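(* Consider the Schwarzschild black hole of mass $m>0$ with the foliation $\Sigma_\tau=\{t^*=\tau\}$ of the exterior, the timelike vector field $N=-(dt^* )^\sharp$ and the horizon portions $\mathcal{H}^+(\tau)$ described in the context. For every $\mu>0$ and for every $\tau>0$ there exists a smooth solution $v\in C^\infty(\overline{\mathcal{D}(\Sigma_0)},\mathbb{C})$ to the wave equation $\Box_gv=0$ with $$E^N_\tau(v)=1\qquad\text{and}\qquad\int_{\mathcal{H}^+(\tau)}J^N(v)\,\lrcorner\,\mathrm{vol}_g<\mu,$$ which satisfies $$E^N_0(v)\ge e^{\kappa\tau}-\mu,$$ where $\kappa=\frac1{4m}$ is the surface gravity of the Schwarzschild black hole.
   Context: Schwarzschild exterior: $M=\mathbb{R}\times(2m,\infty)\times\mathbb{S}^2$ with coordinates $(t,r,\theta,\varphi)$ and $g=-(1-\frac{2m}r)dt^2+(1-\frac{2m}r)^{-1}dr^2+r^2d\theta^2+r^2\sin^2\theta\,d\varphi^2$. Put $t^*=t+2m\log(r-2m)$; the coordinates $(t^*,r,\theta,\varphi)$ extend regularly across the future event horizon $\mathcal{H}^+=\{r=2m\}$ (in the maximal analytic extension). $\Sigma_\tau=\{t^*=\tau\}$ (in the exterior) are spacelike slices, $N=-(dt^* )^\sharp$ is timelike and defines the future direction. $\mathcal{D}(\Sigma_0)$ is the domain of dependence of $\Sigma_0$ in $(M,g)$ and $\overline{\mathcal{D}(\Sigma_0)}$ its closure in the maximal analytic extension of Schwarzschild. $\mathcal{H}^+(\tau)$ is the closed portion of $\mathcal{H}^+$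 cut out by $\Sigma_0$ and $\Sigma_\tau$, i.e. $\{r=2m,\ 0\le t^*\le\tau\}$. Energy. $n_{\Sigma_\tau}$ is the future directed unit normal, $\bar g_\tau$ the induced metric; $\mathbb{T}(u)=\frac12\overline{du}\otimes du+\frac12du\otimes\overline{du}-\frac12g\,g^{-1}(du,\overline{du})$, $J^N(u)=[\mathbb{T}(u)(N,\cdot)]^\sharp$, $E^N_\tau(u)=\int_{\Sigma_\tau}g(J^N(u),n_{\Sigma_\tau})\,\mathrm{vol}_{\bar g_\tau}$. $J^N(v)\lrcorner\mathrm{vol}_g$ is the $3$-form obtained by inserting $J^N(v)$ into the first slot of $\mathrm{vol}_g$; $\mathcal{H}^+(\tau)$ is oriented so that the flux is nonnegative, i.e. the flux equals $\int_0^\tau\int_{\mathbb{S}^2}\mathbb{T}(v)(N,\partial_{t^*})|_{r=2m}(2m)^2\sin\theta\,d\theta\,d\varphi\,dt^*$. *)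

theory Defs
  imports "HOL-Analysis.Analysis"
begin

section \<open>Smooth functions up to the boundary\<close>

primrec Ck_on :: "nat \<Rightarrow> 'a::euclidean_space set \<Rightarrow> ('a \<Rightarrow> 'b::real_normed_vector) \<Rightarrow> bool" where
  "Ck_on 0 S f \<longleftrightarrow> continuous_on S f"
| "Ck_on (Suc k) S f \<longleftrightarrow> (\<forall>x\<in>S. f differentiable (at x)) \<and>
     (\<forall>b\<in>Basis. Ck_on k S (\<lambda>x. frechet_derivative f (at x) b))"

text \<open>For a set \<open>S\<close> that need not be open, a smooth function on \<open>S\<close> is one that is smooth on
  some open neighbourhood of \<open>S\<close>.\<close>

definition smooth_on :: "'a::euclidean_space set \<Rightarrow> ('a \<Rightarrow> 'b::real_normed_vector) \<Rightarrow> bool" where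
  "smooth_on S f \<longleftrightarrow> (\<exists>W. open W \<and> S \<subseteq> W \<and> (\<forall>k. Ck_on k W f))"


section \<open>Lorentzian geometry in a single chart\<close>

text \<open>A metric is given by its matrix of components \<open>G p\<close> in the standard coordinates of
  \<open>real ^ 4\<close>; covectors are represented by their components.\<close>

type_synonym metric = "real ^ 4 \<Rightarrow> real ^ 4 ^ 4"

definition gprod :: "metric \<Rightarrow> real ^ 4 \<Rightarrow> real ^ 4 \<Rightarrow> real ^ 4 \<Rightarrow> real" where
  "gprod G p X Y = X \<bullet> (G p *v Y)"

definition sharp :: "metric \<Rightarrow> real ^ 4 \<Rightarrow> real ^ 4 \<Rightarrow> real ^ 4" where
  "sharp G p \<alpha> = matrix_inv (G p) *v \<alpha>"

definition vol_density :: "metric \<Rightarrow> real ^ 4 \<Rightarrow> real" where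
  "vol_density G p = sqrt \<bar>det (G p)\<bar>"

definition vol_form :: "metric \<Rightarrow> real ^ 4 \<Rightarrow> real ^ 4 \<Rightarrow> real ^ 4 \<Rightarrow> real ^ 4 \<Rightarrow> real ^ 4 \<Rightarrow> real" where
  "vol_form G p A B C D = vol_density G p * det (vector [A, B, C, D] :: real ^ 4 ^ 4)"

definition pderiv_at :: "(real ^ 4 \<Rightarrow> complex) \<Rightarrow> real ^ 4 \<Rightarrow> 4 \<Rightarrow> complex" where
  "pderiv_at u p i = frechet_derivative u (at p) (axis i 1)"

definition wave_op :: "metric \<Rightarrow> (real ^ 4 \<Rightarrow> complex) \<Rightarrow> real ^ 4 \<Rightarrow> complex" where
  "wave_op G u p = complex_of_real (1 / vol_density G p) *
     (\<Sum>i\<in>UNIV. pderiv_at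
        (\<lambda>q. \<Sum>j\<in>UNIV. complex_of_real (vol_density G q * matrix_inv (G q) $ i $ j) * pderiv_at u q j)
        p i)"

text \<open>The expression under \<open>Re\<close> is real; \<open>Re\<close> only adjusts the type.\<close>

definition stress_energy ::
    "metric \<Rightarrow> (real ^ 4 \<Rightarrow> complex) \<Rightarrow> real ^ 4 \<Rightarrow> real ^ 4 \<Rightarrow> real ^ 4 \<Rightarrow> real" where
  "stress_energy G u p X Y =
    (let du = frechet_derivative u (at p) in
     Re (1/2 * (cnj (du X) * du Y) + 1/2 * (du X * cnj (du Y))
       - 1/2 * complex_of_real (gprod G p X Y) *
         (\<Sum>i\<in>UNIV. \<Sum>j\<in>UNIV. complex_of_real (matrix_inv (G p) $ i $ j) *
            pderiv_at u p i * cnj (pderiv_at u p j))))"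

definition current ::
    "metric \<Rightarrow> (real ^ 4 \<Rightarrow> real ^ 4) \<Rightarrow> (real ^ 4 \<Rightarrow> complex) \<Rightarrow> real ^ 4 \<Rightarrow> real ^ 4" where
  "current G Z u p = sharp G p (\<chi> i. stress_energy G u p (Z p) (axis i 1))"


section \<open>Domain of dependence\<close>

text \<open>\<open>Z\<close> is a timelike vector field that fixes the time orientation.\<close>

definition future_causal :: "metric \<Rightarrow> (real ^ 4 \<Rightarrow> real ^ 4) \<Rightarrow> real ^ 4 \<Rightarrow> real ^ 4 \<Rightarrow> bool" where
  "future_causal G Z p X \<longleftrightarrow> X \<noteq> 0 \<and> gprod G p X X \<le> 0 \<and> gprod G p X (Z p) < 0"

definition past_causal :: "metric \<Rightarrow> (real ^ 4 \<Rightarrow> real ^ 4) \<Rightarrow> real ^ 4 \<Rightarrow> real ^ 4 \<Rightarrow> bool" where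
  "past_causal G Z p X \<longleftrightarrow> future_causal G Z p (- X)"

text \<open>Piecewise \<open>C\<^sup>1\<close> curves in \<open>M\<close> starting at \<open>p\<close>, with tangent in the cones \<open>C\<close>, and without
  endpoint in \<open>M\<close>. Parametrising them by the half-line is no restriction. The set \<open>B\<close> collects the
  break points.\<close>

definition inextendible_curve_from ::
    "(real ^ 4) set \<Rightarrow> (real ^ 4 \<Rightarrow> real ^ 4 \<Rightarrow> bool) \<Rightarrow> real ^ 4 \<Rightarrow> (real \<Rightarrow> real ^ 4) \<Rightarrow> bool" where
  "inextendible_curve_from M C p \<gamma> \<longleftrightarrow>
     \<gamma> 0 = p \<and> \<gamma> ` {0..} \<subseteq> M \<and> continuous_on {0..} \<gamma> \<and>
     (\<exists>B. (\<forall>b. finite (B \<inter> {0..b})) \<and> \<gamma> C1_differentiable_on ({0<..} - B) \<and>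
          (\<forall>s\<in>{0<..} - B. C (\<gamma> s) (vector_derivative \<gamma> (at s)))) \<and>
     \<not> (\<exists>q\<in>M. (\<gamma> \<longlongrightarrow> q) at_top)"

definition domain_of_dependence ::
    "metric \<Rightarrow> (real ^ 4 \<Rightarrow> real ^ 4) \<Rightarrow> (real ^ 4) set \<Rightarrow> (real ^ 4) set \<Rightarrow> (real ^ 4) set" where
  "domain_of_dependence G Z M S =
     {p \<in> M. \<forall>\<gamma>. inextendible_curve_from M (past_causal G Z) p \<gamma> \<longrightarrow> \<gamma> ` {0..} \<inter> S \<noteq> {}} \<union>
     {p \<in> M. \<forall>\<gamma>. inextendible_curve_from M (future_causal G Z) p \<gamma> \<longrightarrow> \<gamma> ` {0..} \<inter> S \<noteq> {}}"


section \<open>Schwarzschild\<close>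

text \<open>Coordinates on \<open>real ^ 4\<close>: the first one is \<open>t\<^sup>*\<close>, the other three form the vector \<open>r \<omega>\<close>, where
  \<open>\<omega>\<close> is the point of the unit sphere with angles \<open>\<theta>, \<phi>\<close>. This chart covers the exterior, the future
  event horizon \<open>r = 2m\<close> and the black hole interior, without the coordinate singularities of
  the angles.\<close>

definition tstar :: "real ^ 4 \<Rightarrow> real" where
  "tstar p = p $ 1"

definition space_part :: "real ^ 4 \<Rightarrow> real ^ 3" where
  "space_part p = vector [p $ 2, p $ 3, p $ 4]"

definition radius :: "real ^ 4 \<Rightarrow> real" where
  "radius p = norm (space_part p)"

definition event :: "real \<Rightarrow> real ^ 3 \<Rightarrow> real ^ 4" where
  "event t x = vector [t, x $ 1, x $ 2, x $ 3]"

definition polar :: "real \<Rightarrow> real \<Rightarrow> real \<Rightarrow> real ^ 3" where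
  "polar r \<theta> \<phi> = vector [r * sin \<theta> * cos \<phi>, r * sin \<theta> * sin \<phi>, r * cos \<theta>]"

definition ingoing_chart :: "(real ^ 4) set" where
  "ingoing_chart = {p. radius p > 0}"

definition exterior :: "real \<Rightarrow> (real ^ 4) set" where
  "exterior m = {p. radius p > 2 * m}"

definition null_covector :: "real ^ 4 \<Rightarrow> real ^ 4" where
  "null_covector p = vector [1, p $ 2 / radius p, p $ 3 / radius p, p $ 4 / radius p]"

text \<open>Substituting \<open>t = t\<^sup>* - 2m log (r - 2m)\<close> turns the Schwarzschild metric into
  \<open>- dt\<^sup>*\<^sup>2 + dr\<^sup>2 + r\<^sup>2 (d\<theta>\<^sup>2 + sin\<^sup>2 \<theta> d\<phi>\<^sup>2) + (2m/r) (dt\<^sup>* + dr)\<^sup>2\<close>, which is the metric below; see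
  \<open>schwarzschild_coordinates\<close>.\<close>

definition schw :: "real \<Rightarrow> metric" where
  "schw m p = (\<chi> i j. (if i = j then if i = 1 then - 1 else 1 else 0)
      + 2 * m / radius p * null_covector p $ i * null_covector p $ j)"

definition schw_N :: "real \<Rightarrow> real ^ 4 \<Rightarrow> real ^ 4" where
  "schw_N m p = - sharp (schw m) p (axis 1 1)"

definition Sigma_slice :: "real \<Rightarrow> real \<Rightarrow> (real ^ 4) set" where
  "Sigma_slice m \<tau> = {p \<in> exterior m. tstar p = \<tau>}"

definition unit_normal :: "real \<Rightarrow> real ^ 4 \<Rightarrow> real ^ 4" where
  "unit_normal m p = (1 / sqrt (- gprod (schw m) p (schw_N m p) (schw_N m p))) *\<^sub>R schw_N m p"

definition induced_metric :: "real \<Rightarrow> real \<Rightarrow> real ^ 3 \<Rightarrow> real ^ 3 ^ 3" where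
  "induced_metric m \<tau> x =
     (\<chi> i j. gprod (schw m) (event \<tau> x) (event 0 (axis i 1)) (event 0 (axis j 1)))"

definition energy :: "real \<Rightarrow> real \<Rightarrow> (real ^ 4 \<Rightarrow> complex) \<Rightarrow> real" where
  "energy m \<tau> u =
     (LINT x : {x. event \<tau> x \<in> Sigma_slice m \<tau>} | lborel.
        gprod (schw m) (event \<tau> x)
          (current (schw m) (schw_N m) u (event \<tau> x)) (unit_normal m (event \<tau> x))
        * sqrt (det (induced_metric m \<tau> x)))"

text \<open>The horizon is parametrised by \<open>(t\<^sup>*, \<theta>, \<phi>)\<close>. Its orientation is the one in which
  \<open>(\<partial>\<^sub>t, \<partial>\<^sub>\<phi>, \<partial>\<^sub>\<theta>)\<close> is positive; it makes the flux nonnegative, see \<open>horizon_flux_eq\<close>.\<close>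

definition horizon_point :: "real \<Rightarrow> real \<Rightarrow> real \<Rightarrow> real \<Rightarrow> real ^ 4" where
  "horizon_point m t \<theta> \<phi> = event t (polar (2 * m) \<theta> \<phi>)"

definition horizon_flux :: "real \<Rightarrow> real \<Rightarrow> (real ^ 4 \<Rightarrow> complex) \<Rightarrow> real" where
  "horizon_flux m \<tau> u =
     (LINT (t, \<theta>, \<phi>) : {0..\<tau>} \<times> {0..pi} \<times> {0..2 * pi} | lborel.
        vol_form (schw m) (horizon_point m t \<theta> \<phi>)
          (current (schw m) (schw_N m) u (horizon_point m t \<theta> \<phi>))
          (vector_derivative (\<lambda>s. horizon_point m s \<theta> \<phi>) (at t))
          (vector_derivative (\<lambda>s. horizon_point m t \<theta> s) (at \<phi>))
          (vector_derivative (\<lambda>s. horizon_point m t s \<phi>) (at \<theta>)))"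

definition surface_gravity :: "real \<Rightarrow> real" where
  "surface_gravity m = 1 / (4 * m)"


subsection \<open>The maximal extension\<close>

text \<open>Kruskal's manifold is \<open>{(U, V). U V < 1} \<times> S\<^sup>2\<close> with \<open>U V = (1 - r/2m) exp (r/2m)\<close>; in the
  ingoing chart \<open>V = exp ((t\<^sup>* + r) / 4m)\<close>. Only its topology is needed, for taking closures.\<close>

definition kruskal_space :: "(real \<times> real \<times> (real ^ 3)) set" where
  "kruskal_space = {(U, V, \<omega>). U * V < 1 \<and> norm \<omega> = 1}"

definition kruskal :: "real \<Rightarrow> real ^ 4 \<Rightarrow> real \<times> real \<times> (real ^ 3)" where
  "kruskal m p =
     ((1 - radius p / (2 * m)) * exp ((radius p - tstar p) / (4 * m)),
      exp ((tstar p + radius p) / (4 * m)),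
      (1 / radius p) *\<^sub>R space_part p)"

definition dep_Sigma0 :: "real \<Rightarrow> (real ^ 4) set" where
  "dep_Sigma0 m = domain_of_dependence (schw m) (schw_N m) (exterior m) (Sigma_slice m 0)"

text \<open>The closure of \<open>D(\<Sigma>\<^sub>0)\<close> in Kruskal's manifold, expressed in the ingoing chart. By
  \<open>kruskal_closure\<close> below, that closure lies entirely in the range of the chart.\<close>

definition closed_dep_Sigma0 :: "real \<Rightarrow> (real ^ 4) set" where
  "closed_dep_Sigma0 m = {p \<in> ingoing_chart. kruskal m p \<in> closure (kruskal m ` dep_Sigma0 m)}"

section \<open>Consistency of the definitions\<close>

lemma vector_4 [simp]:
  "(vector [x, y, z, w] :: ('a::zero) ^ 4) $ 1 = x"
  "(vector [x, y, z, w] :: ('a::zero) ^ 4) $ 2 = y"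
  "(vector [x, y, z, w] :: ('a::zero) ^ 4) $ 3 = z"
  "(vector [x, y, z, w] :: ('a::zero) ^ 4) $ 4 = w"
  unfolding vector_def by simp_all

lemma det_4:
  "det (A :: 'a::comm_ring_1 ^ 4 ^ 4) =
     A$1$1 * (A$2$2 * (A$3$3 * A$4$4 - A$3$4 * A$4$3) - A$2$3 * (A$3$2 * A$4$4 - A$3$4 * A$4$2)
       + A$2$4 * (A$3$2 * A$4$3 - A$3$3 * A$4$2))
   - A$1$2 * (A$2$1 * (A$3$3 * A$4$4 - A$3$4 * A$4$3) - A$2$3 * (A$3$1 * A$4$4 - A$3$4 * A$4$1)
       + A$2$4 * (A$3$1 * A$4$3 - A$3$3 * A$4$1))
   + A$1$3 * (A$2$1 * (A$3$2 * A$4$4 - A$3$4 * A$4$2) - A$2$2 * (A$3$1 * A$4$4 - A$3$4 * A$4$1)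
       + A$2$4 * (A$3$1 * A$4$2 - A$3$2 * A$4$1))
   - A$1$4 * (A$2$1 * (A$3$2 * A$4$3 - A$3$3 * A$4$2) - A$2$2 * (A$3$1 * A$4$3 - A$3$3 * A$4$1)
       + A$2$3 * (A$3$1 * A$4$2 - A$3$2 * A$4$1))"
proof -
  have f1: "finite {2::4, 3, 4}" "1 \<notin> {2::4, 3, 4}" by auto
  have f2: "finite {3::4, 4}" "2 \<notin> {3::4, 4}" by auto
  have f3: "finite {4::4}" "3 \<notin> {4::4}" by auto
  show ?thesis
    unfolding det_def UNIV_4
    unfolding sum_over_permutations_insert[OF f1]
    unfolding sum_over_permutations_insert[OF f2]
    unfolding sum_over_permutations_insert[OF f3]
    unfolding permutes_sing
    by (simp add: sign_swap_id permutation_swap_id permutation_compose sign_compose sign_id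
        swap_id_eq algebra_simps)
qed

lemma radius_sq: "(radius p)\<^sup>2 = (p $ 2)\<^sup>2 + (p $ 3)\<^sup>2 + (p $ 4)\<^sup>2"
  by (simp add: radius_def space_part_def norm_eq_sqrt_inner inner_vec_def sum_3 power2_eq_square)

lemma radius_nonneg [simp]: "radius p \<ge> 0"
  by (simp add: radius_def)

lemma unit_direction:
  assumes "radius p > 0"
  shows "(p $ 2 / radius p)\<^sup>2 + (p $ 3 / radius p)\<^sup>2 + (p $ 4 / radius p)\<^sup>2 = 1"
proof -
  have "(p $ 2 / radius p)\<^sup>2 + (p $ 3 / radius p)\<^sup>2 + (p $ 4 / radius p)\<^sup>2
      = ((p $ 2)\<^sup>2 + (p $ 3)\<^sup>2 + (p $ 4)\<^sup>2) / (radius p)\<^sup>2"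
    by (simp add: power_divide add_divide_distrib)
  then show ?thesis using assms by (simp add: radius_sq[symmetric])
qed

definition schw_inv :: "real \<Rightarrow> metric" where
  "schw_inv m p = (\<chi> i j. (if i = j then if i = 1 then - 1 else 1 else 0)
      - 2 * m / radius p * (null_covector p $ i * (if i = 1 then - 1 else 1))
        * (null_covector p $ j * (if j = 1 then - 1 else 1)))"

lemma schw_mult_inv:
  assumes "radius p > 0"
  shows "schw m p ** schw_inv m p = mat 1" "schw_inv m p ** schw m p = mat 1"
proof -
  define a b c where "a = p $ 2 / radius p" and "b = p $ 3 / radius p" and "c = p $ 4 / radius p"
  define h where "h = 2 * m / radius p"
  have c2: "c * c = 1 - a * a - b * b"
    using unit_direction[OF assms] by (simp add: a_def b_def c_def power2_eq_square)
  show "schw m p ** schw_inv m p = mat 1" "schw_inv m p ** schw m p = mat 1"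
    unfolding vec_eq_iff forall_4
    using c2
    by (simp_all add: matrix_matrix_mult_def schw_def schw_inv_def mat_def sum_4 null_covector_def
        a_def[symmetric] b_def[symmetric] c_def[symmetric] h_def[symmetric]; algebra)+
qed

lemma matrix_inv_schw:
  assumes "radius p > 0"
  shows "matrix_inv (schw m p) = schw_inv m p"
proof -
  have ex: "\<exists>B. schw m p ** B = mat 1 \<and> B ** schw m p = mat 1"
    using schw_mult_inv[OF assms] by blast
  have "schw m p ** matrix_inv (schw m p) = mat 1"
    unfolding matrix_inv_def using someI_ex[OF ex] by blast
  then have "schw_inv m p ** (schw m p ** matrix_inv (schw m p)) = schw_inv m p"
    by simp
  then show ?thesis
    by (simp add: matrix_mul_assoc schw_mult_inv[OF assms])
qed

lemma det_schw:
  assumes "radius p > 0"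
  shows "det (schw m p) = - 1"
proof -
  define a b c where "a = p $ 2 / radius p" and "b = p $ 3 / radius p" and "c = p $ 4 / radius p"
  define h where "h = 2 * m / radius p"
  have c2: "c * c = 1 - a * a - b * b"
    using unit_direction[OF assms] by (simp add: a_def b_def c_def power2_eq_square)
  show ?thesis
    unfolding det_4 using c2
    by (simp add: schw_def null_covector_def
        a_def[symmetric] b_def[symmetric] c_def[symmetric] h_def[symmetric]) algebra
qed

lemma gprod_schw:
  "gprod (schw m) p X Y = - X $ 1 * Y $ 1 + X $ 2 * Y $ 2 + X $ 3 * Y $ 3 + X $ 4 * Y $ 4
     + 2 * m / radius p * (null_covector p \<bullet> X) * (null_covector p \<bullet> Y)"
proof -
  define h where "h = 2 * m / radius p"
  show ?thesis
    unfolding schw_def gprod_def h_def[symmetric]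
    by (simp add: matrix_vector_mult_def inner_vec_def sum_4) (simp add: algebra_simps)
qed

lemma gprod_sharp:
  assumes "radius p > 0"
  shows "gprod (schw m) p (sharp (schw m) p \<alpha>) X = \<alpha> \<bullet> X"
proof -
  have sym: "transpose (schw m p) = schw m p"
    by (simp add: transpose_def schw_def vec_eq_iff mult_ac)
  have "gprod (schw m) p (sharp (schw m) p \<alpha>) X = (schw m p *v (schw_inv m p *v \<alpha>)) \<bullet> X"
    unfolding gprod_def sharp_def matrix_inv_schw[OF assms]
    by (metis dot_lmul_matrix sym transpose_matrix_vector)
  also have "\<dots> = \<alpha> \<bullet> X"
    by (simp add: matrix_vector_mul_assoc schw_mult_inv[OF assms])
  finally show ?thesis .
qed

lemma gprod_commute: "gprod (schw m) p X Y = gprod (schw m) p Y X"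
  by (simp add: gprod_schw mult_ac)

lemma gprod_schw_N:
  assumes "radius p > 0"
  shows "gprod (schw m) p X (schw_N m p) = - X $ 1"
proof -
  have "gprod (schw m) p (schw_N m p) X = - (axis 1 1 \<bullet> X)"
    using gprod_sharp[OF assms, of m "axis 1 1" X]
    by (simp add: schw_N_def gprod_def)
  then show ?thesis
    by (simp add: gprod_commute inner_axis' )
qed

lemma gprod_N_N:
  assumes "radius p > 0"
  shows "gprod (schw m) p (schw_N m p) (schw_N m p) = - (1 + 2 * m / radius p)"
  unfolding gprod_schw_N[OF assms]
  by (simp add: schw_N_def sharp_def matrix_inv_schw[OF assms] schw_inv_def matrix_vector_mult_def
      sum_4 null_covector_def axis_def)

lemma unit_normal_properties:
  assumes "m > 0" "radius p > 0"
  shows "gprod (schw m) p (unit_normal m p) (unit_normal m p) = - 1"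
    and "gprod (schw m) p (unit_normal m p) (event 0 x) = 0"
    and "gprod (schw m) p (unit_normal m p) (schw_N m p) < 0"
proof -
  define L where "L = 1 + 2 * m / radius p"
  have L: "L > 0" using assms by (simp add: L_def add_pos_pos)
  have n: "unit_normal m p = (1 / sqrt L) *\<^sub>R schw_N m p"
    by (simp add: unit_normal_def gprod_N_N[OF assms(2)] L_def)
  have sc: "gprod (schw m) p (a *\<^sub>R X) (b *\<^sub>R Y) = a * b * gprod (schw m) p X Y" for a b X Y
    by (simp add: gprod_def matrix_vector_mult_scaleR)
  show "gprod (schw m) p (unit_normal m p) (unit_normal m p) = - 1"
    unfolding n sc gprod_N_N[OF assms(2)] using L by (simp add: L_def[symmetric])
  show "gprod (schw m) p (unit_normal m p) (schw_N m p) < 0"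
    using sc[of "1 / sqrt L" "schw_N m p" 1 "schw_N m p"] L
    by (simp add: n gprod_N_N[OF assms(2)] L_def[symmetric])
  show "gprod (schw m) p (unit_normal m p) (event 0 x) = 0"
    using sc[of "1 / sqrt L" "schw_N m p" 1 "event 0 x"]
    by (simp add: n gprod_commute[of m p "schw_N m p"] gprod_schw_N[OF assms(2)] event_def)
qed

text \<open>In the coordinates \<open>(t, r, \<theta>, \<phi>)\<close> the metric takes its usual diagonal form.\<close>

definition from_schwarzschild :: "real \<Rightarrow> real \<times> real \<times> real \<times> real \<Rightarrow> real ^ 4" where
  "from_schwarzschild m = (\<lambda>(t, r, \<theta>, \<phi>). event (t + 2 * m * ln (r - 2 * m)) (polar r \<theta> \<phi>))"

lemma radius_event: "radius (event t x) = norm x"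
  by (simp add: radius_def space_part_def event_def norm_eq_sqrt_inner inner_vec_def sum_3)

lemma norm_polar: "norm (polar r \<theta> \<phi>) = \<bar>r\<bar>"
proof -
  have "(norm (polar r \<theta> \<phi>))\<^sup>2 = (r * sin \<theta> * cos \<phi>)\<^sup>2 + (r * sin \<theta> * sin \<phi>)\<^sup>2 + (r * cos \<theta>)\<^sup>2"
    unfolding power2_norm_eq_inner by (simp add: polar_def inner_vec_def sum_3 power2_eq_square)
  also have "\<dots> = r\<^sup>2 * ((sin \<theta>)\<^sup>2 * ((cos \<phi>)\<^sup>2 + (sin \<phi>)\<^sup>2) + (cos \<theta>)\<^sup>2)"
    by (simp only: power_mult_distrib distrib_left distrib_right mult.assoc)
  also have "\<dots> = r\<^sup>2" by simp
  finally show ?thesis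
    by (metis norm_ge_zero real_sqrt_abs abs_of_nonneg)
qed

lemma vector_4_axis:
  "(vector [a, b, c, d] :: real ^ 4) = a *\<^sub>R axis 1 1 + b *\<^sub>R axis 2 1 + c *\<^sub>R axis 3 1 + d *\<^sub>R axis 4 1"
  by (simp add: vec_eq_iff forall_4 axis_def)

lemma schwarzschild_coordinates:
  fixes t r \<theta> \<phi> :: real
  assumes "m > 0" "r > 2 * m"
  defines "D \<equiv> frechet_derivative (from_schwarzschild m) (at (t, r, \<theta>, \<phi>))"
  shows "from_schwarzschild m differentiable (at (t, r, \<theta>, \<phi>))"
    and "from_schwarzschild m (t, r, \<theta>, \<phi>) \<in> exterior m"
    and "tstar (from_schwarzschild m (t, r, \<theta>, \<phi>)) = t + 2 * m * ln (r - 2 * m)"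
    and "gprod (schw m) (from_schwarzschild m (t, r, \<theta>, \<phi>)) (D (a, b, c, d)) (D (a', b', c', d')) =
      - (1 - 2 * m / r) * a * a' + inverse (1 - 2 * m / r) * b * b' + r\<^sup>2 * c * c'
      + r\<^sup>2 * (sin \<theta>)\<^sup>2 * d * d'"
proof -
  define E where "E = (\<lambda>(a, b, c, d). vector [a + 2 * m * b / (r - 2 * m),
     b * sin \<theta> * cos \<phi> + r * cos \<theta> * cos \<phi> * c - r * sin \<theta> * sin \<phi> * d,
     b * sin \<theta> * sin \<phi> + r * cos \<theta> * sin \<phi> * c + r * sin \<theta> * cos \<phi> * d,
     b * cos \<theta> - r * sin \<theta> * c] :: real ^ 4)"
  have der: "(from_schwarzschild m has_derivative E) (at (t, r, \<theta>, \<phi>))"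
    unfolding from_schwarzschild_def E_def event_def polar_def vector_4_axis case_prod_unfold vector_3
    using assms(1,2)
    by (auto intro!: derivative_eq_intros simp: fun_eq_iff algebra_simps divide_inverse)
  then show "from_schwarzschild m differentiable (at (t, r, \<theta>, \<phi>))"
    by (auto simp: differentiable_def)
  have D: "D = E" unfolding D_def using frechet_derivative_at[OF der] by simp
  define p where "p = from_schwarzschild m (t, r, \<theta>, \<phi>)"
  have rad: "radius p = r"
    using assms by (simp add: p_def from_schwarzschild_def radius_event norm_polar)
  then show "from_schwarzschild m (t, r, \<theta>, \<phi>) \<in> exterior m"
    using assms by (simp add: exterior_def p_def)
  show "tstar (from_schwarzschild m (t, r, \<theta>, \<phi>)) = t + 2 * m * ln (r - 2 * m)"
    by (simp add: tstar_def from_schwarzschild_def event_def)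
  have r0: "r \<noteq> 0" using assms by auto
  define x y z w where "x = sin \<theta>" and "y = cos \<theta>" and "z = sin \<phi>" and "w = cos \<phi>"
  have sq: "x * x = 1 - y * y" "z * z = 1 - w * w"
    using sin_cos_squared_add3[of \<theta>] sin_cos_squared_add3[of \<phi>]
    unfolding x_def y_def z_def w_def by linarith+
  have l: "null_covector p = vector [1, x * w, x * z, y]"
    using r0 unfolding null_covector_def rad
    by (simp add: p_def from_schwarzschild_def event_def polar_def x_def y_def z_def w_def)
  have dr: "null_covector p \<bullet> E (a, b, c, d) = a + 2 * m * b / (r - 2 * m) + b" for a b c d
    unfolding l E_def x_def[symmetric] y_def[symmetric] z_def[symmetric] w_def[symmetric]
    using sq by (simp add: inner_vec_def sum_4) algebra
  define k where "k = 2 * m / (r - 2 * m)"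
  have k: "2 * m * b / (r - 2 * m) = k * b" for b by (simp add: k_def)
  have fl: "- E (a, b, c, d) $ 1 * E (a', b', c', d') $ 1 + E (a, b, c, d) $ 2 * E (a', b', c', d') $ 2
      + E (a, b, c, d) $ 3 * E (a', b', c', d') $ 3 + E (a, b, c, d) $ 4 * E (a', b', c', d') $ 4
      = - (a + k * b) * (a' + k * b') + b * b' + r\<^sup>2 * c * c' + r\<^sup>2 * x\<^sup>2 * d * d'"
    unfolding E_def x_def[symmetric] y_def[symmetric] z_def[symmetric] w_def[symmetric] k prod.case vector_4
    using sq by algebra
  have "gprod (schw m) p (E (a, b, c, d)) (E (a', b', c', d'))
      = - (a + k * b) * (a' + k * b') + b * b' + r\<^sup>2 * c * c' + r\<^sup>2 * x\<^sup>2 * d * d'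
        + 2 * m / r * (a + k * b + b) * (a' + k * b' + b')"
    unfolding gprod_schw rad dr k fl by simp
  also have "\<dots> = - (1 - 2 * m / r) * a * a' + inverse (1 - 2 * m / r) * b * b' + r\<^sup>2 * c * c'
      + r\<^sup>2 * x\<^sup>2 * d * d'"
  proof -
    define h where "h = 2 * m / r"
    have h1: "h \<noteq> 1" using assms r0 by (simp add: h_def field_simps)
    have kh: "k = h / (1 - h)"
      using assms r0 unfolding k_def h_def by (simp add: field_simps)
    have "- (a + k * b) * (a' + k * b') + b * b' + h * (a + k * b + b) * (a' + k * b' + b')
        = - (1 - h) * a * a' + inverse (1 - h) * b * b'"
      using h1 unfolding kh by (simp add: divide_simps) algebra
    then show ?thesis unfolding h_def[symmetric] by simp
  qed
  finally show "gprod (schw m) (from_schwarzschild m (t, r, \<theta>, \<phi>)) (D (a, b, c, d)) (D (a', b', c', d')) =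
      - (1 - 2 * m / r) * a * a' + inverse (1 - 2 * m / r) * b * b' + r\<^sup>2 * c * c'
      + r\<^sup>2 * (sin \<theta>)\<^sup>2 * d * d'"
    by (simp add: D p_def x_def)
qed

lemma horizon_flux_eq:
  assumes "m > 0"
  shows "horizon_flux m \<tau> u =
     (LINT (t, \<theta>, \<phi>) : {0..\<tau>} \<times> {0..pi} \<times> {0..2 * pi} | lborel.
        stress_energy (schw m) u (horizon_point m t \<theta> \<phi>) (schw_N m (horizon_point m t \<theta> \<phi>)) (axis 1 1)
        * ((2 * m)\<^sup>2 * sin \<theta>))"
proof -
  have "vol_form (schw m) (horizon_point m t \<theta> \<phi>)
          (current (schw m) (schw_N m) u (horizon_point m t \<theta> \<phi>))
          (vector_derivative (\<lambda>s. horizon_point m s \<theta> \<phi>) (at t))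
          (vector_derivative (\<lambda>s. horizon_point m t \<theta> s) (at \<phi>))
          (vector_derivative (\<lambda>s. horizon_point m t s \<phi>) (at \<theta>))
     = stress_energy (schw m) u (horizon_point m t \<theta> \<phi>) (schw_N m (horizon_point m t \<theta> \<phi>)) (axis 1 1)
        * ((2 * m)\<^sup>2 * sin \<theta>)" for t \<theta> \<phi>
  proof -
    define p where "p = horizon_point m t \<theta> \<phi>"
    have rad: "radius p = 2 * m"
      using assms by (simp add: p_def horizon_point_def radius_event norm_polar)
    then have pos: "radius p > 0" using assms by simp
    define x y z w where "x = sin \<theta>" and "y = cos \<theta>" and "z = sin \<phi>" and "w = cos \<phi>"
    have sq: "x * x + y * y = 1" "z * z + w * w = 1"
      using sin_cos_squared_add3[of \<theta>] sin_cos_squared_add3[of \<phi>]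
      by (simp_all add: x_def y_def z_def w_def add.commute)
    define J where "J = current (schw m) (schw_N m) u p"
    have l: "null_covector p = vector [1, x * w, x * z, y]"
      using assms unfolding null_covector_def rad
      by (simp add: p_def horizon_point_def event_def polar_def x_def y_def z_def w_def)
    have T: "stress_energy (schw m) u p (schw_N m p) (axis 1 1) = x * w * J $ 2 + x * z * J $ 3 + y * J $ 4"
    proof -
      have "gprod (schw m) p J (axis 1 1) = stress_energy (schw m) u p (schw_N m p) (axis 1 1)"
        unfolding J_def current_def gprod_sharp[OF pos] by (simp add: inner_axis)
      moreover have "gprod (schw m) p J (axis 1 1) = x * w * J $ 2 + x * z * J $ 3 + y * J $ 4"
        using assms unfolding gprod_schw l rad by (simp add: inner_vec_def sum_4 axis_def)
      ultimately show ?thesis by simp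
    qed
    have d1: "vector_derivative (\<lambda>s. horizon_point m s \<theta> \<phi>) (at t) = vector [1, 0, 0, 0]"
      unfolding horizon_point_def event_def polar_def vector_4_axis vector_3
      by (rule vector_derivative_at) (auto intro!: derivative_eq_intros)
    have d2: "vector_derivative (\<lambda>s. horizon_point m t \<theta> s) (at \<phi>)
        = vector [0, - 2 * m * x * z, 2 * m * x * w, 0]"
      unfolding horizon_point_def event_def polar_def vector_4_axis vector_3 x_def y_def z_def w_def
      by (rule vector_derivative_at) (auto intro!: derivative_eq_intros simp: mult_ac)
    have d3: "vector_derivative (\<lambda>s. horizon_point m t s \<phi>) (at \<theta>)
        = vector [0, 2 * m * y * w, 2 * m * y * z, - 2 * m * x]"
      unfolding horizon_point_def event_def polar_def vector_4_axis vector_3 x_def y_def z_def w_def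
      by (rule vector_derivative_at) (auto intro!: derivative_eq_intros simp: mult_ac)
    have "vol_form (schw m) p J (vector [1, 0, 0, 0]) (vector [0, - 2 * m * x * z, 2 * m * x * w, 0])
        (vector [0, 2 * m * y * w, 2 * m * y * z, - 2 * m * x])
      = (x * w * J $ 2 + x * z * J $ 3 + y * J $ 4) * ((2 * m)\<^sup>2 * x)"
    proof -
      have "vol_density (schw m) p = 1" by (simp add: vol_density_def det_schw[OF pos])
      then show ?thesis
        unfolding vol_form_def det_4 vector_4 using sq by simp algebra
    qed
    then show ?thesis
      unfolding p_def[symmetric] d1 d2 d3 J_def[symmetric] T x_def[symmetric] .
  qed
  then show ?thesis by (simp add: horizon_flux_def)
qed

lemma dep_Sigma0_subset:
  assumes "m > 0" "p \<in> dep_Sigma0 m"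
  shows "p \<in> exterior m" "tstar p + radius p > 2 * m"
proof -
  show ext: "p \<in> exterior m"
    using assms by (auto simp: dep_Sigma0_def domain_of_dependence_def)
  then have r: "radius p > 2 * m" by (simp add: exterior_def)
  with assms have pos: "radius p > 0" by simp
  show "tstar p + radius p > 2 * m"
  proof (rule ccontr)
    assume "\<not> tstar p + radius p > 2 * m"
    then have v: "tstar p + radius p \<le> 2 * m" by simp
    define n where "n = (1 / radius p) *\<^sub>R space_part p"
    have nn: "norm n = 1" using pos by (simp add: n_def radius_def)
    have peq: "event (tstar p) (radius p *\<^sub>R n) = p"
      using pos by (simp add: vec_eq_iff forall_4 event_def tstar_def n_def space_part_def)
    define \<rho> where "\<rho> s = (radius p - 2 * m) * exp (- s)" for s :: real
    define \<gamma> where "\<gamma> s = event (tstar p + radius p - 2 * m - \<rho> s) ((2 * m + \<rho> s) *\<^sub>R n)" for s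
    define \<gamma>' where "\<gamma>' s = event (\<rho> s) (- \<rho> s *\<^sub>R n)" for s
    have \<rho>pos: "\<rho> s > 0" for s using r by (simp add: \<rho>_def)
    have rad: "radius (\<gamma> s) = 2 * m + \<rho> s" for s
      using \<rho>pos[of s] assms(1) nn by (simp add: \<gamma>_def radius_event)
    have radpos: "radius (\<gamma> s) > 0" for s using \<rho>pos[of s] assms(1) by (simp add: rad)
    have der: "(\<gamma> has_vector_derivative \<gamma>' s) (at s)" for s
      unfolding \<gamma>_def[abs_def] \<gamma>'_def \<rho>_def event_def vector_4_axis
      by (auto intro!: derivative_eq_intros simp: algebra_simps)
    have cont: "continuous_on S \<gamma>" for S
      using der by (meson continuous_at_imp_continuous_on has_vector_derivative_continuous)
    have cont': "continuous_on S \<gamma>'" for S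
      unfolding \<gamma>'_def \<rho>_def event_def vector_4_axis by (auto intro!: continuous_intros)
    have n2: "n $ 1 * n $ 1 + n $ 2 * n $ 2 + n $ 3 * n $ 3 = 1"
      using nn by (simp add: norm_eq_1 inner_vec_def sum_3)
    have lc: "null_covector (\<gamma> s) = vector [1, n $ 1, n $ 2, n $ 3]" for s
      using \<rho>pos[of s] assms(1) unfolding null_covector_def rad
      by (simp add: \<gamma>_def event_def)
    have "null_covector (\<gamma> s) \<bullet> \<gamma>' s = 0" for s
      unfolding lc using n2 by (simp add: \<gamma>'_def event_def inner_vec_def sum_4) algebra
    moreover have "- \<gamma>' s $ 1 * \<gamma>' s $ 1 + \<gamma>' s $ 2 * \<gamma>' s $ 2 + \<gamma>' s $ 3 * \<gamma>' s $ 3 + \<gamma>' s $ 4 * \<gamma>' s $ 4 = 0" for s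
      using n2 by (simp add: \<gamma>'_def event_def) algebra
    ultimately have null: "gprod (schw m) (\<gamma> s) (\<gamma>' s) (\<gamma>' s) = 0" for s
      unfolding gprod_schw by simp
    have g1: "\<gamma>' s $ 1 = \<rho> s" for s by (simp add: \<gamma>'_def event_def)
    have fut: "future_causal (schw m) (schw_N m) (\<gamma> s) (\<gamma>' s)" for s
      unfolding future_causal_def gprod_schw_N[OF radpos] null g1
      using \<rho>pos[of s] g1[of s] by auto
    have inM: "\<gamma> s \<in> exterior m" for s using \<rho>pos[of s] by (simp add: exterior_def rad)
    have tneg: "tstar (\<gamma> s) < 0" for s
      using \<rho>pos[of s] v by (simp add: tstar_def \<gamma>_def event_def)
    have lim: "(\<gamma> \<longlongrightarrow> event (tstar p + radius p - 2 * m) ((2 * m) *\<^sub>R n)) at_top"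
    proof -
      have "((\<lambda>s. exp (- s)) \<longlongrightarrow> (0::real)) at_top"
        by (intro filterlim_compose[OF exp_at_bot] filterlim_uminus_at_bot_at_top)
      then have "(\<rho> \<longlongrightarrow> 0) at_top"
        unfolding \<rho>_def[abs_def] by (rule tendsto_mult_right_zero)
      then show ?thesis
        unfolding \<gamma>_def[abs_def] event_def vector_4_axis
        by (auto intro!: tendsto_eq_intros)
    qed
    have fin: "\<not> (\<exists>q\<in>exterior m. (\<gamma> \<longlongrightarrow> q) at_top)"
    proof
      assume "\<exists>q\<in>exterior m. (\<gamma> \<longlongrightarrow> q) at_top"
      then obtain q where q: "q \<in> exterior m" "(\<gamma> \<longlongrightarrow> q) at_top" by blast
      then have "q = event (tstar p + radius p - 2 * m) ((2 * m) *\<^sub>R n)"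
        using lim tendsto_unique trivial_limit_at_top_linorder by blast
      with q(1) assms(1) nn show False by (simp add: exterior_def radius_event)
    qed
    have inext: "inextendible_curve_from (exterior m) (future_causal (schw m) (schw_N m)) p \<gamma>"
      unfolding inextendible_curve_from_def
    proof (intro conjI exI[of _ "{}"] fin cont)
      show "\<gamma> 0 = p" using peq by (simp add: \<gamma>_def \<rho>_def)
      show "\<gamma> ` {0..} \<subseteq> exterior m" using inM by blast
      show "\<gamma> C1_differentiable_on {0<..} - {}"
        unfolding C1_differentiable_on_def using der cont' by blast
      show "\<forall>s\<in>{0<..} - {}. future_causal (schw m) (schw_N m) (\<gamma> s) (vector_derivative \<gamma> (at s))"
        using fut by (simp add: vector_derivative_at[OF der])
    qed simp
    have miss: "\<gamma> ` {0..} \<inter> Sigma_slice m 0 = {}"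
    proof -
      have "tstar (\<gamma> s) \<noteq> 0" for s using tneg[of s] by simp
      then show ?thesis by (auto simp: Sigma_slice_def)
    qed

    define \<beta> where "\<beta> s = event (tstar p - s) (radius p *\<^sub>R n)" for s
    have \<beta>der: "(\<beta> has_vector_derivative - axis 1 1) (at s)" for s
      unfolding \<beta>_def[abs_def] event_def vector_4_axis
      by (auto intro!: derivative_eq_intros)
    have \<beta>rad: "radius (\<beta> s) = radius p" for s
      using pos nn by (simp add: \<beta>_def radius_event)
    have \<beta>past: "past_causal (schw m) (schw_N m) (\<beta> s) (- axis 1 1)" for s
    proof -
      have "gprod (schw m) (\<beta> s) (axis 1 1) (axis 1 1) = - 1 + 2 * m / radius p"
        unfolding gprod_schw \<beta>rad by (simp add: axis_def inner_vec_def sum_4 null_covector_def)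
      also have "\<dots> \<le> 0" using r pos by simp
      finally show ?thesis
        using gprod_schw_N[of "\<beta> s" m "axis 1 1"] pos
        by (simp add: past_causal_def future_causal_def \<beta>rad axis_def vec_eq_iff)
    qed
    have \<beta>fin: "\<not> (\<exists>q\<in>exterior m. (\<beta> \<longlongrightarrow> q) at_top)"
    proof
      assume "\<exists>q\<in>exterior m. (\<beta> \<longlongrightarrow> q) at_top"
      then obtain q where "(\<beta> \<longlongrightarrow> q) at_top" by blast
      then have "((\<lambda>s. \<beta> s $ 1) \<longlongrightarrow> q $ 1) at_top" by (rule tendsto_vec_nth)
      then have "((\<lambda>s. tstar p - (tstar p - s)) \<longlongrightarrow> tstar p - q $ 1) at_top"
        by (intro tendsto_diff tendsto_const) (simp add: \<beta>_def event_def)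
      then have "((\<lambda>s::real. s) \<longlongrightarrow> tstar p - q $ 1) at_top" by simp
      then show False
        using not_tendsto_and_filterlim_at_infinity[OF _ _ filterlim_mono[OF filterlim_ident at_top_le_at_infinity order_refl]]
        by (metis trivial_limit_at_top_linorder)
    qed
    have \<beta>inext: "inextendible_curve_from (exterior m) (past_causal (schw m) (schw_N m)) p \<beta>"
      unfolding inextendible_curve_from_def
    proof (intro conjI exI[of _ "{}"] \<beta>fin)
      show "\<beta> 0 = p" using peq by (simp add: \<beta>_def)
      show "\<beta> ` {0..} \<subseteq> exterior m" using r by (auto simp: exterior_def \<beta>rad)
      show "continuous_on {0..} \<beta>"
        using \<beta>der by (meson continuous_at_imp_continuous_on has_vector_derivative_continuous)
      show "\<beta> C1_differentiable_on {0<..} - {}"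
        unfolding C1_differentiable_on_def
        by (rule exI[of _ "\<lambda>_. - axis 1 1"]) (use \<beta>der in \<open>auto intro: continuous_intros\<close>)
      show "\<forall>s\<in>{0<..} - {}. past_causal (schw m) (schw_N m) (\<beta> s) (vector_derivative \<beta> (at s))"
        using \<beta>past by (simp add: vector_derivative_at[OF \<beta>der])
    qed simp
    have \<beta>miss: "\<beta> ` {0..} \<inter> Sigma_slice m 0 = {}"
    proof -
      have "tstar (\<beta> s) \<noteq> 0" if "s \<ge> 0" for s
        using v r that by (simp add: tstar_def \<beta>_def event_def)
      then show ?thesis by (auto simp: Sigma_slice_def)
    qed
    show False
      using assms(2) inext miss \<beta>inext \<beta>miss
      unfolding dep_Sigma0_def domain_of_dependence_def by blast
  qed
qed

lemma Sigma_slice_subset_dep: "Sigma_slice m 0 \<subseteq> dep_Sigma0 m"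
proof
  fix p assume p: "p \<in> Sigma_slice m 0"
  have "\<gamma> ` {0..} \<inter> Sigma_slice m 0 \<noteq> {}" if "inextendible_curve_from M C p \<gamma>" for M C \<gamma>
    using that p unfolding inextendible_curve_from_def by force
  with p show "p \<in> dep_Sigma0 m"
    unfolding dep_Sigma0_def domain_of_dependence_def Sigma_slice_def by blast
qed

lemma kruskal_range:
  assumes "m > 0"
  shows "kruskal m ` ingoing_chart = {(U, V, \<omega>) \<in> kruskal_space. V > 0}"
proof (intro set_eqI iffI)
  fix z assume "z \<in> kruskal m ` ingoing_chart"
  then obtain p where p: "radius p > 0" "z = kruskal m p" by (auto simp: ingoing_chart_def)
  define q where "q = radius p / (2 * m)"
  have q: "q > 0" using p assms by (simp add: q_def)
  have "(1 - q) * exp ((radius p - tstar p) / (4 * m)) * exp ((tstar p + radius p) / (4 * m)) = (1 - q) * exp q"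
    using assms by (simp add: q_def mult.assoc exp_add[symmetric] add_divide_distrib[symmetric])
  moreover have "(1 - q) * exp q < 1"
  proof -
    have "1 - q < exp (- q)" using exp_minus_greater[of q] q by simp
    then show ?thesis by (simp add: exp_minus field_simps)
  qed
  moreover have "norm ((1 / radius p) *\<^sub>R space_part p) = 1" using p by (simp add: radius_def)
  ultimately have "(1 - q) * exp ((radius p - tstar p) / (4 * m)) * exp ((tstar p + radius p) / (4 * m)) < 1
      \<and> norm ((1 / radius p) *\<^sub>R space_part p) = 1" by metis
  then show "z \<in> {(U, V, \<omega>) \<in> kruskal_space. V > 0}"
    unfolding p(2) kruskal_def kruskal_space_def q_def mem_Collect_eq prod.case
    by (intro conjI exp_gt_zero) (erule conjunct1, erule conjunct2)
next
  fix z assume "z \<in> {(U, V, \<omega>) \<in> kruskal_space. V > 0}"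
  moreover obtain U V n where zn: "z = (U, V, n)" by (rule prod_cases3)
  ultimately have z: "z = (U, V, n)" "U * V < 1" "norm n = 1" "V > 0"
    by (simp_all add: kruskal_space_def)
  have "\<exists>q\<ge>0. q \<le> 1 + \<bar>U * V\<bar> \<and> (1 - q) * exp q = U * V"
  proof (rule IVT2'[of "\<lambda>q. (1 - q) * exp q"])
    show "U * V \<le> (1 - 0) * exp 0" using z by simp
    show "(1 - (1 + \<bar>U * V\<bar>)) * exp (1 + \<bar>U * V\<bar>) \<le> U * V"
    proof -
      have "\<bar>U * V\<bar> * 1 \<le> \<bar>U * V\<bar> * exp (1 + \<bar>U * V\<bar>)" by (intro mult_left_mono) auto
      then show ?thesis by (simp add: abs_if split: if_splits)
    qed
    show "continuous_on {0..1 + \<bar>U * V\<bar>} (\<lambda>q. (1 - q) * exp q)"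
      by (intro continuous_intros)
  qed simp
  then obtain q where q: "q \<ge> 0" "(1 - q) * exp q = U * V" by blast
  have "q \<noteq> 0" using q z by auto
  then have qpos: "q > 0" using q by simp
  define p where "p = event (4 * m * ln V - 2 * m * q) ((2 * m * q) *\<^sub>R n)"
  have rad: "radius p = 2 * m * q" using qpos assms z by (simp add: p_def radius_event)
  have t: "tstar p = 4 * m * ln V - 2 * m * q" by (simp add: p_def tstar_def event_def)
  have sp: "space_part p = (2 * m * q) *\<^sub>R n"
    by (simp add: p_def space_part_def event_def vec_eq_iff forall_3)
  have e1: "exp ((tstar p + radius p) / (4 * m)) = V" using assms z by (simp add: rad t)
  have "(radius p - tstar p) / (4 * m) = q - ln V" using assms by (simp add: rad t field_simps)
  then have "(1 - radius p / (2 * m)) * exp ((radius p - tstar p) / (4 * m)) = (1 - q) * exp q / V"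
    using assms z by (simp add: rad exp_diff)
  then have e2: "(1 - radius p / (2 * m)) * exp ((radius p - tstar p) / (4 * m)) = U"
    using q z by simp
  have e3: "(1 / radius p) *\<^sub>R space_part p = n" using assms qpos by (simp add: rad sp)
  have "z = kruskal m p" unfolding kruskal_def e1 e2 e3 by (simp add: z)
  moreover have "p \<in> ingoing_chart" using assms qpos by (simp add: ingoing_chart_def rad)
  ultimately show "z \<in> kruskal m ` ingoing_chart" by blast
qed

lemma kruskal_closure:
  assumes "m > 0"
  shows "kruskal_space \<inter> closure (kruskal m ` dep_Sigma0 m) = kruskal m ` closed_dep_Sigma0 m"
proof -
  have lower: "exp (1 / 2) \<le> fst (snd (kruskal m p))" if "p \<in> dep_Sigma0 m" for p
  proof -
    have "(tstar p + radius p) / (4 * m) \<ge> 1 / 2"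
      using dep_Sigma0_subset(2)[OF assms that] assms by (simp add: field_simps)
    then show ?thesis by (simp add: kruskal_def)
  qed
  have "closure (kruskal m ` dep_Sigma0 m) \<subseteq> {z. exp (1 / 2) \<le> fst (snd z)}"
  proof (rule closure_minimal)
    show "kruskal m ` dep_Sigma0 m \<subseteq> {z. exp (1 / 2) \<le> fst (snd z)}"
      using lower by blast
    show "closed {z :: real \<times> real \<times> (real ^ 3). exp (1 / 2) \<le> fst (snd z)}"
      by (intro closed_Collect_le continuous_intros)
  qed
  moreover have "V > 0" if "exp (1 / 2) \<le> V" for V :: real
    using less_le_trans[OF exp_gt_zero that] .
  ultimately have "kruskal_space \<inter> closure (kruskal m ` dep_Sigma0 m)
      \<subseteq> {z \<in> kruskal_space. fst (snd z) > 0}"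
    by blast
  also have "\<dots> = kruskal m ` ingoing_chart"
    unfolding kruskal_range[OF assms] by (simp add: case_prod_unfold)
  finally have sub: "kruskal_space \<inter> closure (kruskal m ` dep_Sigma0 m) \<subseteq> kruskal m ` ingoing_chart" .
  have "kruskal m ` ingoing_chart \<subseteq> kruskal_space"
    unfolding kruskal_range[OF assms] by (auto simp: case_prod_unfold)
  with sub show ?thesis
    unfolding closed_dep_Sigma0_def by blast
qed

end

theory Submission
  imports Defs
begin

text \<open>
  For a function \<open>P\<close> of the Kruskal coordinates \<open>U, V\<close> the wave equation for \<open>P / r\<close> reads
  \<open>\<partial>\<^sub>U \<partial>\<^sub>V P = - exp (- q) / q ^ 4 * P\<close>, where \<open>q = r / 2m\<close> is a function of \<open>U V\<close>.
  Outgoing radial waves are already focused along the horizon: no localisation in the angles is needed.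
  The solution with characteristic data \<open>flat 0 (U + \<delta>)\<close> vanishes for \<open>U \<le> - \<delta>\<close>, and for small \<open>\<delta>\<close> it
  differs from its data by an amount that is small compared with the square root of
  \<open>I = \<integral> (\<partial>\<^sub>U data)\<^sup>2\<close>. Hence the horizon flux is \<open>o(I)\<close>, whereas the energy on \<open>\<Sigma>\<^sub>t\<close> is
  \<open>4 \<pi> \<bar>\<partial>\<^sub>r U\<bar> I + o(I)\<close> with \<open>\<partial>\<^sub>r U\<close> taken at \<open>r = 2m\<close>, which is proportional to \<open>exp (- t / 4m)\<close>.
\<close>

section \<open>Calculus of \<open>C\<^sup>k\<close> functions\<close>

text \<open>The whole gain is redshift. On a slice the main part of \<open>r^2\<close> times the
  energy density is the square of \<open>U_r\<close> times the data derivative. One factor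
  \<open>U_r\<close> is used up by the substitution from \<open>r\<close> to \<open>U\<close>, which
  produces the same I on every slice; the other is nearly constant on a thin packet and carries the
  time dependence. The obstacle is that I decays faster than any power of \<delta>, so errors must
  be measured against I itself. The characteristic problem bounds everything except the U-derivative
  of the data by the size \<open>flat 0 \<delta>\<close> of the data, whose square is at most
  \<open>2 \<delta>^2 I\<close>. On the horizon \<open>U = 0\<close> the time derivative is
  \<open>V / 4m\<close> times the V-derivative, so the flux sees only the small part. The equation
  is singular at \<open>U V = 1\<close>. Only \<open>U V \<le> 0\<close> matters, so the coefficient
  is replaced by a smooth bounded one on the whole plane; a single contraction then yields a global
  solution, without any continuation argument.\<close>

lemma Ck_on_Suc_imp:
  "Ck_on (Suc k) S f \<Longrightarrow> Ck_on k S f"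
proof (induction k arbitrary: f)
  case 0
  then show ?case
    by (auto intro: continuous_at_imp_continuous_on differentiable_imp_continuous_within)
next
  case (Suc k)
  then show ?case by simp
qed

text \<open>Any pointwise derivative may replace the chosen \<open>frechet_derivative\<close>. The
  two agree only on \<open>S\<close>, and \<open>S\<close> is open, so the inner congruence carries
  \<open>C^k\<close> regularity from one to the other.\<close>

lemma Ck_on_SucI:
  fixes f :: "'a::euclidean_space \<Rightarrow> 'b::real_normed_vector"
  assumes "open S" "\<And>x. x \<in> S \<Longrightarrow> (f has_derivative f' x) (at x)"
    and "\<And>b. b \<in> Basis \<Longrightarrow> Ck_on k S (\<lambda>x. f' x b)"
  shows "Ck_on (Suc k) S f"
proof -
  have cong: "Ck_on k S g \<Longrightarrow> (\<And>x. x \<in> S \<Longrightarrow> g x = h x) \<Longrightarrow> Ck_on k S h"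
    for g h :: "'a \<Rightarrow> 'b" and k
  proof (induction k arbitrary: g h)
    case 0
    then show ?case by (metis Ck_on.simps(1) continuous_on_cong)
  next
    case (Suc k)
    have eq: "frechet_derivative g (at x) = frechet_derivative h (at x)" if "x \<in> S" for x
      by (rule frechet_derivative_transform_within_open[OF _ assms(1) that])
        (use Suc.prems that in auto)
    have "h differentiable at x" if "x \<in> S" for x
      using Suc.prems that assms(1)
      by (meson Ck_on.simps(2) differentiable_def has_derivative_transform_within_open)
    moreover have "Ck_on k S (\<lambda>x. frechet_derivative h (at x) b)" if "b \<in> Basis" for b
      by (rule Suc.IH[of "\<lambda>x. frechet_derivative g (at x) b"]) (use Suc.prems that eq in auto)
    ultimately show ?case by simp
  qed
  have "frechet_derivative f (at x) = f' x" if "x \<in> S" for x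
    using assms(2)[OF that] frechet_derivative_at by metis
  then have "Ck_on k S (\<lambda>x. frechet_derivative f (at x) b)" if "b \<in> Basis" for b
    by (intro cong[OF assms(3)[OF that]]) simp
  then show ?thesis
    using assms(2) by (auto simp: differentiable_def)
qed

lemma Ck_on_SucD:
  assumes "Ck_on (Suc k) S f" "x \<in> S"
  shows "(f has_derivative frechet_derivative f (at x)) (at x)"
  using assms by (simp add: frechet_derivative_works)

lemma Ck_on_cong:
  assumes "open S" "\<And>x. x \<in> S \<Longrightarrow> f x = g x" "Ck_on k S f"
  shows "Ck_on k S g"
proof (cases k)
  case 0
  then show ?thesis using assms by (metis Ck_on.simps(1) continuous_on_cong)
next
  case (Suc j)
  have "(g has_derivative frechet_derivative f (at x)) (at x)" if "x \<in> S" for x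
    using assms(3) that unfolding Suc
    by (intro has_derivative_transform_within_open[OF Ck_on_SucD assms(1) that assms(2)])
  then show ?thesis
    unfolding Suc using assms Suc by (intro Ck_on_SucI) auto
qed

lemma Ck_on_const: "open S \<Longrightarrow> Ck_on k S (\<lambda>x. c)"
proof (induction k arbitrary: c)
  case (Suc k)
  then show ?case by (intro Ck_on_SucI[where f' = "\<lambda>x h. 0"]) auto
qed auto

lemma Ck_on_bounded_linear:
  assumes "bounded_linear h" "open S"
  shows "Ck_on k S h"
proof (cases k)
  case 0
  then show ?thesis using assms by (simp add: linear_continuous_on)
next
  case (Suc j)
  show ?thesis unfolding Suc
    by (rule Ck_on_SucI[where f' = "\<lambda>x. h"])
      (use assms in \<open>auto intro: Ck_on_const bounded_linear_imp_has_derivative\<close>)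
qed

lemma Ck_on_bounded_linear_comp:
  assumes "bounded_linear h" "open S" "Ck_on k S f"
  shows "Ck_on k S (\<lambda>x. h (f x))"
  using assms(3)
proof (induction k arbitrary: f)
  case 0
  then show ?case using assms(1) by (auto intro: bounded_linear.continuous_on)
next
  case (Suc k)
  show ?case
    by (rule Ck_on_SucI[OF assms(2), where f' = "\<lambda>x b. h (frechet_derivative f (at x) b)"])
      (use Suc in \<open>auto intro!: bounded_linear.has_derivative[OF assms(1)] intro: Ck_on_SucD\<close>)
qed

lemma Ck_on_add:
  assumes "open S" "Ck_on k S f" "Ck_on k S g"
  shows "Ck_on k S (\<lambda>x. f x + g x)"
  using assms(2,3)
proof (induction k arbitrary: f g)
  case 0
  then show ?case by (auto intro: continuous_intros)
next
  case (Suc k)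
  show ?case
    by (rule Ck_on_SucI[OF assms(1),
          where f' = "\<lambda>x b. frechet_derivative f (at x) b + frechet_derivative g (at x) b"])
      (use Suc in \<open>auto intro!: has_derivative_add intro: Ck_on_SucD\<close>)
qed

lemma (in bounded_bilinear) Ck_on_prod:
  assumes "open S" "Ck_on k S f" "Ck_on k S g"
  shows "Ck_on k S (\<lambda>x. prod (f x) (g x))"
  using assms(2,3)
proof (induction k arbitrary: f g)
  case 0
  then show ?case by (auto intro: continuous_on)
next
  case (Suc k)
  have "Ck_on k S f" "Ck_on k S g" using Suc.prems[THEN Ck_on_Suc_imp] .
  then show ?case
    by (intro Ck_on_SucI[OF assms(1), where f' = "\<lambda>x b. prod (f x) (frechet_derivative g (at x) b)
          + prod (frechet_derivative f (at x) b) (g x)"])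
      (use Suc in \<open>auto intro!: FDERIV Ck_on_add assms(1) intro: Ck_on_SucD\<close>)
qed

lemmas Ck_on_mult = bounded_bilinear.Ck_on_prod[OF bounded_bilinear_mult]

lemma Ck_on_sum:
  assumes "open S" "finite A" "\<And>i. i \<in> A \<Longrightarrow> Ck_on k S (f i)"
  shows "Ck_on k S (\<lambda>x. \<Sum>i\<in>A. f i x)"
  using assms(2,3) by (induction A) (auto intro: Ck_on_const Ck_on_add assms(1))

text \<open>The chain rule is expanded over a basis of the middle space: the derivative becomes a
  finite sum of \<open>C^k\<close> scalars times compositions, to which the induction hypothesis
  applies.\<close>

lemma Ck_on_compose:
  fixes f :: "'b::euclidean_space \<Rightarrow> 'c::real_normed_vector" and g :: "'a::euclidean_space \<Rightarrow> 'b"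
  assumes "open S" "\<And>x. x \<in> S \<Longrightarrow> g x \<in> T" "Ck_on k T f" "Ck_on k S g"
  shows "Ck_on k S (\<lambda>x. f (g x))"
  using assms(3,4)
proof (induction k arbitrary: f)
  case 0
  then show ?case using assms(2) by (auto intro: continuous_on_compose2)
next
  case (Suc k)
  let ?f = "\<lambda>x. frechet_derivative f (at x)" and ?g = "\<lambda>x. frechet_derivative g (at x)"
  have gk: "Ck_on k S g" using Suc.prems(2)[THEN Ck_on_Suc_imp] .
  have der: "((\<lambda>x. f (g x)) has_derivative (\<lambda>h. ?f (g x) (?g x h))) (at x)" if "x \<in> S" for x
    using has_derivative_compose[OF Ck_on_SucD[OF Suc.prems(2) that] Ck_on_SucD[OF Suc.prems(1) assms(2)[OF that]]] .
  have eq: "?f (g x) (?g x h) = (\<Sum>c\<in>Basis. (?g x h \<bullet> c) *\<^sub>R ?f (g x) c)" if "x \<in> S" for x h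
  proof -
    have lin: "linear (?f (g x))"
      using Ck_on_SucD[OF Suc.prems(1) assms(2)[OF that]] has_derivative_linear by blast
    have "?f (g x) (?g x h) = ?f (g x) (\<Sum>c\<in>Basis. (?g x h \<bullet> c) *\<^sub>R c)"
      by (simp add: euclidean_representation)
    then show ?thesis by (simp add: linear_sum[OF lin] linear_scale[OF lin])
  qed
  show ?case
  proof (rule Ck_on_SucI[OF assms(1), where f' = "\<lambda>x h. \<Sum>c\<in>Basis. (?g x h \<bullet> c) *\<^sub>R ?f (g x) c"])
    show "((\<lambda>x. f (g x)) has_derivative (\<lambda>h. \<Sum>c\<in>Basis. (?g x h \<bullet> c) *\<^sub>R ?f (g x) c)) (at x)"
      if "x \<in> S" for x
      using der[OF that] by (simp add: eq[OF that])
    show "Ck_on k S (\<lambda>x. \<Sum>c\<in>Basis. (?g x b \<bullet> c) *\<^sub>R ?f (g x) c)" if "b \<in> Basis" for b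
    proof (rule Ck_on_sum[OF assms(1) finite_Basis],
        rule bounded_bilinear.Ck_on_prod[OF bounded_bilinear_scaleR assms(1)])
      fix c :: 'b assume "c \<in> Basis"
      show "Ck_on k S (\<lambda>x. ?g x b \<bullet> c)"
        by (rule Ck_on_bounded_linear_comp[OF bounded_linear_inner_left assms(1)])
          (use Suc.prems that in simp)
      show "Ck_on k S (\<lambda>x. ?f (g x) c)"
        by (rule Suc.IH[of "\<lambda>y. ?f y c", OF _ gk]) (use Suc.prems \<open>c \<in> Basis\<close> in simp)
    qed
  qed
qed

section \<open>Smoothness of explicit functions on the line\<close>

lemma Ck_on_real_SucI:
  fixes f :: "real \<Rightarrow> real"
  assumes "open S" "\<And>x. x \<in> S \<Longrightarrow> (f has_real_derivative f' x) (at x)" "Ck_on k S f'"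
  shows "Ck_on (Suc k) S f"
  by (rule Ck_on_SucI[where f' = "\<lambda>x h. f' x * h"])
    (use assms in \<open>auto simp: has_field_derivative_def\<close>)

text \<open>Bootstrapping: if \<open>f\<close> is \<open>C^k\<close>, then so is
  \<open>F (f x)\<close>, which is its derivative. This yields the exponential, the inverse, the
  square root and the Kruskal radius from their differential equations alone.\<close>

lemma Ck_on_ode:
  fixes f :: "real \<Rightarrow> real"
  assumes "open S" "\<And>x. x \<in> S \<Longrightarrow> f x \<in> T"
    and "\<And>x. x \<in> S \<Longrightarrow> (f has_real_derivative F (f x)) (at x)" "\<And>k. Ck_on k T F"
  shows "Ck_on k S f"
proof (induction k)
  case 0
  show ?case using assms(3) by (auto intro: continuous_at_imp_continuous_on DERIV_isCont)
next
  case (Suc k)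
  show ?case
    by (rule Ck_on_real_SucI[OF assms(1,3) Ck_on_compose[OF assms(1,2,4) Suc]])
qed

lemma Ck_on_exp: "open S \<Longrightarrow> Ck_on k S (exp :: real \<Rightarrow> real)"
  by (rule Ck_on_ode[where T = UNIV and F = "\<lambda>x. x"])
    (auto intro: DERIV_exp Ck_on_bounded_linear bounded_linear_ident)

lemma Ck_on_ident: "open S \<Longrightarrow> Ck_on k S (\<lambda>x. x)"
  by (rule Ck_on_bounded_linear[OF bounded_linear_ident])

lemma Ck_on_inverse: "open S \<Longrightarrow> 0 \<notin> S \<Longrightarrow> Ck_on k S (inverse :: real \<Rightarrow> real)"
proof (rule Ck_on_ode[where T = UNIV and F = "\<lambda>x. - 1 * (x * x)"])
  show "Ck_on k UNIV (\<lambda>x::real. - 1 * (x * x))" for k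
    by (intro Ck_on_mult Ck_on_const Ck_on_ident open_UNIV)
qed (auto intro!: derivative_eq_intros)

lemma Ck_on_sqrt: "Ck_on k {0<..} sqrt"
proof (rule Ck_on_ode[where T = "{0<..}" and F = "\<lambda>x. 1 / 2 * inverse x"])
  show "Ck_on k {0<..} (\<lambda>x::real. 1 / 2 * inverse x)" for k
    by (intro Ck_on_mult Ck_on_const Ck_on_inverse) auto
qed (auto intro!: derivative_eq_intros simp: divide_simps)

section \<open>Flat functions and the potential\<close>

text \<open>The classical flat function \<open>exp (- 1 / x)\<close>; the extra powers of
  \<open>1 / x\<close> make the family closed under differentiation up to linear
  combinations.\<close>

definition flat :: "nat \<Rightarrow> real \<Rightarrow> real" where
  "flat n x = (if x > 0 then (1 / x) ^ n * exp (- 1 / x) else 0)"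

lemma flat_nonpos [simp]: "x \<le> 0 \<Longrightarrow> flat n x = 0"
  by (simp add: flat_def)

lemma flat_nonneg: "flat n x \<ge> 0"
  by (simp add: flat_def)

lemma flat_0_le_1: "flat 0 x \<le> 1"
  by (simp add: flat_def)

lemma flat_0_mono: "x \<le> y \<Longrightarrow> flat 0 x \<le> flat 0 y"
  by (auto simp: flat_def field_simps)

lemma tendsto_flat_0: "(flat n \<longlongrightarrow> 0) (at 0)"
proof -
  have "((\<lambda>y::real. y ^ n / exp y) \<longlongrightarrow> 0) at_top"
    by (rule tendsto_power_div_exp_0)
  then have "((\<lambda>x::real. inverse x ^ n / exp (inverse x)) \<longlongrightarrow> 0) (at_right 0)"
    by (rule filterlim_compose[OF _ filterlim_inverse_at_top_right])
  then have "(flat n \<longlongrightarrow> 0) (at_right 0)"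
    by (rule Lim_transform_eventually)
      (auto simp: flat_def eventually_at_filter exp_minus divide_simps)
  moreover have "(flat n \<longlongrightarrow> 0) (at_left 0)"
    by (rule Lim_transform_eventually[of "\<lambda>_. 0"]) (auto simp: eventually_at_filter)
  ultimately show ?thesis
    by (simp add: filterlim_at_split)
qed

lemma flat_has_derivative:
  "(flat n has_real_derivative flat (n + 2) x - real n * flat (n + 1) x) (at x)"
proof -
  consider "x > 0" | "x < 0" | "x = 0" by linarith
  then show ?thesis
  proof cases
    case 1
    have "((\<lambda>x. inverse x ^ n * exp (- inverse x)) has_real_derivative
        real n * inverse x ^ (n - 1) * (- (inverse x * inverse x)) * exp (- inverse x)
        + inverse x ^ n * (exp (- inverse x) * (inverse x * inverse x))) (at x)"
      using 1 by (auto intro!: derivative_eq_intros)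
    also have "real n * inverse x ^ (n - 1) * (- (inverse x * inverse x)) * exp (- inverse x)
        + inverse x ^ n * (exp (- inverse x) * (inverse x * inverse x))
        = flat (n + 2) x - real n * flat (n + 1) x"
      using 1 by (cases n) (simp_all add: flat_def inverse_eq_divide[symmetric])
    finally have "((\<lambda>x. inverse x ^ n * exp (- inverse x)) has_real_derivative
        flat (n + 2) x - real n * flat (n + 1) x) (at x)" .
    then show ?thesis
      by (rule has_field_derivative_transform_within_open[where S = "{0<..}"])
        (use 1 in \<open>auto simp: flat_def inverse_eq_divide\<close>)
  next
    case 2
    have "((\<lambda>x. 0) has_real_derivative 0) (at x)" by simp
    then have "(flat n has_real_derivative 0) (at x)"
      by (rule has_field_derivative_transform_within_open[where S = "{..<0}"]) (use 2 in auto)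
    then show ?thesis using 2 by simp
  next
    case 3
    \<comment> \<open>The difference quotient at 0 is \<open>flat (n + 1)\<close>, which tends to 0
      there.\<close>
    have "((\<lambda>y. flat n y / y) \<longlongrightarrow> 0) (at 0)"
      by (rule Lim_transform_eventually[OF tendsto_flat_0[of "Suc n"]])
        (auto simp: flat_def eventually_at_filter)
    then show ?thesis unfolding 3 has_field_derivative_iff by simp
  qed
qed

lemma Ck_on_flat: "Ck_on k UNIV (flat n)"
proof (induction k arbitrary: n)
  case 0
  show ?case
    using flat_has_derivative by (auto intro!: continuous_at_imp_continuous_on intro: DERIV_isCont)
next
  case (Suc k)
  have "Ck_on k UNIV (\<lambda>x. flat (n + 2) x + - real n * flat (n + 1) x)"
    by (intro Ck_on_add Ck_on_mult Ck_on_const Suc open_UNIV)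
  then show ?case
    by (intro Ck_on_real_SucI[OF _ flat_has_derivative]) auto
qed

text \<open>The primitive of the square of \<open>flat 2\<close> that vanishes on the nonpositive
  axis. The argument \<open>x / 2\<close> produces the exponent \<open>- 2 / x\<close> of the
  square. At \<delta> it equals the integral I of the overview.\<close>

definition flat_energy :: "real \<Rightarrow> real" where
  "flat_energy x = flat 2 (x / 2) / 8 + flat 1 (x / 2) / 4 + flat 0 (x / 2) / 4"

lemma flat_energy_has_derivative:
  "(flat_energy has_real_derivative (flat 2 x)\<^sup>2) (at x)"
proof -
  have "(flat_energy has_real_derivative flat 4 (x / 2) / 16) (at x)"
    unfolding flat_energy_def
    by (rule derivative_eq_intros DERIV_chain2[OF flat_has_derivative] refl | simp)+
      (simp add: eval_nat_numeral field_simps)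
  moreover have "flat 4 (x / 2) / 16 = (flat 2 x)\<^sup>2"
    by (auto simp: flat_def power_divide power_mult_distrib exp_double[symmetric] power2_eq_square
        power4_eq_xxxx divide_simps exp_add[symmetric])
  ultimately show ?thesis by simp
qed

text \<open>Cauchy-Schwarz would compare the squared profile with \<open>x\<close> times the
  integral of its squared derivative; the explicit profile gains a second power of \<open>x\<close>.
  It is this power that makes a Young inequality with weight \<delta> leave an error of order
  \<delta>.\<close>

lemma flat_energy_bound:
  assumes "x > 0"
  shows "(flat 0 x)\<^sup>2 \<le> 2 * x\<^sup>2 * flat_energy x" "flat_energy x > 0"
proof -
  have e: "flat_energy x = exp (- 2 / x) * (1 / (2 * x\<^sup>2) + 1 / (2 * x) + 1 / 4)"
    using assms by (simp add: flat_energy_def flat_def field_simps power2_eq_square)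
  have "(flat 0 x)\<^sup>2 = exp (- 2 / x)"
    using assms by (simp add: flat_def power2_eq_square exp_add[symmetric])
  also have "\<dots> \<le> exp (- 2 / x) * (1 + x + x\<^sup>2 / 2)"
    using assms by simp
  also have "\<dots> = 2 * x\<^sup>2 * flat_energy x"
    using assms unfolding e by (simp add: field_simps power2_eq_square)
  finally show "(flat 0 x)\<^sup>2 \<le> 2 * x\<^sup>2 * flat_energy x" .
  show "flat_energy x > 0" unfolding e using assms by (intro mult_pos_pos add_pos_pos) auto
qed

text \<open>Precomposing with this map extends smooth functions of \<open>U V\<close> from the exterior \<open>U V \<le> 0\<close> to the
  whole line, away from the singularity \<open>U V = 1\<close>.\<close>

definition clamp_half :: "real \<Rightarrow> real" where
  "clamp_half x = x * (1 - flat 0 (2 * x))"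

lemma clamp_half_nonpos: "x \<le> 0 \<Longrightarrow> clamp_half x = x"
  by (simp add: clamp_half_def)

text \<open>This is \<open>1 - exp (- y) < y\<close> at \<open>y = 1 / (2 x)\<close>. Staying away
  from 1 keeps the radius away from 0, hence the potential bounded.\<close>

lemma clamp_half_less: "clamp_half x < 1 / 2"
proof (cases "x > 0")
  case True
  have "1 - 1 / (2 * x) < exp (- 1 / (2 * x))"
    using exp_minus_greater[of "1 / (2 * x)"] True by simp
  then have "x * (1 - exp (- 1 / (2 * x))) < x * (1 / (2 * x))"
    using True by (intro mult_strict_left_mono) auto
  then show ?thesis using True by (simp add: clamp_half_def flat_def)
qed (auto simp: clamp_half_def)

lemma Ck_on_clamp_half: "Ck_on k UNIV clamp_half"
proof -
  have "Ck_on k UNIV (\<lambda>x. x * (1 + - 1 * flat 0 (2 * x)))"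
    by (intro Ck_on_mult Ck_on_add Ck_on_const Ck_on_ident open_UNIV
        Ck_on_compose[OF open_UNIV _ Ck_on_flat, where g = "\<lambda>x. 2 * x"]) auto
  then show ?thesis
    unfolding clamp_half_def[abs_def] by simp
qed

text \<open>\<open>r / 2m\<close> as a function of \<open>U V\<close>, see \<open>kruskal_space\<close>.\<close>

definition kruskal_radius :: "real \<Rightarrow> real" where
  "kruskal_radius x = (THE q. q > 0 \<and> (1 - q) * exp q = x)"

lemma kruskal_radius_fun_deriv:
  "((\<lambda>q. (1 - q) * exp q) has_real_derivative - q * exp q) (at (q::real))"
  by (auto intro!: derivative_eq_intros simp: algebra_simps)

lemma kruskal_radius_eq:
  assumes "q > 0"
  shows "kruskal_radius ((1 - q) * exp q) = q"
proof -
  have "(1 - b) * exp b < (1 - a) * exp a" if "0 < a" "a < b" for a b :: real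
    by (rule DERIV_neg_imp_decreasing[OF that(2)])
      (use that kruskal_radius_fun_deriv in \<open>force simp: mult_less_0_iff\<close>)
  then show ?thesis
    unfolding kruskal_radius_def using assms
    by (intro the_equality) (auto, metis less_irrefl linorder_neqE_linordered_idom)
qed

lemma kruskal_radius:
  assumes "x < 1"
  shows "kruskal_radius x > 0" "(1 - kruskal_radius x) * exp (kruskal_radius x) = x"
proof -
  have "\<exists>q\<ge>0. q \<le> 1 + \<bar>x\<bar> \<and> (1 - q) * exp q = x"
  proof (rule IVT2'[of "\<lambda>q. (1 - q) * exp q"])
    have "\<bar>x\<bar> * 1 \<le> \<bar>x\<bar> * exp (1 + \<bar>x\<bar>)" by (intro mult_left_mono) auto
    then show "(1 - (1 + \<bar>x\<bar>)) * exp (1 + \<bar>x\<bar>) \<le> x"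
      by (simp add: abs_if split: if_splits)
  qed (use assms in \<open>auto intro!: continuous_intros\<close>)
  then obtain q where q: "q \<ge> 0" "(1 - q) * exp q = x" by blast
  with assms have "q > 0" by (cases "q = 0") auto
  then show "kruskal_radius x > 0" "(1 - kruskal_radius x) * exp (kruskal_radius x) = x"
    using kruskal_radius_eq q(2) by auto
qed

text \<open>The inverse function theorem gives the autonomous equation
  \<open>q' = - exp (- q) / q\<close>, from which all orders of smoothness follow.\<close>

lemma Ck_on_kruskal_radius: "Ck_on k {..<1} kruskal_radius"
proof (rule Ck_on_ode[where T = "{0<..}" and F = "\<lambda>q. - 1 * (exp (- 1 * q) * inverse q)"])
  show "(kruskal_radius has_real_derivative
      - 1 * (exp (- 1 * kruskal_radius x) * inverse (kruskal_radius x))) (at x)"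
    if "x \<in> {..<1}" for x
  proof -
    define q where "q = kruskal_radius x"
    have q: "q > 0" "(1 - q) * exp q = x" using kruskal_radius that by (auto simp: q_def)
    have "(kruskal_radius has_real_derivative inverse (- q * exp q)) (at ((1 - q) * exp q))"
      unfolding has_field_derivative_def
    proof (rule has_derivative_inverse_strong[of "{0<..}" q "\<lambda>q. (1 - q) * exp q"])
      show "((\<lambda>q. (1 - q) * exp q) has_derivative (*) (- q * exp q)) (at q)"
        using kruskal_radius_fun_deriv by (simp add: has_field_derivative_def)
      show "(*) (- q * exp q) \<circ> (*) (inverse (- q * exp q)) = id"
        using q by (simp add: fun_eq_iff field_simps)
    qed (use q kruskal_radius_eq in \<open>auto intro!: continuous_intros\<close>)
    then show ?thesis unfolding q_def[symmetric] using q
      by (simp add: exp_minus divide_inverse inverse_mult_distrib mult.commute)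
  qed
  show "Ck_on k {0<..} (\<lambda>q::real. - 1 * (exp (- 1 * q) * inverse q))" for k
    by (intro Ck_on_mult Ck_on_const Ck_on_ident Ck_on_inverse
        Ck_on_compose[OF _ _ Ck_on_exp[OF open_UNIV], where g = "\<lambda>q. - 1 * q"]) auto
qed (auto intro: kruskal_radius)

text \<open>The coefficient of the wave equation for \<open>U V \<le> 0\<close>; for positive
  arguments it is a modification without geometric meaning, chosen so that it is smooth and bounded
  on the whole line.\<close>

definition potential :: "real \<Rightarrow> real" where
  "potential x = - exp (- kruskal_radius (clamp_half x)) / kruskal_radius (clamp_half x) ^ 4"

lemma potential_eq:
  assumes "q \<ge> 1"
  shows "potential ((1 - q) * exp q) = - exp (- q) / q ^ 4"
proof -
  have "(1 - q) * exp q \<le> 0" using assms by (simp add: mult_le_0_iff)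
  then show ?thesis
    using assms by (simp add: potential_def clamp_half_nonpos kruskal_radius_eq)
qed

text \<open>From \<open>exp q \<ge> 1 + q\<close> the inequality
  \<open>(1 - q) * exp q < 1 / 2\<close> gives \<open>q^2 \<ge> 1 / 2\<close>, so
  \<open>q^4 \<ge> 1 / 4\<close>. As 4 is below \<open>3^2 / 2\<close>, the rate 3 can be used in
  the weight of the characteristic problem.\<close>

lemma potential_bound: "\<bar>potential x\<bar> \<le> 4"
proof -
  define q where "q = kruskal_radius (clamp_half x)"
  have q: "q > 0" "(1 - q) * exp q < 1 / 2"
    using kruskal_radius[of "clamp_half x"] clamp_half_less[of x] by (auto simp: q_def)
  have "1 / 2 \<le> q\<^sup>2"
  proof (cases "q \<ge> 1")
    case True
    then show ?thesis using one_le_power[of q 2] by linarith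
  next
    case False
    then have "(1 - q) * (1 + q) \<le> (1 - q) * exp q"
      by (intro mult_left_mono exp_ge_add_one_self) auto
    then show ?thesis using q by (simp add: algebra_simps power2_eq_square)
  qed
  then have "(1 / 2)\<^sup>2 \<le> (q\<^sup>2)\<^sup>2" by (intro power_mono) auto
  then have "1 / 4 \<le> q ^ 4" by (simp add: power_divide)
  moreover have "exp (- q) \<le> 1" using q by simp
  ultimately have "exp (- q) \<le> 4 * q ^ 4" by linarith
  then show ?thesis
    unfolding potential_def q_def[symmetric] using q by (simp add: abs_divide divide_simps)
qed

lemma Ck_on_potential: "Ck_on k UNIV potential"
proof -
  let ?q = "\<lambda>x. kruskal_radius (clamp_half x)"
  have q: "Ck_on k UNIV ?q" for k
    by (rule Ck_on_compose[OF open_UNIV _ Ck_on_kruskal_radius Ck_on_clamp_half])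
      (use less_trans[OF clamp_half_less, of 1] in auto)
  have pos: "?q x > 0" for x
    using kruskal_radius(1)[of "clamp_half x"] clamp_half_less[of x] by auto
  have i: "Ck_on k UNIV (\<lambda>x. inverse (?q x))"
    by (rule Ck_on_compose[OF open_UNIV _ Ck_on_inverse q, where T = "{0<..}"]) (use pos in auto)
  have e: "Ck_on k UNIV (\<lambda>x. exp (- 1 * ?q x))"
    by (rule Ck_on_compose[OF open_UNIV _ Ck_on_exp[OF open_UNIV], where g = "\<lambda>x. - 1 * ?q x"])
      (auto intro!: Ck_on_mult[OF open_UNIV Ck_on_const[OF open_UNIV] q, of _ "-1", simplified])
  have "Ck_on k UNIV (\<lambda>x. - 1 * (exp (- 1 * ?q x) *
      (inverse (?q x) * (inverse (?q x) * (inverse (?q x) * inverse (?q x))))))"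
    by (intro Ck_on_mult[OF open_UNIV] Ck_on_const[OF open_UNIV] i e)
  then show ?thesis
    by (rule Ck_on_cong[OF open_UNIV, rotated])
      (simp add: potential_def divide_inverse eval_nat_numeral inverse_mult_distrib)
qed

section \<open>The characteristic initial value problem\<close>

text \<open>The oriented integral of \<open>h\<close> from \<open>a\<close> to \<open>x\<close>,
  rescaled to the unit interval: it has the right sign for \<open>x < a\<close>, and its domain is
  fixed, so that theorems on parameter integrals apply directly.\<close>

definition line_int :: "real \<Rightarrow> (real \<Rightarrow> real) \<Rightarrow> real \<Rightarrow> real" where
  "line_int a h x = (x - a) * integral {0..1} (\<lambda>s. h (a + s * (x - a)))"

lemma line_int_has_derivative:
  assumes "continuous_on UNIV h"
  shows "(line_int a h has_real_derivative h x) (at x)"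
proof -
  \<comment> \<open>An interval with both \<open>a\<close> and \<open>x\<close> in its interior, so
    that no distinction between \<open>x < a\<close> and \<open>x > a\<close> is needed.\<close>
  define L R where "L = min a x - 1" and "R = max a x + 1"
  obtain G where G: "\<And>y. y \<in> {L..R} \<Longrightarrow> (G has_vector_derivative h y) (at y within {L..R})"
    using antiderivative_continuous[OF continuous_on_subset[OF assms subset_UNIV]] by metis
  have eq: "line_int a h y = G y - G a" if y: "y \<in> {L..R}" for y
  proof -
    have inL: "a + s * (y - a) \<in> {L..R}" if "s \<in> {0..1}" for s
    proof -
      have "a + s * (y - a) = (1 - s) *\<^sub>R a + s *\<^sub>R y" by (simp add: algebra_simps)
      moreover have "\<dots> \<in> {L..R}"
        by (rule convexD) (use that y in \<open>auto simp: L_def R_def\<close>)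
      ultimately show ?thesis by simp
    qed
    have "((\<lambda>s. G (a + s * (y - a))) has_vector_derivative (y - a) * h (a + s * (y - a)))
        (at s within {0..1})" if "s \<in> {0..1}" for s
    proof -
      have "((\<lambda>s. a + s * (y - a)) has_vector_derivative (y - a)) (at s within {0..1})"
        by (auto intro!: derivative_eq_intros)
      moreover have "(G has_vector_derivative h (a + s * (y - a)))
          (at (a + s * (y - a)) within (\<lambda>s. a + s * (y - a)) ` {0..1})"
        by (rule has_vector_derivative_within_subset[OF G[OF inL[OF that]]]) (use inL in blast)
      ultimately show ?thesis
        using vector_diff_chain_within[of "\<lambda>s. a + s * (y - a)" "y - a" s "{0..1}" G]
        by (simp add: o_def)
    qed
    then have "((\<lambda>s. (y - a) * h (a + s * (y - a))) has_integral
        G (a + 1 * (y - a)) - G (a + 0 * (y - a))) {0..1}"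
      by (intro fundamental_theorem_of_calculus) auto
    then show ?thesis
      by (simp add: line_int_def integral_unique flip: integral_mult_right)
  qed
  have "(G has_vector_derivative h x) (at x)"
    using G[of x] at_within_interior[of x "{L..R}"] by (simp add: L_def R_def min_def max_def)
  then have "((\<lambda>y. G y - G a) has_real_derivative h x) (at x)"
    by (auto intro!: derivative_eq_intros simp: has_real_derivative_iff_has_vector_derivative)
  then show ?thesis
    by (rule has_field_derivative_transform_within_open[where S = "{L<..<R}"])
      (use eq in \<open>auto simp: L_def R_def\<close>)
qed

lemma line_int_integrable:
  "continuous_on UNIV h \<Longrightarrow> (\<lambda>s. h (a + s * (x - a))) integrable_on {0..1::real}" for h :: "real \<Rightarrow> real"
  by (rule integrable_continuous_interval, erule continuous_on_compose2[OF _ _ subset_UNIV])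
    (intro continuous_intros)

lemma line_int_diff:
  assumes "continuous_on UNIV g" "continuous_on UNIV h"
  shows "line_int a (\<lambda>s. g s - h s) x = line_int a g x - line_int a h x"
  unfolding line_int_def
  by (simp add: integral_diff line_int_integrable assms flip: right_diff_distrib)

text \<open>Integrating the exponential weight gains a factor \<open>1 / c\<close>. Restricting the
  hypothesis to an interval \<open>X\<close> through \<open>a\<close> and \<open>x\<close> is what
  later gives localised bounds.\<close>

lemma line_int_exp_bound:
  assumes "continuous_on UNIV h" "c > 0" "is_interval X" "a \<in> X" "x \<in> X"
    and "\<And>s. s \<in> X \<Longrightarrow> \<bar>h s\<bar> \<le> c * D * exp (c * \<bar>s - a\<bar>)"
  shows "\<bar>line_int a h x\<bar> \<le> D * exp (c * \<bar>x - a\<bar>)"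
proof -
  define d where "d = \<bar>x - a\<bar>"
  have "0 \<le> c * D" using assms(6)[OF assms(4)] by (simp add: order_trans[OF abs_ge_zero])
  then have D: "D \<ge> 0" using assms(2) by (simp add: zero_le_mult_iff)
  have hi: "((\<lambda>s. D * (c * d * exp (c * d * s))) has_integral
      D * exp (c * d * 1) - D * exp (c * d * 0)) {0..1}"
    by (rule fundamental_theorem_of_calculus)
      (auto intro!: derivative_eq_intros simp: has_real_derivative_iff_has_vector_derivative[symmetric])
  have "\<bar>line_int a h x\<bar> = norm (integral {0..1} (\<lambda>s. (x - a) * h (a + s * (x - a))))"
    unfolding line_int_def by simp
  also have "\<dots> \<le> integral {0..1} (\<lambda>s. D * (c * d * exp (c * d * s)))"
  proof (rule integral_norm_bound_integral)
    show "(\<lambda>s. (x - a) * h (a + s * (x - a))) integrable_on {0..1}"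
      using integrable_cmul[OF line_int_integrable[OF assms(1)], of "x - a"] by simp
    show "(\<lambda>s. D * (c * d * exp (c * d * s))) integrable_on {0..1}"
      using hi by blast
    fix s :: real assume s: "s \<in> {0..1}"
    have "a + s * (x - a) = (1 - s) *\<^sub>R a + s *\<^sub>R x" by (simp add: algebra_simps)
    also have "\<dots> \<in> X"
      by (rule convexD[OF is_interval_convex]) (use s assms in auto)
    finally have "\<bar>h (a + s * (x - a))\<bar> \<le> c * D * exp (c * \<bar>s * (x - a)\<bar>)"
      using assms(6)[of "a + s * (x - a)"] by simp
    then have "d * \<bar>h (a + s * (x - a))\<bar> \<le> d * (c * D * exp (c * (s * d)))"
      using s by (intro mult_left_mono) (auto simp: d_def abs_mult)
    then show "norm ((x - a) * h (a + s * (x - a))) \<le> D * (c * d * exp (c * d * s))"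
      by (simp add: d_def abs_mult mult_ac)
  qed
  also have "\<dots> = D * exp (c * d) - D" using integral_unique[OF hi] by simp
  also have "\<dots> \<le> D * exp (c * d)" using D by simp
  finally show ?thesis by (simp add: d_def)
qed

lemma continuous_on_line_int:
  fixes g :: "real \<times> real \<Rightarrow> real"
  assumes "continuous_on UNIV g"
  shows "continuous_on UNIV (\<lambda>z. line_int a (\<lambda>s. g (s, snd z)) (fst z))"
    and "continuous_on UNIV (\<lambda>z. line_int a (\<lambda>s. g (fst z, s)) (snd z))"
proof -
  have "continuous_on UNIV (\<lambda>z. integral (cbox 0 1) (\<lambda>s. g (a + s * (fst z - a), snd z)))"
    "continuous_on UNIV (\<lambda>z. integral (cbox 0 1) (\<lambda>s. g (fst z, a + s * (snd z - a))))"
    by (rule integral_continuous_on_param, unfold case_prod_unfold,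
        rule continuous_on_compose2[OF assms _ subset_UNIV], intro continuous_intros)+
  then show "continuous_on UNIV (\<lambda>z. line_int a (\<lambda>s. g (s, snd z)) (fst z))"
    "continuous_on UNIV (\<lambda>z. line_int a (\<lambda>s. g (fst z, s)) (snd z))"
    unfolding line_int_def cbox_interval by (auto intro!: continuous_on_mult continuous_on_diff
        continuous_on_fst continuous_on_snd continuous_on_id continuous_on_const)
qed

lemma line_int_leibniz:
  fixes g g' :: "real \<Rightarrow> real \<Rightarrow> real"
  assumes "\<And>y. continuous_on UNIV (\<lambda>s. g s y)"
    and "continuous_on UNIV (\<lambda>z. g' (fst z) (snd z))"
    and "\<And>s y. (g s has_real_derivative g' s y) (at y)"
  shows "((\<lambda>y. line_int a (\<lambda>s. g s y) x) has_real_derivative line_int a (\<lambda>s. g' s y) x) (at y)"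
proof -
  have "((\<lambda>y. integral (cbox 0 1) (\<lambda>s. g (a + s * (x - a)) y)) has_real_derivative
      integral (cbox 0 1) (\<lambda>s. g' (a + s * (x - a)) y)) (at y within UNIV)"
  proof (rule leibniz_rule_field_derivative)
    show "((\<lambda>y. g (a + s * (x - a)) y) has_real_derivative g' (a + s * (x - a)) y) (at y)" for s y
      by (rule assms(3))
    show "(\<lambda>s. g (a + s * (x - a)) y) integrable_on cbox 0 1" for y
      using line_int_integrable[OF assms(1)] by simp
    show "continuous_on (UNIV \<times> cbox 0 1) (\<lambda>(y, s). g' (a + s * (x - a)) y)"
      unfolding case_prod_unfold
      using continuous_on_compose2[OF assms(2) _ subset_UNIV,
          of "UNIV \<times> cbox 0 1" "\<lambda>z. (a + snd z * (x - a), fst z)"]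
      by (simp add: continuous_intros)
  qed auto
  then have "((\<lambda>y. (x - a) * integral {0..1} (\<lambda>s. g (a + s * (x - a)) y)) has_real_derivative
      (x - a) * integral {0..1} (\<lambda>s. g' (a + s * (x - a)) y)) (at y)"
    by (intro DERIV_cmult) simp
  then show ?thesis
    by (simp add: line_int_def)
qed

text \<open>Continuity of one of the two partial derivatives is enough for total
  differentiability.\<close>

lemma has_derivative_real_partials:
  fixes f :: "real \<times> real \<Rightarrow> real"
  assumes "\<And>x y. ((\<lambda>x. f (x, y)) has_real_derivative fx (x, y)) (at x)"
    and "\<And>x y. ((\<lambda>y. f (x, y)) has_real_derivative fy (x, y)) (at y)"
    and "continuous_on UNIV fy"
  shows "(f has_derivative (\<lambda>h. fx z * fst h + fy z * snd h)) (at z)"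
proof -
  obtain x y where z: "z = (x, y)" by fastforce
  have "((\<lambda>(x, y). f (x, y)) has_derivative
      (\<lambda>(tx, ty). fx (x, y) * tx + blinfun_apply (blinfun_mult_right (fy (x, y))) ty))
      (at (x, y) within UNIV \<times> UNIV)"
  proof (rule has_derivative_partialsI)
    show "((\<lambda>x. f (x, y)) has_derivative (\<lambda>tx. fx (x, y) * tx)) (at x)"
      using assms(1) by (simp add: has_field_derivative_def)
    show "((\<lambda>y. f (x, y)) has_derivative blinfun_apply (blinfun_mult_right (fy (x, y)))) (at y)" for x y
      using assms(2)[of x y] by (simp add: has_field_derivative_def)
    show "continuous (at (x, y) within UNIV \<times> UNIV) (\<lambda>(x, y). blinfun_mult_right (fy (x, y)))"
      using assms(3)
      by (auto simp: case_prod_unfold continuous_on_eq_continuous_at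
          intro!: bounded_linear.isCont[OF bounded_linear_blinfun_mult_right])
  qed auto
  then show ?thesis by (simp add: z case_prod_unfold)
qed

lemma Ck_on_imp_continuous_on: "Ck_on k S f \<Longrightarrow> continuous_on S f"
  by (induction k) (auto dest: Ck_on_Suc_imp simp del: Ck_on.simps(2))

lemma frechet_derivative_partials:
  fixes g :: "real \<times> real \<Rightarrow> real"
  assumes "(g has_derivative g') (at (x, y))"
  shows "((\<lambda>x. g (x, y)) has_real_derivative g' (1, 0)) (at x)"
    and "((\<lambda>y. g (x, y)) has_real_derivative g' (0, 1)) (at y)"
proof -
  have lin: "g' (h *\<^sub>R v) = g' v * h" for h v
    using linear_scale[OF has_derivative_linear[OF assms]] by simp
  have "((\<lambda>x. (x, y)) has_derivative (\<lambda>h. h *\<^sub>R (1, 0))) (at x)"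
    "((\<lambda>y. (x, y)) has_derivative (\<lambda>h. h *\<^sub>R (0, 1))) (at y)"
    by (auto intro!: derivative_eq_intros simp: fun_eq_iff)
  from this(1)[THEN has_derivative_compose, OF assms] this(2)[THEN has_derivative_compose, OF assms]
  show "((\<lambda>x. g (x, y)) has_real_derivative g' (1, 0)) (at x)"
    "((\<lambda>y. g (x, y)) has_real_derivative g' (0, 1)) (at y)"
    unfolding has_field_derivative_def by (simp_all only: lin)
qed

lemma Ck_on_partials_SucI:
  fixes f :: "real \<times> real \<Rightarrow> real"
  assumes "\<And>x y. ((\<lambda>x. f (x, y)) has_real_derivative fx (x, y)) (at x)"
    and "\<And>x y. ((\<lambda>y. f (x, y)) has_real_derivative fy (x, y)) (at y)"
    and "Ck_on k UNIV fx" "Ck_on k UNIV fy"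
  shows "Ck_on (Suc k) UNIV f"
  using has_derivative_real_partials[OF assms(1,2) Ck_on_imp_continuous_on[OF assms(4)]]
  by (rule Ck_on_SucI[OF open_UNIV]) (use assms(3,4) in \<open>auto simp: Basis_prod_def\<close>)

text \<open>The derivative in the upper limit is \<open>g\<close> itself, and the derivative in the
  parameter is an integral of the same kind, of a function with one order of smoothness
  less.\<close>

lemma Ck_on_line_int_fst:
  fixes g :: "real \<times> real \<Rightarrow> real"
  assumes "Ck_on k UNIV g"
  shows "Ck_on k UNIV (\<lambda>z. line_int a (\<lambda>s. g (s, snd z)) (fst z))"
  using assms
proof (induction k arbitrary: g)
  case 0
  then show ?case by (simp add: continuous_on_line_int)
next
  case (Suc k)
  define gy where "gy z = frechet_derivative g (at z) (0, 1)" for z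
  have gk: "Ck_on k UNIV g" by (rule Ck_on_Suc_imp[OF Suc.prems])
  have gyk: "Ck_on k UNIV gy"
    using Suc.prems by (auto simp: gy_def[abs_def] Basis_prod_def)
  have slice: "continuous_on UNIV (\<lambda>s. g (s, y))" for y
    by (rule continuous_on_compose2[OF Ck_on_imp_continuous_on[OF gk] _ subset_UNIV])
      (intro continuous_intros)
  show ?case
  proof (rule Ck_on_partials_SucI[OF _ _ gk Suc.IH[OF gyk]], unfold fst_conv snd_conv)
    show "(line_int a (\<lambda>s. g (s, y)) has_real_derivative g (x, y)) (at x)" for x y
      by (rule line_int_has_derivative[OF slice])
    show "((\<lambda>y. line_int a (\<lambda>s. g (s, y)) x) has_real_derivative line_int a (\<lambda>s. gy (s, y)) x) (at y)"
      for x y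
      by (rule line_int_leibniz[of "\<lambda>s y. g (s, y)" "\<lambda>s y. gy (s, y)"])
        (use slice Ck_on_imp_continuous_on[OF gyk]
           frechet_derivative_partials(2)[OF Ck_on_SucD[OF Suc.prems]] in \<open>auto simp: gy_def\<close>)
  qed
qed

lemma Ck_on_line_int_snd:
  fixes g :: "real \<times> real \<Rightarrow> real"
  assumes "Ck_on k UNIV g"
  shows "Ck_on k UNIV (\<lambda>z. line_int a (\<lambda>s. g (fst z, s)) (snd z))"
proof -
  have swap: "Ck_on k UNIV (\<lambda>z::real \<times> real. (snd z, fst z))" for k
    by (rule Ck_on_bounded_linear) (intro bounded_linear_Pair bounded_linear_fst bounded_linear_snd open_UNIV)+
  have "Ck_on k UNIV (\<lambda>z. g (snd z, fst z))"
    by (rule Ck_on_compose[OF open_UNIV _ assms swap]) simp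
  from Ck_on_compose[OF open_UNIV _ Ck_on_line_int_fst[OF this] swap] show ?thesis by simp
qed

section \<open>Contraction in an exponentially weighted norm\<close>

lemma line_int_weight_bounds:
  fixes g :: "real \<times> real \<Rightarrow> real"
  assumes g: "continuous_on UNIV g" and c: "c > 0" and X: "is_interval X" "a \<in> X" "x \<in> X"
    and le: "\<And>s y. s \<in> X \<Longrightarrow> \<bar>g (s, y)\<bar> \<le> c\<^sup>2 * D * exp (c * (\<bar>s - a\<bar> + \<bar>y - b\<bar>))"
  shows "\<bar>line_int b (\<lambda>t. g (x, t)) y\<bar> \<le> c * D * exp (c * (\<bar>x - a\<bar> + \<bar>y - b\<bar>))"
    and "\<bar>line_int a (\<lambda>s. g (s, y)) x\<bar> \<le> c * D * exp (c * (\<bar>x - a\<bar> + \<bar>y - b\<bar>))"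
    and "\<bar>line_int a (\<lambda>s. line_int b (\<lambda>t. g (s, t)) y) x\<bar> \<le> D * exp (c * (\<bar>x - a\<bar> + \<bar>y - b\<bar>))"
proof -
  have slices: "continuous_on UNIV (\<lambda>s. g (s, y))" "continuous_on UNIV (\<lambda>t. g (x, t))" for x y
    by (rule continuous_on_compose2[OF g _ subset_UNIV], intro continuous_intros)+
  have inner: "\<bar>line_int b (\<lambda>t. g (x, t)) y\<bar> \<le> c * D * exp (c * \<bar>x - a\<bar>) * exp (c * \<bar>y - b\<bar>)"
    if "x \<in> X" for x
  proof (rule line_int_exp_bound[OF slices(2) c, of UNIV])
    show "\<bar>g (x, t)\<bar> \<le> c * (c * D * exp (c * \<bar>x - a\<bar>)) * exp (c * \<bar>t - b\<bar>)" for t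
      using le[OF that, of t] by (simp add: power2_eq_square distrib_left exp_add mult_ac)
  qed (auto simp: is_interval_univ)
  from inner[OF X(3)] show "\<bar>line_int b (\<lambda>t. g (x, t)) y\<bar> \<le> c * D * exp (c * (\<bar>x - a\<bar> + \<bar>y - b\<bar>))"
    by (simp add: distrib_left exp_add mult_ac)
  have "\<bar>line_int a (\<lambda>s. g (s, y)) x\<bar> \<le> c * D * exp (c * \<bar>y - b\<bar>) * exp (c * \<bar>x - a\<bar>)"
  proof (rule line_int_exp_bound[OF slices(1) c X])
    show "\<bar>g (s, y)\<bar> \<le> c * (c * D * exp (c * \<bar>y - b\<bar>)) * exp (c * \<bar>s - a\<bar>)" if "s \<in> X" for s
      using le[OF that, of y] by (simp add: power2_eq_square distrib_left exp_add mult_ac)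
  qed
  then show "\<bar>line_int a (\<lambda>s. g (s, y)) x\<bar> \<le> c * D * exp (c * (\<bar>x - a\<bar> + \<bar>y - b\<bar>))"
    by (simp add: distrib_left exp_add mult_ac)
  have "\<bar>line_int a (\<lambda>s. line_int b (\<lambda>t. g (s, t)) y) x\<bar> \<le> D * exp (c * \<bar>y - b\<bar>) * exp (c * \<bar>x - a\<bar>)"
  proof (rule line_int_exp_bound[OF _ c X])
    show "continuous_on UNIV (\<lambda>s. line_int b (\<lambda>t. g (s, t)) y)"
      using continuous_on_compose2[OF continuous_on_line_int(2)[OF g, of b] _ subset_UNIV,
          of UNIV "\<lambda>s. (s, y)"] by (simp add: continuous_intros)
    show "\<bar>line_int b (\<lambda>t. g (s, t)) y\<bar> \<le> c * (D * exp (c * \<bar>y - b\<bar>)) * exp (c * \<bar>s - a\<bar>)"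
      if "s \<in> X" for s
      using inner[OF that] by (simp add: mult_ac)
  qed
  then show "\<bar>line_int a (\<lambda>s. line_int b (\<lambda>t. g (s, t)) y) x\<bar> \<le> D * exp (c * (\<bar>x - a\<bar> + \<bar>y - b\<bar>))"
    by (simp add: distrib_left exp_add mult_ac)
qed

text \<open>In the sup norm weighted by \<open>exp (c (\<bar>x - a\<bar> + \<bar>y - b\<bar>))\<close> the integral operator is a contraction
  on the whole plane.\<close>

lemma goursat_fixpoint:
  fixes K :: "real \<times> real \<Rightarrow> real" and f :: "real \<Rightarrow> real"
  assumes K: "continuous_on UNIV K" "\<And>z. \<bar>K z\<bar> \<le> c\<^sup>2 / 2" and c: "c > 0"
    and f: "continuous_on UNIV f" "\<And>x. \<bar>f x\<bar> \<le> B"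
  obtains P C where "continuous_on UNIV P"
    and "\<And>x y. \<bar>P (x, y)\<bar> \<le> C * exp (c * (\<bar>x - a\<bar> + \<bar>y - b\<bar>))"
    and "\<And>x y. P (x, y) = f x + line_int a (\<lambda>s. line_int b (\<lambda>t. K (s, t) * P (s, t)) y) x"
proof -
  define w where "w z = exp (c * (\<bar>fst z - a\<bar> + \<bar>snd z - b\<bar>))" for z
  define G where "G g z = line_int a (\<lambda>s. line_int b (\<lambda>t. g (s, t)) (snd z)) (fst z)"
    for g :: "real \<times> real \<Rightarrow> real" and z
  \<comment> \<open>The unknown is \<open>Q = P / w\<close>, so the weighted space becomes the
    complete space of bounded continuous functions.\<close>
  define T where "T Q z = (f (fst z) + G (\<lambda>z. K z * (w z * apply_bcontfun Q z)) z) / w z" for Q z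
  have wc: "continuous_on UNIV w" unfolding w_def by (intro continuous_intros)
  have w1: "w z \<ge> 1" for z using c by (simp add: w_def)
  have wne: "w z \<noteq> 0" for z using w1[of z] by auto
  have Gc: "continuous_on UNIV (G g)" if "continuous_on UNIV g" for g
    using continuous_on_line_int(1)[OF continuous_on_line_int(2)[OF that, of b], of a]
    by (simp add: G_def[abs_def])
  have Qc: "continuous_on UNIV (\<lambda>z. K z * (w z * apply_bcontfun Q z))" for Q
    by (intro continuous_intros K wc) simp
  \<comment> \<open>The two integrations gain \<open>1 / c^2\<close> against a kernel of size
    \<open>c^2 / 2\<close>; this is the contraction factor 1/2.\<close>
  have Gb: "\<bar>G g z\<bar> \<le> D / 2 * w z"
    if "continuous_on UNIV g" "\<And>z. \<bar>g z\<bar> \<le> c\<^sup>2 / 2 * D * w z" for g D z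
    using line_int_weight_bounds(3)[OF that(1) c is_interval_univ UNIV_I UNIV_I, where D = "D / 2" and a = a and b = b] that(2)
    by (auto simp: w_def G_def)
  have Tb: "\<bar>T Q z\<bar> \<le> B + norm Q / 2" for Q z
  proof -
    have "\<bar>G (\<lambda>z. K z * (w z * apply_bcontfun Q z)) z\<bar> \<le> norm Q / 2 * w z"
    proof (rule Gb[OF Qc])
      fix z
      have "\<bar>K z\<bar> * (w z * \<bar>apply_bcontfun Q z\<bar>) \<le> c\<^sup>2 / 2 * (w z * norm Q)"
        using norm_bounded[of Q z] K(2)[of z] w1[of z]
        by (intro mult_mono mult_left_mono mult_nonneg_nonneg) auto
      then show "\<bar>K z * (w z * apply_bcontfun Q z)\<bar> \<le> c\<^sup>2 / 2 * norm Q * w z"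
        using w1[of z] by (simp add: abs_mult mult_ac)
    qed
    moreover have "\<bar>f (fst z)\<bar> \<le> B * w z"
      using f(2)[of "fst z"] w1[of z] mult_left_mono[of 1 "w z" B] abs_ge_zero[of "f (fst z)"] by linarith
    ultimately have "\<bar>f (fst z) + G (\<lambda>z. K z * (w z * apply_bcontfun Q z)) z\<bar> \<le> (B + norm Q / 2) * w z"
      by (simp add: distrib_right)
    then show ?thesis
      using w1[of z] by (simp add: T_def abs_divide divide_simps)
  qed
  have Tc: "continuous_on UNIV (T Q)" for Q
    unfolding T_def
    by (intro continuous_on_divide continuous_on_add wc Gc Qc
        continuous_on_compose2[OF f(1) continuous_on_fst[OF continuous_on_id] subset_UNIV] ballI wne)
  have Tin: "T Q \<in> bcontfun" for Q
    by (rule bcontfun_normI[OF Tc]) (use Tb in auto)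
  define T' where "T' Q = Bcontfun (T Q)" for Q
  have T': "apply_bcontfun (T' Q) = T Q" for Q
    unfolding T'_def by (rule Bcontfun_inverse[OF Tin])
  have contr: "dist (T' Q) (T' R) \<le> 1 / 2 * dist Q R" for Q R
  proof (rule dist_bound)
    fix z
    let ?d = "\<lambda>z. K z * (w z * apply_bcontfun Q z) - K z * (w z * apply_bcontfun R z)"
    have sl: "continuous_on UNIV (\<lambda>t. K (s, t) * (w (s, t) * apply_bcontfun Q (s, t)))" for s Q
      by (rule continuous_on_compose2[OF Qc _ subset_UNIV]) (intro continuous_intros)
    have li: "continuous_on UNIV (\<lambda>s. line_int b (\<lambda>t. K (s, t) * (w (s, t) * apply_bcontfun Q (s, t))) y)" for y Q
      using continuous_on_compose2[OF continuous_on_line_int(2)[OF Qc, of b] _ subset_UNIV,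
          of UNIV "\<lambda>s. (s, y)"] by (simp add: continuous_intros)
    have "T Q z - T R z = G ?d z / w z"
      unfolding T_def G_def by (simp add: line_int_diff sl li diff_divide_distrib[symmetric])
    moreover have "\<bar>G ?d z\<bar> \<le> dist Q R / 2 * w z"
    proof (rule Gb)
      show "continuous_on UNIV ?d" by (intro continuous_on_diff Qc)
      fix z
      have "\<bar>K z\<bar> * (w z * \<bar>apply_bcontfun Q z - apply_bcontfun R z\<bar>) \<le> c\<^sup>2 / 2 * (w z * dist Q R)"
        using dist_bounded[of Q z R] K(2)[of z] w1[of z]
        by (intro mult_mono mult_left_mono mult_nonneg_nonneg) (auto simp: dist_real_def)
      moreover have "?d z = K z * (w z * (apply_bcontfun Q z - apply_bcontfun R z))"
        by (simp add: algebra_simps)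
      ultimately show "\<bar>?d z\<bar> \<le> c\<^sup>2 / 2 * dist Q R * w z"
        using w1[of z] by (simp add: abs_mult mult_ac)
    qed
    ultimately have "\<bar>T Q z - T R z\<bar> \<le> dist Q R / 2 * w z / \<bar>w z\<bar>"
      by (simp only: abs_divide divide_right_mono abs_ge_zero)
    then show "dist (apply_bcontfun (T' Q) z) (apply_bcontfun (T' R) z) \<le> 1 / 2 * dist Q R"
      unfolding T' dist_real_def using w1[of z] by simp
  qed
  obtain Q where Q: "T' Q = Q"
    using banach_fix_type[of "1 / 2" T'] contr by auto
  show thesis
  proof (rule that[of "\<lambda>z. w z * apply_bcontfun Q z" "norm Q"])
    show "continuous_on UNIV (\<lambda>z. w z * apply_bcontfun Q z)"
      by (intro continuous_intros wc) simp
    show "\<bar>w (x, y) * apply_bcontfun Q (x, y)\<bar> \<le> norm Q * exp (c * (\<bar>x - a\<bar> + \<bar>y - b\<bar>))" for x y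
      using norm_bounded[of Q "(x, y)"] by (simp add: w_def abs_mult mult.commute mult_left_mono)
    have "w z * apply_bcontfun Q z = f (fst z) + G (\<lambda>z. K z * (w z * apply_bcontfun Q z)) z" for z
    proof -
      have "apply_bcontfun Q z = T Q z" using T'[of Q] unfolding Q by (rule fun_cong)
      then have "w z * apply_bcontfun Q z = w z * T Q z" by (rule arg_cong)
      also have "\<dots> = f (fst z) + G (\<lambda>z. K z * (w z * apply_bcontfun Q z)) z"
        unfolding T_def using wne[of z] by simp
      finally show ?thesis .
    qed
    from this[of "(x, y)" for x y] show "w (x, y) * apply_bcontfun Q (x, y) = f x +
        line_int a (\<lambda>s. line_int b (\<lambda>t. K (s, t) * (w (s, t) * apply_bcontfun Q (s, t))) y) x" for x y
      unfolding G_def fst_conv snd_conv .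
  qed
qed

text \<open>The data are \<open>f x\<close> on \<open>y = b\<close> and the constant
  \<open>f a\<close> on \<open>x = a\<close>. Smoothness is bootstrapped: if \<open>P\<close> is
  \<open>C^k\<close>, then the integral formulas make \<open>Px\<close> and \<open>Py\<close> of
  class \<open>C^k\<close>, hence \<open>P\<close> of class \<open>C^(k+1)\<close>. The last
  conclusion expresses causality: for \<open>x\<close> in an interval around \<open>a\<close>, only
  the data on that interval count. It serves both to make the solution vanish ahead of the packet
  and to bound it on the packet.\<close>

theorem goursat:
  fixes K :: "real \<times> real \<Rightarrow> real" and f :: "real \<Rightarrow> real"
  assumes K: "\<And>k. Ck_on k UNIV K" "\<And>z. \<bar>K z\<bar> \<le> c\<^sup>2 / 2" and c: "c > 0"
    and f: "\<And>k. Ck_on k UNIV f'" "\<And>x. (f has_real_derivative f' x) (at x)" "\<And>x. \<bar>f x\<bar> \<le> B"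
  obtains P Px Py :: "real \<times> real \<Rightarrow> real" where
    "\<And>k. Ck_on k UNIV P" "\<And>k. Ck_on k UNIV Px" "\<And>k. Ck_on k UNIV Py"
    "\<And>x y. ((\<lambda>x. P (x, y)) has_real_derivative Px (x, y)) (at x)"
    "\<And>x y. ((\<lambda>y. P (x, y)) has_real_derivative Py (x, y)) (at y)"
    "\<And>x y. ((\<lambda>y. Px (x, y)) has_real_derivative K (x, y) * P (x, y)) (at y)"
    "\<And>x y. ((\<lambda>x. Py (x, y)) has_real_derivative K (x, y) * P (x, y)) (at x)"
    "\<And>X F x y. is_interval X \<Longrightarrow> a \<in> X \<Longrightarrow> x \<in> X \<Longrightarrow> (\<And>s. s \<in> X \<Longrightarrow> \<bar>f s\<bar> \<le> F) \<Longrightarrow>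
       \<bar>P (x, y)\<bar> \<le> 2 * F * exp (c * (\<bar>x - a\<bar> + \<bar>y - b\<bar>)) \<and>
       \<bar>Px (x, y) - f' x\<bar> \<le> c * F * exp (c * (\<bar>x - a\<bar> + \<bar>y - b\<bar>)) \<and>
       \<bar>Py (x, y)\<bar> \<le> c * F * exp (c * (\<bar>x - a\<bar> + \<bar>y - b\<bar>))"
proof -
  have fc: "continuous_on UNIV f"
    using f(2) by (auto intro!: continuous_at_imp_continuous_on intro: DERIV_isCont)
  have Kc: "continuous_on UNIV K" using Ck_on_imp_continuous_on[OF K(1)] .
  obtain P C where Pc: "continuous_on UNIV P"
    and PC: "\<And>x y. \<bar>P (x, y)\<bar> \<le> C * exp (c * (\<bar>x - a\<bar> + \<bar>y - b\<bar>))"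
    and Peq: "\<And>x y. P (x, y) = f x + line_int a (\<lambda>s. line_int b (\<lambda>t. K (s, t) * P (s, t)) y) x"
    by (rule goursat_fixpoint[OF Kc K(2) c fc f(3), where a = a and b = b]) (rule that)
  define g where "g z = K z * P z" for z
  define Px where "Px z = f' (fst z) + line_int b (\<lambda>t. g (fst z, t)) (snd z)" for z
  define Py where "Py z = line_int a (\<lambda>s. g (s, snd z)) (fst z)" for z
  have gc: "continuous_on UNIV g" unfolding g_def by (intro continuous_intros Kc Pc)
  have slices: "continuous_on UNIV (\<lambda>s. g (s, y))" "continuous_on UNIV (\<lambda>t. g (x, t))" for x y
    by (rule continuous_on_compose2[OF gc _ subset_UNIV], intro continuous_intros)+
  have li: "continuous_on UNIV (\<lambda>s. line_int b (\<lambda>t. g (s, t)) y)" for y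
    using continuous_on_compose2[OF continuous_on_line_int(2)[OF gc, of b] _ subset_UNIV,
        of UNIV "\<lambda>s. (s, y)"] by (simp add: continuous_intros)
  have Peq': "P (x, y) = f x + line_int a (\<lambda>s. line_int b (\<lambda>t. g (s, t)) y) x" for x y
    unfolding g_def by (rule Peq)
  have dx: "((\<lambda>x. P (x, y)) has_real_derivative Px (x, y)) (at x)" for x y
    unfolding Peq' Px_def fst_conv snd_conv
    by (intro DERIV_add f(2) line_int_has_derivative[OF li])
  have dy: "((\<lambda>y. P (x, y)) has_real_derivative Py (x, y)) (at y)" for x y
  proof -
    have "((\<lambda>y. line_int a (\<lambda>s. line_int b (\<lambda>t. g (s, t)) y) x) has_real_derivative
        line_int a (\<lambda>s. g (s, y)) x) (at y)"
      by (rule line_int_leibniz[of "\<lambda>s. line_int b (\<lambda>t. g (s, t))" "\<lambda>s y. g (s, y)"])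
        (use li gc line_int_has_derivative[OF slices(2)] in auto)
    then show ?thesis
      unfolding Peq' Py_def by (auto intro!: derivative_eq_intros)
  qed
  have smooth: "Ck_on k UNIV P \<and> Ck_on k UNIV Px \<and> Ck_on k UNIV Py" for k
  proof -
    have step: "Ck_on k UNIV Px \<and> Ck_on k UNIV Py" if "Ck_on k UNIV P" for k
    proof -
      have "Ck_on k UNIV g" unfolding g_def by (intro Ck_on_mult open_UNIV K(1) that)
      moreover have "Ck_on k UNIV (\<lambda>z::real \<times> real. f' (fst z))"
        by (rule Ck_on_compose[OF open_UNIV _ f(1) Ck_on_bounded_linear[OF bounded_linear_fst open_UNIV]]) simp
      ultimately show ?thesis
        unfolding Px_def Py_def
        by (intro conjI Ck_on_add open_UNIV Ck_on_line_int_fst Ck_on_line_int_snd)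
    qed
    have "Ck_on k UNIV P"
    proof (induction k)
      case 0
      show ?case using Pc by simp
    next
      case (Suc k)
      then show ?case using step by (intro Ck_on_partials_SucI[OF dx dy]) auto
    qed
    with step show ?thesis by blast
  qed
  show thesis
  proof (rule that[of P Px Py])
    show "((\<lambda>y. Px (x, y)) has_real_derivative K (x, y) * P (x, y)) (at y)" for x y
      using line_int_has_derivative[OF slices(2), of b x y]
      by (auto simp: Px_def g_def intro!: derivative_eq_intros)
    show "((\<lambda>x. Py (x, y)) has_real_derivative K (x, y) * P (x, y)) (at x)" for x y
      using line_int_has_derivative[OF slices(1), of a y x] by (simp add: Py_def g_def)
    fix X :: "real set" and F x y
    assume X: "is_interval X" "a \<in> X" "x \<in> X" and F: "\<And>s. s \<in> X \<Longrightarrow> \<bar>f s\<bar> \<le> F"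
    define w where "w z = exp (c * (\<bar>fst z - a\<bar> + \<bar>snd z - b\<bar>))" for z
    have w1: "w z \<ge> 1" for z using c by (simp add: w_def)
    have gb: "\<bar>g (s, y)\<bar> \<le> c\<^sup>2 * (D / 2) * w (s, y)" if "\<bar>P (s, y)\<bar> \<le> D * w (s, y)" for s y D
    proof -
      have "\<bar>K (s, y)\<bar> * \<bar>P (s, y)\<bar> \<le> c\<^sup>2 / 2 * (D * w (s, y))"
        by (intro mult_mono K(2) that) auto
      then show ?thesis by (simp add: g_def abs_mult mult_ac)
    qed
    \<comment> \<open>The optimal weighted constant on the strip, finite thanks to the global bound
      with \<open>C\<close>. The integral equation gives \<open>S \<le> F + S / 2\<close>, and
      finiteness allows the last term to be absorbed, so \<open>S \<le> 2 * F\<close>.\<close>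
    define S where "S = (SUP z\<in>X \<times> UNIV. \<bar>P z\<bar> / w z)"
    have bdd: "bdd_above ((\<lambda>z. \<bar>P z\<bar> / w z) ` (X \<times> UNIV))"
      by (rule bdd_aboveI2[of _ _ C]) (use PC in \<open>auto simp: w_def divide_simps\<close>)
    have PS: "\<bar>P (s, y)\<bar> \<le> S * w (s, y)" if "s \<in> X" for s y
    proof -
      have "\<bar>P (s, y)\<bar> / w (s, y) \<le> S"
        unfolding S_def by (rule cSUP_upper[OF _ bdd]) (use that in auto)
      then show ?thesis using w1[of "(s, y)"] by (simp add: divide_simps)
    qed
    have "S \<le> F + S / 2"
      unfolding S_def
    proof (rule cSUP_least, unfold S_def[symmetric])
      show "X \<times> UNIV \<noteq> {}" using X by auto
      fix z assume "z \<in> X \<times> (UNIV :: real set)"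
      then obtain s y where z: "z = (s, y)" "s \<in> X" by auto
      have "\<bar>line_int a (\<lambda>s. line_int b (\<lambda>t. g (s, t)) y) s\<bar> \<le> S / 2 * w z"
        using line_int_weight_bounds(3)[OF gc c X(1,2) z(2), where D = "S / 2" and b = b and y = y] gb[OF PS]
        by (auto simp: w_def z)
      moreover have "\<bar>f s\<bar> \<le> F * w z"
        using F[OF z(2)] w1[of z] mult_left_mono[of 1 "w z" F] abs_ge_zero[of "f s"] by linarith
      ultimately have "\<bar>P z\<bar> \<le> (F + S / 2) * w z"
        unfolding z(1) Peq' by (simp add: distrib_right z(1))
      then show "\<bar>P z\<bar> / w z \<le> F + S / 2" using w1[of z] by (simp add: divide_simps)
    qed
    then have PF: "\<bar>P (s, y)\<bar> \<le> 2 * F * w (s, y)" if "s \<in> X" for s y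
      using PS[OF that, of y] w1[of "(s, y)"] mult_right_mono[of S "2 * F" "w (s, y)"] by linarith
    have "\<bar>g (s, y)\<bar> \<le> c\<^sup>2 * F * exp (c * (\<bar>s - a\<bar> + \<bar>y - b\<bar>))" if "s \<in> X" for s y
      using gb[OF PF[OF that]] by (simp add: w_def)
    from line_int_weight_bounds(1,2)[OF gc c X this]
    show "\<bar>P (x, y)\<bar> \<le> 2 * F * exp (c * (\<bar>x - a\<bar> + \<bar>y - b\<bar>)) \<and>
       \<bar>Px (x, y) - f' x\<bar> \<le> c * F * exp (c * (\<bar>x - a\<bar> + \<bar>y - b\<bar>)) \<and>
       \<bar>Py (x, y)\<bar> \<le> c * F * exp (c * (\<bar>x - a\<bar> + \<bar>y - b\<bar>))"
      using PF[OF X(3), of y] by (simp add: Px_def Py_def w_def)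
  qed (use smooth dx dy in auto)
qed

section \<open>Spherically symmetric fields\<close>

lemma has_derivative_vec_nth: "((\<lambda>q. q $ i) has_derivative (\<lambda>h. h $ i)) (at p)"
  by (rule bounded_linear_imp_has_derivative[OF bounded_linear_vec_nth])

definition rad_dir :: "real ^ 4 \<Rightarrow> real ^ 4 \<Rightarrow> real" where
  "rad_dir p h = (p $ 2 * h $ 2 + p $ 3 * h $ 3 + p $ 4 * h $ 4) / radius p"

lemma radius_eq_sqrt: "radius p = sqrt (p $ 2 * p $ 2 + p $ 3 * p $ 3 + p $ 4 * p $ 4)"
  using radius_sq[of p] real_sqrt_unique[of "radius p"] by (simp add: power2_eq_square)

lemma radius_has_derivative:
  assumes "radius p > 0"
  shows "(radius has_derivative rad_dir p) (at p)"
proof -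
  have pos: "p $ 2 * p $ 2 + p $ 3 * p $ 3 + p $ 4 * p $ 4 > 0"
    using zero_less_power[OF assms, of 2] unfolding radius_sq by (simp add: power2_eq_square)
  have "((\<lambda>p. sqrt (p $ 2 * p $ 2 + p $ 3 * p $ 3 + p $ 4 * p $ 4)) has_derivative rad_dir p) (at p)"
    by (rule derivative_eq_intros has_derivative_vec_nth pos refl)+
      (simp add: fun_eq_iff rad_dir_def radius_eq_sqrt divide_simps)
  then show ?thesis by (simp add: radius_eq_sqrt[abs_def])
qed

lemma radial_has_derivative:
  assumes "radius p > 0" "(F has_derivative F') (at (p $ 1, radius p))"
  shows "((\<lambda>q. F (q $ 1, radius q)) has_derivative (\<lambda>h. F' (h $ 1, rad_dir p h))) (at p)"
  by (rule has_derivative_compose[OF has_derivative_Pair[OF has_derivative_vec_nth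
          radius_has_derivative[OF assms(1)]] assms(2)])

lemma rad_dir_axis:
  "rad_dir p (axis 1 1) = 0" "rad_dir p (axis 2 1) = p $ 2 / radius p"
  "rad_dir p (axis 3 1) = p $ 3 / radius p" "rad_dir p (axis 4 1) = p $ 4 / radius p"
  by (simp_all add: rad_dir_def axis_def)

lemma continuous_on_radius: "continuous_on S radius"
  unfolding radius_eq_sqrt by (intro continuous_intros)

lemma open_ingoing_chart: "open ingoing_chart"
  unfolding ingoing_chart_def
  by (intro open_Collect_less continuous_on_const continuous_on_radius)

lemma schw_N_components:
  assumes "radius p > 0"
  shows "schw_N m p $ 1 = 1 + 2 * m / radius p"
    "schw_N m p $ 2 = - 2 * m / radius p * (p $ 2 / radius p)"
    "schw_N m p $ 3 = - 2 * m / radius p * (p $ 3 / radius p)"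
    "schw_N m p $ 4 = - 2 * m / radius p * (p $ 4 / radius p)"
  by (simp_all add: schw_N_def sharp_def matrix_inv_schw[OF assms] schw_inv_def matrix_vector_mult_def
      sum_4 null_covector_def axis_def)

locale radial_field =
  fixes m :: real and \<Phi> \<Phi>t \<Phi>r :: "real \<times> real \<Rightarrow> real"
  assumes field_deriv: "\<And>z. snd z > 0 \<Longrightarrow> (\<Phi> has_derivative (\<lambda>h. \<Phi>t z * fst h + \<Phi>r z * snd h)) (at z)"
begin

definition field :: "real ^ 4 \<Rightarrow> complex" where
  "field p = complex_of_real (\<Phi> (p $ 1, radius p))"

lemma frechet_field:
  assumes "radius p > 0"
  shows "frechet_derivative field (at p) h =
    complex_of_real (\<Phi>t (p $ 1, radius p) * h $ 1 + \<Phi>r (p $ 1, radius p) * rad_dir p h)"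
proof -
  have "((\<lambda>q. \<Phi> (q $ 1, radius q)) has_derivative
      (\<lambda>h. \<Phi>t (p $ 1, radius p) * h $ 1 + \<Phi>r (p $ 1, radius p) * rad_dir p h)) (at p)"
    using radial_has_derivative[OF assms field_deriv[of "(p $ 1, radius p)"]] assms by simp
  from bounded_linear.has_derivative[OF bounded_linear_of_real this]
  have D: "(field has_derivative (\<lambda>h. complex_of_real
      (\<Phi>t (p $ 1, radius p) * h $ 1 + \<Phi>r (p $ 1, radius p) * rad_dir p h))) (at p)"
    by (simp add: field_def[abs_def])
  show ?thesis unfolding frechet_derivative_at[OF D, symmetric] ..
qed

lemma pderiv_field:
  assumes "radius p > 0"
  shows "pderiv_at field p 1 = complex_of_real (\<Phi>t (p $ 1, radius p))"
    "pderiv_at field p 2 = complex_of_real (\<Phi>r (p $ 1, radius p) * (p $ 2 / radius p))"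
    "pderiv_at field p 3 = complex_of_real (\<Phi>r (p $ 1, radius p) * (p $ 3 / radius p))"
    "pderiv_at field p 4 = complex_of_real (\<Phi>r (p $ 1, radius p) * (p $ 4 / radius p))"
  unfolding pderiv_at_def frechet_field[OF assms] rad_dir_axis by (simp_all add: axis_def)

text \<open>With \<open>grad_r\<close> below, the contravariant components of the gradient along
  \<open>t*\<close> and \<open>r\<close>. The negative of \<open>grad_t\<close> is also the
  derivative in direction \<open>N\<close>.\<close>

definition grad_t :: "real \<times> real \<Rightarrow> real" where
  "grad_t z = - (1 + 2 * m / snd z) * \<Phi>t z + 2 * m / snd z * \<Phi>r z"

definition grad_r :: "real \<times> real \<Rightarrow> real" where
  "grad_r z = (1 - 2 * m / snd z) * \<Phi>r z + 2 * m / snd z * \<Phi>t z"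

text \<open>The density is 1 in these coordinates. The spatial part is written as the position
  vector times a scalar, so that taking its divergence needs only the product rule.\<close>

lemma raised_gradient:
  assumes "radius p > 0"
  shows "(\<Sum>j\<in>UNIV. complex_of_real (vol_density (schw m) p * matrix_inv (schw m p) $ i $ j) * pderiv_at field p j)
    = complex_of_real (if i = 1 then grad_t (p $ 1, radius p)
        else p $ i * (grad_r (p $ 1, radius p) / radius p))"
proof -
  define a b c where "a = p $ 2 / radius p" and "b = p $ 3 / radius p" and "c = p $ 4 / radius p"
  define h where "h = 2 * m / radius p"
  define A B where "A = \<Phi>t (p $ 1, radius p)" and "B = \<Phi>r (p $ 1, radius p)"
  have c2: "c * c = 1 - a * a - b * b"
    using unit_direction[OF assms] by (simp add: a_def b_def c_def power2_eq_square)
  have vol: "vol_density (schw m) p = 1" by (simp add: vol_density_def det_schw[OF assms])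
  have sp: "p $ i * (x / radius p) = (p $ i / radius p) * x" for i x by simp
  have i: "i = 1 \<or> i = 2 \<or> i = 3 \<or> i = 4" using forall_4[of "\<lambda>i. i = 1 \<or> i = 2 \<or> i = 3 \<or> i = 4"] by simp
  have inv:
    "schw_inv m p $ 1 $ 1 = - 1 - h * (- 1) * (- 1)"
    "schw_inv m p $ 1 $ 2 = 0 - h * (- 1) * (a)"
    "schw_inv m p $ 1 $ 3 = 0 - h * (- 1) * (b)"
    "schw_inv m p $ 1 $ 4 = 0 - h * (- 1) * (c)"
    "schw_inv m p $ 2 $ 1 = 0 - h * (a) * (- 1)"
    "schw_inv m p $ 2 $ 2 = 1 - h * (a) * (a)"
    "schw_inv m p $ 2 $ 3 = 0 - h * (a) * (b)"
    "schw_inv m p $ 2 $ 4 = 0 - h * (a) * (c)"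
    "schw_inv m p $ 3 $ 1 = 0 - h * (b) * (- 1)"
    "schw_inv m p $ 3 $ 2 = 0 - h * (b) * (a)"
    "schw_inv m p $ 3 $ 3 = 1 - h * (b) * (b)"
    "schw_inv m p $ 3 $ 4 = 0 - h * (b) * (c)"
    "schw_inv m p $ 4 $ 1 = 0 - h * (c) * (- 1)"
    "schw_inv m p $ 4 $ 2 = 0 - h * (c) * (a)"
    "schw_inv m p $ 4 $ 3 = 0 - h * (c) * (b)"
    "schw_inv m p $ 4 $ 4 = 1 - h * (c) * (c)"
    by (simp_all add: schw_inv_def null_covector_def a_def b_def c_def h_def)
  have e1: "schw_inv m p $ 1 $ 1 * A + schw_inv m p $ 1 $ 2 * (B * a)
      + schw_inv m p $ 1 $ 3 * (B * b) + schw_inv m p $ 1 $ 4 * (B * c) = - (1 + h) * A + h * B"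
    unfolding inv using c2 by algebra
  have e2: "schw_inv m p $ 2 $ 1 * A + schw_inv m p $ 2 $ 2 * (B * a)
      + schw_inv m p $ 2 $ 3 * (B * b) + schw_inv m p $ 2 $ 4 * (B * c) = a * ((1 - h) * B + h * A)"
    unfolding inv using c2 by algebra
  have e3: "schw_inv m p $ 3 $ 1 * A + schw_inv m p $ 3 $ 2 * (B * a)
      + schw_inv m p $ 3 $ 3 * (B * b) + schw_inv m p $ 3 $ 4 * (B * c) = b * ((1 - h) * B + h * A)"
    unfolding inv using c2 by algebra
  have e4: "schw_inv m p $ 4 $ 1 * A + schw_inv m p $ 4 $ 2 * (B * a)
      + schw_inv m p $ 4 $ 3 * (B * b) + schw_inv m p $ 4 $ 4 * (B * c) = c * ((1 - h) * B + h * A)"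
    unfolding inv using c2 by algebra
  have gr: "grad_t (p $ 1, radius p) = - (1 + h) * A + h * B"
    "grad_r (p $ 1, radius p) = (1 - h) * B + h * A"
    by (simp_all add: grad_t_def grad_r_def h_def A_def B_def)
  have "schw_inv m p $ i $ 1 * A + schw_inv m p $ i $ 2 * (B * a)
      + schw_inv m p $ i $ 3 * (B * b) + schw_inv m p $ i $ 4 * (B * c)
      = (if i = 1 then - (1 + h) * A + h * B else p $ i / radius p * ((1 - h) * B + h * A))"
    using i
  proof (elim disjE)
    assume "i = 1" then show ?thesis using e1 by simp
  next
    assume "i = 2" then show ?thesis using e2 by (simp add: a_def)
  next
    assume "i = 3" then show ?thesis using e3 by (simp add: b_def)
  next
    assume "i = 4" then show ?thesis using e4 by (simp add: c_def)
  qed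
  then show ?thesis
    unfolding vol matrix_inv_schw[OF assms] sum_4 pderiv_field[OF assms] of_real_mult[symmetric]
      of_real_add[symmetric] of_real_eq_iff sp mult_1
      a_def[symmetric] b_def[symmetric] c_def[symmetric] A_def[symmetric] B_def[symmetric] gr .
qed

text \<open>The divergence of the position vector times \<open>C\<close> is
  \<open>3 C + r C_r\<close>, with \<open>C = grad_r / r\<close>.\<close>

lemma wave_op_field:
  assumes r: "radius p > 0"
    and A': "(grad_t has_derivative A') (at (p $ 1, radius p))"
    and C': "((\<lambda>z. grad_r z / snd z) has_derivative C') (at (p $ 1, radius p))"
  shows "wave_op (schw m) field p = complex_of_real
    (A' (1, 0) + 3 * (grad_r (p $ 1, radius p) / radius p) + radius p * C' (0, 1))"
proof -
  define X where "X i q = (\<Sum>j\<in>UNIV. complex_of_real (vol_density (schw m) q * matrix_inv (schw m q) $ i $ j)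
      * pderiv_at field q j)" for i q
  define C where "C q = grad_r (q $ 1, radius q) / radius q" for q
  have pin: "p \<in> ingoing_chart" using r by (simp add: ingoing_chart_def)
  \<comment> \<open>The formula for the raised gradient holds only on the chart; since the chart is
    open, it may still be differentiated at \<open>p\<close>.\<close>
  have germ: "pderiv_at (X i) p i = complex_of_real (D (axis i 1))"
    if "((\<lambda>q. if i = 1 then grad_t (q $ 1, radius q) else q $ i * C q) has_derivative D) (at p)" for i D
  proof -
    have "complex_of_real (if i = 1 then grad_t (q $ 1, radius q) else q $ i * C q) = X i q"
      if "q \<in> ingoing_chart" for q
      using that unfolding X_def C_def ingoing_chart_def by (intro raised_gradient[symmetric]) simp
    from has_derivative_transform_within_open[OF
        bounded_linear.has_derivative[OF bounded_linear_of_real that] open_ingoing_chart pin this]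
    have XD: "(X i has_derivative (\<lambda>h. complex_of_real (D h))) (at p)" .
    show ?thesis
      unfolding pderiv_at_def frechet_derivative_at[OF XD, symmetric] ..
  qed
  have t: "((\<lambda>q. grad_t (q $ 1, radius q)) has_derivative (\<lambda>h. A' (h $ 1, rad_dir p h))) (at p)"
    by (rule radial_has_derivative[OF r A'])
  have CD: "(C has_derivative (\<lambda>h. C' (h $ 1, rad_dir p h))) (at p)"
    using radial_has_derivative[OF r C'] by (simp add: C_def[abs_def])
  have s: "((\<lambda>q. q $ i * C q) has_derivative (\<lambda>h. p $ i * C' (h $ 1, rad_dir p h) + h $ i * C p)) (at p)" for i
    by (rule has_derivative_mult[OF has_derivative_vec_nth CD])
  have lin: "C' (0, x) = x * C' (0, 1)" for x
    using linear_scale[OF has_derivative_linear[OF C'], of x "(0, 1)"] by simp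
  have 1: "pderiv_at (X 1) p 1 = complex_of_real (A' (1, 0))"
    using germ[of 1, simplified, OF t] by (simp add: rad_dir_axis)
  have 2: "pderiv_at (X i) p i = complex_of_real (p $ i * (p $ i / radius p) * C' (0, 1) + C p)"
    if "i \<noteq> 1" "rad_dir p (axis i 1) = p $ i / radius p" for i
  proof -
    have "axis i (1::real) $ 1 = 0" using that(1) by (simp add: axis_def)
    then show ?thesis
      using germ[of i "\<lambda>h. p $ i * C' (h $ 1, rad_dir p h) + h $ i * C p"] s[of i] that
        lin[of "p $ i / radius p"] by simp
  qed
  have sq: "p $ 2 * (p $ 2 / radius p) + p $ 3 * (p $ 3 / radius p) + p $ 4 * (p $ 4 / radius p) = radius p"
    using radius_sq[of p] r by (simp add: field_simps power2_eq_square)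
  have "p $ 2 * (p $ 2 / radius p) * C' (0, 1) + C p + (p $ 3 * (p $ 3 / radius p) * C' (0, 1) + C p)
      + (p $ 4 * (p $ 4 / radius p) * C' (0, 1) + C p)
      = (p $ 2 * (p $ 2 / radius p) + p $ 3 * (p $ 3 / radius p) + p $ 4 * (p $ 4 / radius p)) * C' (0, 1) + 3 * C p"
    by (simp add: distrib_right)
  then have sum: "A' (1, 0) + (p $ 2 * (p $ 2 / radius p) * C' (0, 1) + C p)
      + (p $ 3 * (p $ 3 / radius p) * C' (0, 1) + C p) + (p $ 4 * (p $ 4 / radius p) * C' (0, 1) + C p)
      = A' (1, 0) + 3 * C p + radius p * C' (0, 1)"
    unfolding sq by linarith
  have ne: "(2::4) \<noteq> 1" "(3::4) \<noteq> 1" "(4::4) \<noteq> 1" by simp_all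
  have "wave_op (schw m) field p = complex_of_real (1 / vol_density (schw m) p) * (\<Sum>i\<in>UNIV. pderiv_at (X i) p i)"
    unfolding wave_op_def X_def ..
  also have "\<dots> = (\<Sum>i\<in>UNIV. pderiv_at (X i) p i)"
    by (simp add: vol_density_def det_schw[OF r])
  also have "\<dots> = complex_of_real (A' (1, 0) + 3 * C p + radius p * C' (0, 1))"
    unfolding sum_4 1 2[OF ne(1) rad_dir_axis(2)] 2[OF ne(2) rad_dir_axis(3)] 2[OF ne(3) rad_dir_axis(4)]
      of_real_add[symmetric] sum ..
  finally show ?thesis by (simp add: C_def)
qed

text \<open>The last bracket is the squared length of the differential of the field in the inverse
  metric.\<close>

lemma stress_energy_field:
  assumes "radius p > 0"
  defines "d \<equiv> \<lambda>X. \<Phi>t (p $ 1, radius p) * X $ 1 + \<Phi>r (p $ 1, radius p) * rad_dir p X"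
  shows "stress_energy (schw m) field p X Y = d X * d Y - 1 / 2 * gprod (schw m) p X Y *
    ((\<Phi>r (p $ 1, radius p))\<^sup>2 - (\<Phi>t (p $ 1, radius p))\<^sup>2
      - 2 * m / radius p * (\<Phi>r (p $ 1, radius p) - \<Phi>t (p $ 1, radius p))\<^sup>2)"
proof -
  define a b c where "a = p $ 2 / radius p" and "b = p $ 3 / radius p" and "c = p $ 4 / radius p"
  define h where "h = 2 * m / radius p"
  define A B where "A = \<Phi>t (p $ 1, radius p)" and "B = \<Phi>r (p $ 1, radius p)"
  have c2: "c * c = 1 - a * a - b * b"
    using unit_direction[OF assms(1)] by (simp add: a_def b_def c_def power2_eq_square)
  have "(\<Sum>i\<in>UNIV. \<Sum>j\<in>UNIV. complex_of_real (matrix_inv (schw m p) $ i $ j) *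
            pderiv_at field p i * cnj (pderiv_at field p j))
      = complex_of_real (B\<^sup>2 - A\<^sup>2 - h * (B - A)\<^sup>2)"
    unfolding matrix_inv_schw[OF assms(1)] sum_4 pderiv_field[OF assms(1)] complex_cnj_complex_of_real
      of_real_mult[symmetric] of_real_add[symmetric] of_real_eq_iff
    using c2
    by (simp add: schw_inv_def null_covector_def
        a_def[symmetric] b_def[symmetric] c_def[symmetric] h_def[symmetric] A_def[symmetric] B_def[symmetric])
      algebra
  moreover have "Re (1/2 * (cnj (complex_of_real u) * complex_of_real w) + 1/2 * (complex_of_real u * cnj (complex_of_real w))
       - 1/2 * complex_of_real g * complex_of_real q) = u * w - 1 / 2 * g * q" for u w g q
    by simp
  ultimately show ?thesis
    unfolding stress_energy_def Let_def frechet_field[OF assms(1)] d_def h_def A_def B_def by metis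
qed

definition energy_density :: "real \<times> real \<Rightarrow> real" where
  "energy_density z = 1 / 2 * ((grad_t z)\<^sup>2 + (\<Phi>r z)\<^sup>2)"

text \<open>With \<open>L = 1 + 2m / r\<close>, the unit normal is \<open>N\<close> divided by
  \<open>sqrt L\<close>, while the induced volume density is \<open>sqrt L\<close>. The two factors
  cancel and leave the stress-energy on \<open>(N, N)\<close>, which is half a sum of two
  squares.\<close>

lemma energy_integrand:
  assumes "m > 0" "norm x > 0"
  shows "gprod (schw m) (event t x) (current (schw m) (schw_N m) field (event t x)) (unit_normal m (event t x))
    * sqrt (det (induced_metric m t x)) = energy_density (t, norm x)"
proof -
  define p where "p = event t x"
  have rad: "radius p = norm x" by (simp add: p_def radius_event)
  then have r: "radius p > 0" using assms by simp
  have p1: "p $ 1 = t" by (simp add: p_def event_def)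
  define a b c where "a = p $ 2 / radius p" and "b = p $ 3 / radius p" and "c = p $ 4 / radius p"
  define h where "h = 2 * m / radius p"
  define A B where "A = \<Phi>t (p $ 1, radius p)" and "B = \<Phi>r (p $ 1, radius p)"
  have h: "h > 0" using assms r by (simp add: h_def)
  have c2: "c * c = 1 - a * a - b * b"
    using unit_direction[OF r] by (simp add: a_def b_def c_def power2_eq_square)
  define N where "N = schw_N m p"
  have N: "N $ 1 = 1 + h" "N $ 2 = - h * a" "N $ 3 = - h * b" "N $ 4 = - h * c"
    using schw_N_components[OF r, of m] by (simp_all add: N_def h_def a_def b_def c_def)
  define d where "d X = A * X $ 1 + B * (a * X $ 2 + b * X $ 3 + c * X $ 4)" for X :: "real ^ 4"
  have rd: "rad_dir p X = a * X $ 2 + b * X $ 3 + c * X $ 4" for X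
    by (simp add: rad_dir_def a_def b_def c_def add_divide_distrib)
  have gN: "gprod (schw m) p N Y = - Y $ 1" for Y
    using gprod_schw_N[OF r, of m Y] gprod_commute[of m p] by (simp add: N_def)
  have T: "stress_energy (schw m) field p N Y
      = d N * d Y + 1 / 2 * Y $ 1 * (B\<^sup>2 - A\<^sup>2 - h * (B - A)\<^sup>2)" for Y
    unfolding stress_energy_field[OF r] gN rd A_def[symmetric] B_def[symmetric] h_def[symmetric] d_def by simp
  have dN: "d N = (1 + h) * A - h * B"
    unfolding d_def N using c2 by algebra
  define J where "J = current (schw m) (schw_N m) field p"
  have JN: "gprod (schw m) p J N = 1 / 2 * ((- (1 + h) * A + h * B)\<^sup>2 + B\<^sup>2)"
  proof -
    have "gprod (schw m) p J N = stress_energy (schw m) field p N N"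
      unfolding J_def current_def gprod_sharp[OF r] N_def[symmetric] T
      by (simp add: inner_vec_def sum_4 axis_def d_def algebra_simps)
    also have "\<dots> = 1 / 2 * ((- (1 + h) * A + h * B)\<^sup>2 + B\<^sup>2)"
      unfolding T dN N by (simp add: power2_eq_square) algebra
    finally show ?thesis .
  qed
  have "det (induced_metric m t x) = 1 + h"
  proof -
    have "gprod (schw m) p (event 0 (axis i 1)) (event 0 (axis j 1)) =
       (if i = j then 1 else 0) + h * (vector [a, b, c] :: real ^ 3) $ i * (vector [a, b, c] :: real ^ 3) $ j" for i j
    proof -
      have "i = 1 \<or> i = 2 \<or> i = 3" "j = 1 \<or> j = 2 \<or> j = 3"
        using forall_3[of "\<lambda>i. i = 1 \<or> i = 2 \<or> i = 3"] by simp_all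
      then show ?thesis
        unfolding gprod_schw null_covector_def a_def[symmetric] b_def[symmetric] c_def[symmetric] h_def[symmetric]
        by (elim disjE) (simp_all add: event_def axis_def inner_vec_def sum_4)
    qed
    then have ind: "induced_metric m t x $ i $ j = (if i = j then 1 else 0)
        + h * (vector [a, b, c] :: real ^ 3) $ i * (vector [a, b, c] :: real ^ 3) $ j" for i j
      by (simp add: induced_metric_def p_def)
    show ?thesis
      unfolding det_3 ind using c2 by simp algebra
  qed
  moreover have "unit_normal m p = (1 / sqrt (1 + h)) *\<^sub>R N"
    by (simp add: unit_normal_def gprod_N_N[OF r] h_def N_def)
  moreover have "gprod (schw m) p J (k *\<^sub>R N) = k * gprod (schw m) p J N" for k
    by (simp add: gprod_def matrix_vector_mult_scaleR)
  ultimately have "gprod (schw m) p J (unit_normal m p) * sqrt (det (induced_metric m t x))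
      = gprod (schw m) p J N"
    using h by simp
  then show ?thesis
    unfolding p_def[symmetric] J_def[symmetric] JN energy_density_def grad_t_def
    by (simp add: A_def B_def h_def p1 rad)
qed

lemma energy_field:
  assumes "m > 0"
  shows "energy m t field = (LINT x : {x :: real ^ 3. norm x > 2 * m} | lborel. energy_density (t, norm x))"
proof -
  have "tstar (event t x) = t" for x by (simp add: tstar_def event_def)
  then have dom: "{x. event t x \<in> Sigma_slice m t} = {x. norm x > 2 * m}"
    by (auto simp: Sigma_slice_def exterior_def radius_event)
  show ?thesis
    unfolding energy_def dom set_lebesgue_integral_def
    by (rule Bochner_Integration.integral_cong[OF refl])
      (use assms in \<open>auto simp: indicator_def intro!: energy_integrand\<close>)
qed

text \<open>At \<open>r = 2m\<close> the field \<open>N\<close> is twice the time direction minus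
  the radial one, and all terms with the radial derivative cancel.\<close>

lemma horizon_flux_field:
  assumes "m > 0"
  shows "horizon_flux m \<tau> field = (LINT (t, \<theta>, \<phi>) : {0..\<tau>} \<times> {0..pi} \<times> {0..2 * pi} | lborel.
    (\<Phi>t (t, 2 * m))\<^sup>2 * ((2 * m)\<^sup>2 * sin \<theta>))"
proof -
  have "stress_energy (schw m) field (horizon_point m t \<theta> \<phi>) (schw_N m (horizon_point m t \<theta> \<phi>)) (axis 1 1)
      = (\<Phi>t (t, 2 * m))\<^sup>2" for t \<theta> \<phi>
  proof -
    define p where "p = horizon_point m t \<theta> \<phi>"
    have rad: "radius p = 2 * m"
      using assms by (simp add: p_def horizon_point_def radius_event norm_polar)
    then have r: "radius p > 0" using assms by simp
    have p1: "p $ 1 = t" by (simp add: p_def horizon_point_def event_def)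
    have g: "gprod (schw m) p (schw_N m p) (axis 1 1) = - 1"
      using gprod_schw_N[OF r, of m "axis 1 1"] gprod_commute[of m p] by simp
    have "rad_dir p (schw_N m p) = - ((p $ 2 / radius p)\<^sup>2 + (p $ 3 / radius p)\<^sup>2 + (p $ 4 / radius p)\<^sup>2)"
      unfolding rad_dir_def schw_N_components[OF r] using rad assms
      by (simp add: power2_eq_square divide_simps)
    then have rN: "rad_dir p (schw_N m p) = - 1" by (simp add: unit_direction[OF r])
    show ?thesis
      unfolding p_def[symmetric] stress_energy_field[OF r] g rN rad_dir_axis schw_N_components(1)[OF r]
      using assms by (simp add: rad p1 power2_eq_square axis_def) (simp add: field_simps)
  qed
  then show ?thesis by (simp add: horizon_flux_eq[OF assms])
qed

end

section \<open>Kruskal coordinates\<close>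

text \<open>Here \<psi> stands for the radius times the field. This removes the first order term
  \<open>2 / r\<close> of the flat spherical wave operator.\<close>

locale reduced_field =
  fixes m :: real and \<psi> \<psi>t \<psi>r :: "real \<times> real \<Rightarrow> real"
  assumes reduced_deriv: "\<And>z. snd z > 0 \<Longrightarrow> (\<psi> has_derivative (\<lambda>h. \<psi>t z * fst h + \<psi>r z * snd h)) (at z)"

sublocale reduced_field \<subseteq> radial_field m "\<lambda>z. \<psi> z / snd z" "\<lambda>z. \<psi>t z / snd z"
  "\<lambda>z. \<psi>r z / snd z - \<psi> z / (snd z)\<^sup>2"
proof
  fix z :: "real \<times> real" assume z: "snd z > 0"
  show "((\<lambda>z. \<psi> z / snd z) has_derivative
      (\<lambda>h. \<psi>t z / snd z * fst h + (\<psi>r z / snd z - \<psi> z / (snd z)\<^sup>2) * snd h)) (at z)"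
    using z
    by (auto intro!: derivative_eq_intros reduced_deriv simp: fun_eq_iff power2_eq_square field_simps)
qed

context reduced_field
begin

lemma wave_op_reduced:
  assumes r: "radius p > 0"
    and t: "(\<psi>t has_derivative (\<lambda>h. \<psi>tt * fst h + \<psi>tr * snd h)) (at (p $ 1, radius p))"
    and s: "(\<psi>r has_derivative (\<lambda>h. \<psi>tr * fst h + \<psi>rr * snd h)) (at (p $ 1, radius p))"
    and eq: "- (1 + 2 * m / radius p) * \<psi>tt + 2 * (2 * m / radius p) * \<psi>tr + (1 - 2 * m / radius p) * \<psi>rr
      + 2 * m / (radius p)\<^sup>2 * (\<psi>r (p $ 1, radius p) - \<psi>t (p $ 1, radius p))
      - 2 * m / (radius p) ^ 3 * \<psi> (p $ 1, radius p) = 0"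
  shows "wave_op (schw m) field p = 0"
proof -
  define R where "R = radius p"
  define z where "z = (p $ 1, R)"
  have R: "R > 0" using r by (simp add: R_def)
  have z2: "snd z = R" by (simp add: z_def)
  have d: "(\<psi> has_derivative (\<lambda>h. \<psi>t z * fst h + \<psi>r z * snd h)) (at z)"
    by (rule reduced_deriv) (use R z2 in simp)
  have t': "(\<psi>t has_derivative (\<lambda>h. \<psi>tt * fst h + \<psi>tr * snd h)) (at z)"
    and s': "(\<psi>r has_derivative (\<lambda>h. \<psi>tr * fst h + \<psi>rr * snd h)) (at z)"
    using t s by (simp_all add: z_def R_def)
  define a b c where "a = \<psi> z" and "b = \<psi>t z" and "c = \<psi>r z"
  \<comment> \<open>In terms of the inverse radius all coefficients are polynomial, and
    \<open>R * w = 1\<close> is the only relation needed to compare them.\<close>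
  define w where "w = inverse R"
  define A' where "A' h = - (1 + 2 * m * w) * (w * (\<psi>tt * fst h + \<psi>tr * snd h))
      + 2 * m * w * (w * (\<psi>tr * fst h + \<psi>rr * snd h) - w * w * (b * fst h + c * snd h))
      + snd h * (2 * m * w * w * (b * w) + (1 + 2 * m * w) * (b * w * w)
        - 2 * m * w * w * (c * w - a * w * w) + 2 * m * w * (- c * w * w + 2 * a * w * w * w))" for h
  define C' where "C' h = w * ((1 - 2 * m * w) * (w * (\<psi>tr * fst h + \<psi>rr * snd h) - w * w * (b * fst h + c * snd h))
        + 2 * m * w * (w * (\<psi>tt * fst h + \<psi>tr * snd h)))
      + snd h * (w * (2 * m * w * w * (c * w - a * w * w) + (1 - 2 * m * w) * (- c * w * w + 2 * a * w * w * w)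
        - 4 * m * w * w * w * b) - w * w * ((1 - 2 * m * w) * (c * w - a * w * w) + 2 * m * w * (w * b)))" for h
  have "((\<lambda>z. - (1 + 2 * m * inverse (snd z)) * (\<psi>t z * inverse (snd z)) + 2 * m * inverse (snd z) *
      (\<psi>r z * inverse (snd z) - \<psi> z * (inverse (snd z) * inverse (snd z)))) has_derivative A') (at z)"
    using R
    by (auto intro!: derivative_eq_intros d t' s'
        simp: z2 A'_def fun_eq_iff a_def[symmetric] b_def[symmetric] c_def[symmetric] w_def[symmetric])
      (simp add: algebra_simps)
  then have "(grad_t has_derivative A') (at z)"
    unfolding grad_t_def[abs_def] by (simp add: divide_inverse power2_eq_square inverse_mult_distrib)
  moreover have "((\<lambda>z. ((1 - 2 * m * inverse (snd z)) *
      (\<psi>r z * inverse (snd z) - \<psi> z * (inverse (snd z) * inverse (snd z)))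
      + 2 * m * inverse (snd z) * (\<psi>t z * inverse (snd z))) * inverse (snd z)) has_derivative C') (at z)"
    using R
    by (auto intro!: derivative_eq_intros d t' s'
        simp: z2 C'_def fun_eq_iff a_def[symmetric] b_def[symmetric] c_def[symmetric] w_def[symmetric])
      (simp add: algebra_simps)
  then have "((\<lambda>z. grad_r z / snd z) has_derivative C') (at z)"
    unfolding grad_r_def[abs_def] by (simp add: divide_inverse power2_eq_square inverse_mult_distrib)
  ultimately have "wave_op (schw m) field p = complex_of_real (A' (1, 0) + 3 * (grad_r z / R) + R * C' (0, 1))"
    unfolding z_def R_def by (rule wave_op_field[OF r])
  also have "A' (1, 0) + 3 * (grad_r z / R) + R * C' (0, 1) = w *
      (- (1 + 2 * m / R) * \<psi>tt + 2 * (2 * m / R) * \<psi>tr + (1 - 2 * m / R) * \<psi>rr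
      + 2 * m / R\<^sup>2 * (c - b) - 2 * m / R ^ 3 * a)"
  proof -
    have wR: "R * w = 1" using R by (simp add: w_def)
    have inv: "2 * m / R = 2 * m * w" "2 * m / R\<^sup>2 = 2 * m * w * w" "2 * m / R ^ 3 = 2 * m * w * w * w" "x / R = x * w" for x
      using R by (simp_all add: w_def field_simps power2_eq_square power3_eq_cube)
    have g: "grad_r z = (1 - 2 * m * w) * (c * w - a * w * w) + 2 * m * w * (b * w)"
      using R unfolding grad_r_def z2 a_def[symmetric] b_def[symmetric] c_def[symmetric]
      by (simp add: w_def divide_inverse power2_eq_square)
    show ?thesis
      unfolding A'_def C'_def fst_conv snd_conv inv g using wR by algebra
  qed
  also have "\<dots> = 0" using eq by (simp add: R_def[symmetric] z_def[symmetric] a_def b_def c_def)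
  finally show ?thesis by simp
qed

end

text \<open>\<open>kU\<close> and \<open>kV\<close> are the first two components of
  \<open>kruskal\<close>, as functions of \<open>t*\<close> and \<open>r\<close>; \<open>kUr\<close>
  is the radial derivative of \<open>kU\<close>.\<close>

definition kU :: "real \<Rightarrow> real \<times> real \<Rightarrow> real" where
  "kU m z = (1 - snd z / (2 * m)) * exp ((snd z - fst z) / (4 * m))"

definition kV :: "real \<Rightarrow> real \<times> real \<Rightarrow> real" where
  "kV m z = exp ((fst z + snd z) / (4 * m))"

definition kUr :: "real \<Rightarrow> real \<times> real \<Rightarrow> real" where
  "kUr m z = - ((1 + snd z / (2 * m)) / (4 * m)) * exp ((snd z - fst z) / (4 * m))"

lemma kU_has_derivative:
  assumes "m > 0"
  shows "(kU m has_derivative (\<lambda>h. - kU m z / (4 * m) * fst h + kUr m z * snd h)) (at z)"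
  unfolding kU_def[abs_def] kUr_def using assms
  by (auto intro!: derivative_eq_intros simp: fun_eq_iff field_simps)

lemma kV_has_derivative:
  assumes "m > 0"
  shows "(kV m has_derivative (\<lambda>h. kV m z / (4 * m) * fst h + kV m z / (4 * m) * snd h)) (at z)"
  unfolding kV_def[abs_def] using assms
  by (auto intro!: derivative_eq_intros simp: fun_eq_iff field_simps)

lemma kUr_has_derivative:
  assumes "m > 0"
  shows "(kUr m has_derivative (\<lambda>h. - kUr m z / (4 * m) * fst h
    + (kUr m z / (4 * m) - exp ((snd z - fst z) / (4 * m)) / (8 * m\<^sup>2)) * snd h)) (at z)"
  unfolding kUr_def[abs_def] using assms
  by (auto intro!: derivative_eq_intros simp: fun_eq_iff field_simps power2_eq_square)

lemma kruskal_chain: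
  assumes "m > 0" "(Q has_derivative (\<lambda>h. Qx * fst h + Qy * snd h)) (at (kU m z, kV m z))"
  shows "((\<lambda>z. Q (kU m z, kV m z)) has_derivative
    (\<lambda>h. (Qx * (- kU m z / (4 * m)) + Qy * (kV m z / (4 * m))) * fst h
       + (Qx * kUr m z + Qy * (kV m z / (4 * m))) * snd h)) (at z)"
  using has_derivative_compose[OF has_derivative_Pair[OF kU_has_derivative[OF assms(1)]
        kV_has_derivative[OF assms(1)]] assms(2)]
  by (simp add: algebra_simps)

locale kruskal_field =
  fixes m :: real and P Px Py :: "real \<times> real \<Rightarrow> real"
  assumes m: "m > 0"
    and P_deriv: "\<And>z. (P has_derivative (\<lambda>h. Px z * fst h + Py z * snd h)) (at z)"

sublocale kruskal_field \<subseteq> reduced_field m "\<lambda>z. P (kU m z, kV m z)"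
  "\<lambda>z. Px (kU m z, kV m z) * (- kU m z / (4 * m)) + Py (kU m z, kV m z) * (kV m z / (4 * m))"
  "\<lambda>z. Px (kU m z, kV m z) * kUr m z + Py (kU m z, kV m z) * (kV m z / (4 * m))"
  by standard (rule kruskal_chain[OF m P_deriv])

context kruskal_field
begin

text \<open>Since U and V are null, both pure second derivatives of \<open>P\<close> drop out, and
  so do its first derivatives. The mixed derivative remains and has to balance the zero order term
  \<open>2m / r^3\<close>; this dictates the potential. For \<open>r \<ge> 2m\<close> the value of
  \<open>potential\<close> is the true coefficient.\<close>

lemma wave_op_kruskal:
  assumes r: "radius p \<ge> 2 * m"
    and Px': "\<And>z. (Px has_derivative (\<lambda>h. Pxx z * fst h + potential (fst z * snd z) * P z * snd h)) (at z)"
    and Py': "\<And>z. (Py has_derivative (\<lambda>h. potential (fst z * snd z) * P z * fst h + Pyy z * snd h)) (at z)"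
  shows "wave_op (schw m) field p = 0"
proof -
  define R where "R = radius p"
  define z where "z = (p $ 1, R)"
  have R: "R > 0" "R \<ge> 2 * m" using r m by (auto simp: R_def)
  have z2: "snd z = R" by (simp add: z_def)
  define E V q where "E = exp ((snd z - fst z) / (4 * m))" and "V = kV m z" and "q = R / (2 * m)"
  define y where "y = (kU m z, V)"
  have q: "q \<ge> 1" "R = 2 * m * q" using R m by (auto simp: q_def)
  define W where "W = exp q"
  have EV: "E * V = W"
    using m unfolding E_def V_def kV_def exp_add[symmetric] W_def q_def z2
    by (simp add: field_simps)
  have U: "kU m z = (1 - q) * E" "kUr m z = - ((1 + q) / (4 * m)) * E"
    by (simp_all add: kU_def kUr_def E_def q_def z2)
  have "kU m z * kV m z = (1 - q) * W" using EV by (simp add: U V_def[symmetric] mult.assoc)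
  then have "potential (fst y * snd y) = - exp (- q) / q ^ 4"
    unfolding W_def y_def V_def by (simp add: potential_eq[OF q(1)])
  then have pot: "potential (fst y * snd y) = - 1 / (W * q ^ 4)"
    by (simp add: W_def exp_minus divide_simps)
  define K where "K = potential (fst y * snd y) * P y"
  have K: "K = - P y / (E * V * q ^ 4)" by (simp add: K_def pot EV)
  have pos: "E > 0" "V > 0" by (simp_all add: E_def V_def kV_def)
  define a b c d e where "a = P y" and "b = Px y" and "c = Py y" and "d = Pxx y" and "e = Pyy y"
  have chx: "((\<lambda>z. Px (kU m z, kV m z)) has_derivative
      (\<lambda>h. (d * (- kU m z / (4 * m)) + K * (V / (4 * m))) * fst h
         + (d * kUr m z + K * (V / (4 * m))) * snd h)) (at z)"
    unfolding d_def K_def y_def V_def by (rule kruskal_chain[OF m Px'[of "(kU m z, kV m z)"]])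
  have chy: "((\<lambda>z. Py (kU m z, kV m z)) has_derivative
      (\<lambda>h. (K * (- kU m z / (4 * m)) + e * (V / (4 * m))) * fst h
         + (K * kUr m z + e * (V / (4 * m))) * snd h)) (at z)"
    unfolding e_def K_def y_def V_def by (rule kruskal_chain[OF m Py'[of "(kU m z, kV m z)"]])
  define Ut Ur Vt where "Ut = - kU m z / (4 * m)" and "Ur = kUr m z" and "Vt = V / (4 * m)"
  have Uz: "Ut = - (1 - q) * E / (4 * m)" "Ur = - (1 + q) * E / (4 * m)"
    using m by (simp_all add: Ut_def Ur_def U field_simps)
  define tt where "tt = d * Ut * Ut + 2 * K * Ut * Vt + e * Vt * Vt - b * Ut / (4 * m) + c * Vt / (4 * m)"
  define tr where "tr = d * Ut * Ur + K * Vt * (Ut + Ur) + e * Vt * Vt - b * Ur / (4 * m) + c * Vt / (4 * m)"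
  define rr where "rr = d * Ur * Ur + 2 * K * Ur * Vt + e * Vt * Vt + b * (Ur / (4 * m) - E / (8 * m\<^sup>2))
      + c * Vt / (4 * m)"
  have dt: "((\<lambda>z. Px (kU m z, kV m z) * (- kU m z / (4 * m)) + Py (kU m z, kV m z) * (kV m z / (4 * m)))
      has_derivative (\<lambda>h. tt * fst h + tr * snd h)) (at z)"
    using m
    by (auto intro!: derivative_eq_intros chx chy kU_has_derivative kV_has_derivative
        simp: fun_eq_iff b_def[symmetric] c_def[symmetric] y_def[symmetric] V_def[symmetric] Ur_def[symmetric])
      (simp add: tt_def tr_def Ut_def Vt_def field_simps)
  have dr: "((\<lambda>z. Px (kU m z, kV m z) * kUr m z + Py (kU m z, kV m z) * (kV m z / (4 * m)))
      has_derivative (\<lambda>h. tr * fst h + rr * snd h)) (at z)"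
    using m
    by (auto intro!: derivative_eq_intros chx chy kUr_has_derivative kV_has_derivative
        simp: fun_eq_iff b_def[symmetric] c_def[symmetric] y_def[symmetric] V_def[symmetric] Ur_def[symmetric] E_def[symmetric])
      (simp add: rr_def tr_def Ut_def Vt_def field_simps)
  have q0: "q \<noteq> 0" using q by simp
  have h: "2 * m / R = 1 / q" "2 * m / R\<^sup>2 = 1 / (2 * m * q\<^sup>2)" "2 * m / R ^ 3 = 1 / (4 * m\<^sup>2 * q ^ 3)"
    using m q0 unfolding q(2) by (simp_all add: field_simps power2_eq_square power3_eq_cube)
  \<comment> \<open>In this order: the null equation for U, the coefficient of the mixed derivative,
    and the fact that U is annihilated by the reduced operator without its zero order term.\<close>
  have coeffs: "- (1 + 1 / q) * (Ut * Ut) + 2 * (1 / q) * (Ut * Ur) + (1 - 1 / q) * (Ur * Ur) = 0"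
    "- (1 + 1 / q) * Ut + 1 / q * (Ut + Ur) + (1 - 1 / q) * Ur = - (q * E / (2 * m))"
    "- (1 + 1 / q) * (- Ut / (4 * m)) + 2 * (1 / q) * (- Ur / (4 * m)) + (1 - 1 / q) * (Ur / (4 * m) - E / (8 * m\<^sup>2))
      + 1 / (2 * m * q\<^sup>2) * (Ur - Ut) = 0"
    unfolding Uz using m q0 by (simp_all add: field_simps power2_eq_square)
  have KV: "2 * (K * Vt) * (- (q * E / (2 * m))) = a / (4 * m\<^sup>2 * q ^ 3)"
    using m q0 pos unfolding K a_def Vt_def by (simp add: field_simps power2_eq_square power3_eq_cube power4_eq_xxxx)
  have eq: "- (1 + 2 * m / R) * tt + 2 * (2 * m / R) * tr + (1 - 2 * m / R) * rr
      + 2 * m / R\<^sup>2 * (b * Ur + c * Vt - (b * Ut + c * Vt)) - 2 * m / R ^ 3 * a = 0"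
  proof -
    have "- (1 + 1 / q) * tt + 2 * (1 / q) * tr + (1 - 1 / q) * rr
        + 1 / (2 * m * q\<^sup>2) * (b * Ur + c * Vt - (b * Ut + c * Vt)) - 1 / (4 * m\<^sup>2 * q ^ 3) * a
      = d * (- (1 + 1 / q) * (Ut * Ut) + 2 * (1 / q) * (Ut * Ur) + (1 - 1 / q) * (Ur * Ur))
      + 2 * (K * Vt) * (- (1 + 1 / q) * Ut + 1 / q * (Ut + Ur) + (1 - 1 / q) * Ur)
      + b * (- (1 + 1 / q) * (- Ut / (4 * m)) + 2 * (1 / q) * (- Ur / (4 * m))
         + (1 - 1 / q) * (Ur / (4 * m) - E / (8 * m\<^sup>2)) + 1 / (2 * m * q\<^sup>2) * (Ur - Ut))
      - 1 / (4 * m\<^sup>2 * q ^ 3) * a"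
    proof -
      define s k g where "s = 1 / q" and "k = 1 / (4 * m)" and "g = E / (8 * m\<^sup>2)"
      have "x / (4 * m) = x * k" for x by (simp add: k_def)
      then show ?thesis
        unfolding tt_def tr_def rr_def s_def[symmetric] g_def[symmetric] by (simp add: algebra_simps)
    qed
    then show ?thesis unfolding coeffs KV h by simp
  qed
  have vals: "P (kU m z, V) = a" "Px (kU m z, V) = b" "Py (kU m z, V) = c"
    by (simp_all add: a_def b_def c_def y_def)
  show ?thesis
  proof (rule wave_op_reduced[of p tt tr rr], unfold z_def[symmetric] R_def[symmetric] vals V_def[symmetric]
      Ut_def[symmetric] Ur_def[symmetric] Vt_def[symmetric])
  qed (fact R(1) dt dr eq)+
qed

lemma Ck_on_field:
  assumes "Ck_on k UNIV P"
  shows "Ck_on k ingoing_chart field"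
proof -
  note op = open_ingoing_chart
  have nth: "Ck_on k ingoing_chart (\<lambda>p. p $ i)" for i
    by (rule Ck_on_bounded_linear[OF bounded_linear_vec_nth op])
  have rad: "Ck_on k ingoing_chart radius"
  proof -
    have "Ck_on k ingoing_chart (\<lambda>p. p $ 2 * p $ 2 + p $ 3 * p $ 3 + p $ 4 * p $ 4)"
      by (intro Ck_on_add[OF op] Ck_on_mult[OF op] nth)
    from Ck_on_compose[OF op _ Ck_on_sqrt this] show ?thesis
      unfolding radius_eq_sqrt[abs_def] ingoing_chart_def
      by (auto simp: radius_eq_sqrt)
  qed
  have inv: "Ck_on k ingoing_chart (\<lambda>p. inverse (radius p))"
    by (rule Ck_on_compose[OF op _ Ck_on_inverse rad, where T = "{0<..}"]) (auto simp: ingoing_chart_def)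
  have ex: "Ck_on k ingoing_chart (\<lambda>p. exp (g p))" if "Ck_on k ingoing_chart g" for g :: "real ^ 4 \<Rightarrow> real"
    by (rule Ck_on_compose[OF op _ Ck_on_exp[OF open_UNIV] that]) simp
  have U: "Ck_on k ingoing_chart (\<lambda>p. kU m (p $ 1, radius p))"
  proof -
    have "Ck_on k ingoing_chart (\<lambda>p. (1 + (- 1 / (2 * m)) * radius p)
        * exp (1 / (4 * m) * radius p + - 1 / (4 * m) * p $ 1))"
      by (intro Ck_on_mult[OF op] Ck_on_add[OF op] Ck_on_const[OF op] ex rad nth)
    then show ?thesis
      by (rule Ck_on_cong[OF op, rotated]) (simp add: kU_def diff_divide_distrib)
  qed
  have V: "Ck_on k ingoing_chart (\<lambda>p. kV m (p $ 1, radius p))"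
  proof -
    have "Ck_on k ingoing_chart (\<lambda>p. exp (1 / (4 * m) * p $ 1 + 1 / (4 * m) * radius p))"
      by (intro Ck_on_mult[OF op] Ck_on_add[OF op] Ck_on_const[OF op] ex rad nth)
    then show ?thesis
      by (rule Ck_on_cong[OF op, rotated]) (simp add: kV_def add_divide_distrib)
  qed
  have UV: "Ck_on k ingoing_chart (\<lambda>p. (kU m (p $ 1, radius p), kV m (p $ 1, radius p)))"
  proof -
    have "bounded_linear (\<lambda>x::real. (x, 0::real))" "bounded_linear (\<lambda>x::real. (0::real, x))"
      by (intro bounded_linear_Pair bounded_linear_ident bounded_linear_zero)+
    from Ck_on_add[OF op Ck_on_bounded_linear_comp[OF this(1) op U] Ck_on_bounded_linear_comp[OF this(2) op V]]
    show ?thesis by simp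
  qed
  have "Ck_on k ingoing_chart (\<lambda>p. P (kU m (p $ 1, radius p), kV m (p $ 1, radius p)))"
    by (rule Ck_on_compose[OF op _ assms UV]) simp
  from Ck_on_mult[OF op this inv] show ?thesis
    unfolding field_def[abs_def] unfolding divide_inverse snd_conv
    by (rule Ck_on_bounded_linear_comp[OF bounded_linear_of_real op])
qed

end

text \<open>\<open>U \<le> 0\<close> is a closed condition that holds in the exterior, hence on the
  closure as well, and in the chart it means \<open>r \<ge> 2m\<close>.\<close>

lemma closed_dep_Sigma0_subset:
  assumes "m > 0" "p \<in> closed_dep_Sigma0 m"
  shows "p \<in> ingoing_chart" "radius p \<ge> 2 * m"
proof -
  show "p \<in> ingoing_chart" using assms(2) by (simp add: closed_dep_Sigma0_def)
  have "closure (kruskal m ` dep_Sigma0 m) \<subseteq> {z. fst z \<le> 0}"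
  proof (rule closure_minimal)
    show "kruskal m ` dep_Sigma0 m \<subseteq> {z. fst z \<le> 0}"
      using dep_Sigma0_subset(1)[OF assms(1)] assms(1)
      by (fastforce simp: kruskal_def exterior_def mult_le_0_iff)
    show "closed {z :: real \<times> real \<times> (real ^ 3). fst z \<le> 0}"
      by (intro closed_Collect_le continuous_intros)
  qed
  then have "(1 - radius p / (2 * m)) * exp ((radius p - tstar p) / (4 * m)) \<le> 0"
    using assms(2) by (auto simp: closed_dep_Sigma0_def kruskal_def)
  then have "1 - radius p / (2 * m) \<le> 0" by (simp add: mult_le_0_iff)
  then show "radius p \<ge> 2 * m" using assms(1) by (simp add: divide_simps)
qed

section \<open>Integrals of radial functions\<close>

text \<open>The sign is there because measures on the line are compared on the rays
  \<open>{x<..}\<close>: under the negative norm their preimages are balls, which have finite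
  measure, whereas under the norm itself they would be complements of balls.\<close>

lemma distr_lborel_minus_norm:
  "distr (lborel :: (real ^ 3) measure) borel (\<lambda>x. - norm x)
    = density lborel (\<lambda>s. ennreal (indicator {..0} s * (4 * pi * s\<^sup>2)))"
proof (rule measure_eqI_lessThan)
  fix x :: real
  have "emeasure (distr (lborel :: (real ^ 3) measure) borel (\<lambda>x. - norm x)) {x<..} = emeasure lborel (ball (0 :: real ^ 3) (- x))"
    by (subst emeasure_distr) (auto intro!: arg_cong[where f = "emeasure lborel"] simp: ball_def dist_norm)
  also have "\<dots> = ennreal (4 / 3 * pi * (max 0 (- x)) ^ 3)"
  proof (cases "x \<le> 0")
    case True
    then show ?thesis by (simp add: emeasure_ball unit_ball_vol_3)
  next
    case False
    then have e: "ball (0 :: real ^ 3) (- x) = {}" by (simp add: ball_eq_empty)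
    show ?thesis using False unfolding e by simp
  qed
  finally have M: "emeasure (distr (lborel :: (real ^ 3) measure) borel (\<lambda>x. - norm x)) {x<..}
      = ennreal (4 / 3 * pi * (max 0 (- x)) ^ 3)" .
  then show "emeasure (distr (lborel :: (real ^ 3) measure) borel (\<lambda>x. - norm x)) {x<..} < \<infinity>" by simp
  have "emeasure (density lborel (\<lambda>s. ennreal (indicator {..0} s * (4 * pi * s\<^sup>2)))) {x<..}
      = (\<integral>\<^sup>+ s. ennreal (indicator {..0} s * (4 * pi * s\<^sup>2)) * indicator {x<..} s \<partial>lborel)"
    by (subst emeasure_density) auto
  also have "\<dots> = (\<integral>\<^sup>+ s. ennreal (4 * pi * s\<^sup>2) * indicator {min x 0..0} s \<partial>lborel)"
    by (rule nn_integral_cong_AE, rule AE_mp[OF AE_lborel_singleton[of x]],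
        rule AE_mp[OF AE_lborel_singleton[of 0]])
      (auto simp: indicator_def min_def split: if_splits)
  also have "\<dots> = ennreal (4 / 3 * pi * 0 ^ 3 - 4 / 3 * pi * (min x 0) ^ 3)"
    by (rule nn_integral_FTC_Icc) (auto intro!: derivative_eq_intros simp: power2_eq_square)
  also have "4 / 3 * pi * 0 ^ 3 - 4 / 3 * pi * (min x 0) ^ 3 = 4 / 3 * pi * (max 0 (- x)) ^ 3"
    by (simp add: min_def max_def)
  finally show "emeasure (distr (lborel :: (real ^ 3) measure) borel (\<lambda>x. - norm x)) {x<..} =
    emeasure (density lborel (\<lambda>s. ennreal (indicator {..0} s * (4 * pi * s\<^sup>2)))) {x<..}"
    unfolding M by simp
qed auto

lemma radial_integral:
  fixes g :: "real \<Rightarrow> real"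
  assumes "0 \<le> a" "a \<le> b" "continuous_on {a..b} g" "\<And>r. r > b \<Longrightarrow> g r = 0"
  shows "(LINT x : {x :: real ^ 3. norm x > a} | lborel. g (norm x)) = 4 * pi * integral {a..b} (\<lambda>r. r\<^sup>2 * g r)"
proof -
  define h where "h s = indicator {- b..<- a} s * g (- s)" for s
  have cont: "continuous_on {- b..<- a} (\<lambda>s. g (- s))"
    by (rule continuous_on_compose2[OF assms(3)]) (auto intro!: continuous_intros)
  have h: "h \<in> borel_measurable borel"
    using borel_measurable_continuous_on_indicator[OF _ cont]
    unfolding h_def by simp
  have "(LINT x : {x :: real ^ 3. norm x > a} | lborel. g (norm x)) = (LINT x | lborel. h (- norm (x :: real ^ 3)))"
    unfolding set_lebesgue_integral_def
    by (rule Bochner_Integration.integral_cong[OF refl]) (use assms(4) in \<open>auto simp: h_def indicator_def\<close>)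
  also have "\<dots> = (LINT s | distr (lborel :: (real ^ 3) measure) borel (\<lambda>x. - norm x). h s)"
    by (rule integral_distr[symmetric]) (use h in auto)
  also have "\<dots> = (LINT s | lborel. indicator {..0} s * (4 * pi * s\<^sup>2) * h s)"
    unfolding distr_lborel_minus_norm
    by (subst integral_density) (use h in auto)
  also have "\<dots> = (LINT s | lborel. indicator {..0} (- s) * (4 * pi * s\<^sup>2) * h (- s))"
    using lborel_integral_real_affine[of "- 1" "\<lambda>s. indicator {..0} s * (4 * pi * s\<^sup>2) * h s" 0] by simp
  also have "\<dots> = (LINT s : {a..b} | lborel. 4 * pi * (s\<^sup>2 * g s))"
    unfolding set_lebesgue_integral_def
  proof (rule integral_cong_AE)
    show "(\<lambda>s. indicator {..0} (- s) * (4 * pi * s\<^sup>2) * h (- s)) \<in> borel_measurable lborel"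
      using h by measurable
    show "(\<lambda>s. indicator {a..b} s *\<^sub>R (4 * pi * (s\<^sup>2 * g s))) \<in> borel_measurable lborel"
      unfolding measurable_lborel2
      by (rule borel_measurable_continuous_on_indicator) (auto intro!: continuous_intros assms(3))
    show "AE s in lborel. indicator {..0} (- s) * (4 * pi * s\<^sup>2) * h (- s)
        = indicator {a..b} s *\<^sub>R (4 * pi * (s\<^sup>2 * g s))"
      by (rule AE_mp[OF AE_lborel_singleton[of a]])
        (use assms(1) in \<open>auto simp: h_def indicator_def\<close>)
  qed
  also have "\<dots> = integral {a..b} (\<lambda>r. 4 * pi * (r\<^sup>2 * g r))"
    by (rule set_borel_integral_eq_integral)
      (auto intro!: borel_integrable_atLeastAtMost' continuous_intros assms(3))
  finally show ?thesis by simp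
qed

section \<open>Wave packets at the horizon\<close>

context kruskal_field
begin

text \<open>Both squares contain the same leading term, the radial derivative of U times
  \<open>Px\<close>. For the first one this is the null equation of U, in the form proved as
  \<open>null\<close>: the \<open>t*\<close>-component of the gradient of U equals its radial
  derivative.\<close>

lemma energy_density_kruskal:
  fixes t r :: real
  assumes "r > 0"
  defines "y \<equiv> (kU m (t, r), kV m (t, r))"
  shows "r\<^sup>2 * energy_density (t, r) = 1 / 2 *
    ((kUr m (t, r) * Px y - (Py y * (kV m (t, r) / (4 * m)) + 2 * m / r * (P y / r)))\<^sup>2
     + (kUr m (t, r) * Px y + (Py y * (kV m (t, r) / (4 * m)) - P y / r))\<^sup>2)"
proof -
  define q E where "q = r / (2 * m)" and "E = exp ((r - t) / (4 * m))"
  define p x z v where "p = P y" and "x = Px y" and "z = Py y" and "v = kV m (t, r) / (4 * m)"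
  have q: "q > 0" "r = 2 * m * q" using assms m by (auto simp: q_def)
  have U: "kU m (t, r) = (1 - q) * E" "kUr m (t, r) = - ((1 + q) / (4 * m)) * E"
    by (simp_all add: kU_def kUr_def q_def E_def)
  have null: "(1 + 2 * m / r) * (kU m (t, r) / (4 * m)) + 2 * m / r * kUr m (t, r) = kUr m (t, r)"
    unfolding U using q m by (simp add: field_simps)
  have "r * grad_t (t, r) = x * ((1 + 2 * m / r) * (kU m (t, r) / (4 * m)) + 2 * m / r * kUr m (t, r))
      - (z * v + 2 * m / r * (p / r))"
    using assms m unfolding grad_t_def fst_conv snd_conv y_def[symmetric] p_def[symmetric] x_def[symmetric]
      z_def[symmetric] v_def[symmetric]
    by (simp add: field_simps power2_eq_square)
  then have 1: "r * grad_t (t, r) = kUr m (t, r) * x - (z * v + 2 * m / r * (p / r))"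
    unfolding null by (simp add: mult.commute)
  have 2: "r * ((x * kUr m (t, r) + z * v) / r - p / r\<^sup>2) = kUr m (t, r) * x + (z * v - p / r)"
    using assms by (simp add: field_simps power2_eq_square)
  have "r\<^sup>2 * energy_density (t, r) = 1 / 2 * ((r * grad_t (t, r))\<^sup>2 + (r * ((x * kUr m (t, r) + z * v) / r - p / r\<^sup>2))\<^sup>2)"
    unfolding energy_density_def fst_conv snd_conv y_def[symmetric] p_def[symmetric] x_def[symmetric]
      z_def[symmetric] v_def[symmetric]
    by (simp add: power_mult_distrib distrib_left)
  then show ?thesis unfolding 1 2 unfolding p_def x_def z_def v_def .
qed

text \<open>Energy and flux are quadratic, so the energy at the final time can be normalised by a
  constant factor.\<close>

lemma scaled_field:
  defines "\<Phi> \<equiv> \<lambda>c z. c * P (kU m z, kV m z) / snd z"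
  shows "kruskal_field m (\<lambda>z. c * P z) (\<lambda>z. c * Px z) (\<lambda>z. c * Py z)"
    and "energy m t (radial_field.field (\<Phi> c)) = c\<^sup>2 * energy m t field"
    and "horizon_flux m \<tau> (radial_field.field (\<Phi> c)) = c\<^sup>2 * horizon_flux m \<tau> field"
proof -
  show k: "kruskal_field m (\<lambda>z. c * P z) (\<lambda>z. c * Px z) (\<lambda>z. c * Py z)"
  proof
    show "((\<lambda>z. c * P z) has_derivative (\<lambda>h. c * Px z * fst h + c * Py z * snd h)) (at z)" for z
      using has_derivative_mult_right[OF P_deriv[of z], of c] by (simp add: algebra_simps)
  qed (rule m)
  then interpret S: kruskal_field m "\<lambda>z. c * P z" "\<lambda>z. c * Px z" "\<lambda>z. c * Py z" .
  have "S.energy_density z = c\<^sup>2 * energy_density z" for z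
  proof -
    have "S.grad_t z = c * grad_t z"
      unfolding S.grad_t_def grad_t_def by (simp add: algebra_simps add_divide_distrib diff_divide_distrib)
    moreover have "(c * Px (kU m z, kV m z) * kUr m z + c * Py (kU m z, kV m z) * (kV m z / (4 * m))) / snd z
        - c * P (kU m z, kV m z) / (snd z)\<^sup>2
      = c * ((Px (kU m z, kV m z) * kUr m z + Py (kU m z, kV m z) * (kV m z / (4 * m))) / snd z
        - P (kU m z, kV m z) / (snd z)\<^sup>2)"
      by (simp add: algebra_simps add_divide_distrib)
    ultimately show ?thesis
      unfolding S.energy_density_def energy_density_def by (simp add: power_mult_distrib distrib_left)
  qed
  then show "energy m t (radial_field.field (\<Phi> c)) = c\<^sup>2 * energy m t field"
    unfolding energy_field[OF m] \<Phi>_def S.energy_field[OF m] set_lebesgue_integral_def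
    by (simp flip: integral_mult_right_zero add: mult.left_commute)
  show "horizon_flux m \<tau> (radial_field.field (\<Phi> c)) = c\<^sup>2 * horizon_flux m \<tau> field"
    unfolding horizon_flux_field[OF m] \<Phi>_def S.horizon_flux_field[OF m] set_lebesgue_integral_def case_prod_unfold
    by (simp flip: integral_mult_right_zero)
      (intro Bochner_Integration.integral_cong[OF refl],
       simp add: algebra_simps add_divide_distrib power_divide power2_eq_square)
qed

end

text \<open>Collects what the estimates use of a solution: it vanishes ahead of the packet, and on
  the packet only \<open>Px\<close> has a part that is not controlled by
  \<open>flat 0 \<delta>\<close>, namely the data derivative. The numbers 2 and 3 are those of
  \<open>goursat\<close> at rate 3, based at \<open>U = - \<delta>\<close> and
  \<open>V = 0\<close>.\<close>

locale wave_packet = kruskal_field m P Px Py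
  for m :: real and P Px Py :: "real \<times> real \<Rightarrow> real" +
  fixes \<delta> :: real
  assumes delta: "0 < \<delta>" "\<delta> \<le> 1"
    and cont: "continuous_on UNIV P" "continuous_on UNIV Px" "continuous_on UNIV Py"
    and vanish: "\<And>x y. x \<le> - \<delta> \<Longrightarrow> P (x, y) = 0 \<and> Px (x, y) = 0 \<and> Py (x, y) = 0"
    and bounds: "\<And>x y. - \<delta> \<le> x \<Longrightarrow> x \<le> 0 \<Longrightarrow>
       \<bar>P (x, y)\<bar> \<le> 2 * flat 0 \<delta> * exp (3 * (\<delta> + \<bar>y\<bar>)) \<and>
       \<bar>Px (x, y) - flat 2 (x + \<delta>)\<bar> \<le> 3 * flat 0 \<delta> * exp (3 * (\<delta> + \<bar>y\<bar>)) \<and>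
       \<bar>Py (x, y)\<bar> \<le> 3 * flat 0 \<delta> * exp (3 * (\<delta> + \<bar>y\<bar>))"
begin

lemma uniform_bounds:
  assumes "x \<le> 0" "0 \<le> y" "y \<le> v"
  shows "\<bar>P (x, y)\<bar> \<le> 3 * exp (3 * (1 + v)) * flat 0 \<delta>"
    and "\<bar>Px (x, y) - flat 2 (x + \<delta>)\<bar> \<le> 3 * exp (3 * (1 + v)) * flat 0 \<delta>"
    and "\<bar>Py (x, y)\<bar> \<le> 3 * exp (3 * (1 + v)) * flat 0 \<delta>"
proof -
  have F: "flat 0 \<delta> \<ge> 0" by (rule flat_nonneg)
  have w: "exp (3 * (\<delta> + \<bar>y\<bar>)) \<le> exp (3 * (1 + v))" using delta assms by simp
  have up: "c * flat 0 \<delta> * exp (3 * (\<delta> + \<bar>y\<bar>)) \<le> 3 * exp (3 * (1 + v)) * flat 0 \<delta>"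
    if "0 \<le> c" "c \<le> 3" for c
    using mult_mono[OF mult_right_mono[OF that(2) F] w] F that by (simp add: mult_ac)
  have "\<bar>P (x, y)\<bar> \<le> 3 * exp (3 * (1 + v)) * flat 0 \<delta> \<and>
    \<bar>Px (x, y) - flat 2 (x + \<delta>)\<bar> \<le> 3 * exp (3 * (1 + v)) * flat 0 \<delta> \<and>
    \<bar>Py (x, y)\<bar> \<le> 3 * exp (3 * (1 + v)) * flat 0 \<delta>"
  proof (cases "x \<le> - \<delta>")
    case True
    then show ?thesis using vanish[OF True, of y] F by simp
  next
    case False
    then show ?thesis
      using bounds[of x y] assms(1) order_trans[OF _ up[of 2]] order_trans[OF _ up[of 3]] by simp
  qed
  then show "\<bar>P (x, y)\<bar> \<le> 3 * exp (3 * (1 + v)) * flat 0 \<delta>"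
    and "\<bar>Px (x, y) - flat 2 (x + \<delta>)\<bar> \<le> 3 * exp (3 * (1 + v)) * flat 0 \<delta>"
    and "\<bar>Py (x, y)\<bar> \<le> 3 * exp (3 * (1 + v)) * flat 0 \<delta>" by auto
qed

end

lemma wave_packet_exists:
  assumes m: "m > 0" and d: "0 < \<delta>" "\<delta> \<le> 1"
  obtains P Px Py Pxx Pyy where "wave_packet m P Px Py \<delta>"
    and "\<And>k. Ck_on k UNIV P"
    and "\<And>z. (Px has_derivative (\<lambda>h. Pxx z * fst h + potential (fst z * snd z) * P z * snd h)) (at z)"
    and "\<And>z. (Py has_derivative (\<lambda>h. potential (fst z * snd z) * P z * fst h + Pyy z * snd h)) (at z)"
proof -
  have shift: "Ck_on k UNIV (\<lambda>x. x + \<delta>)" for k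
    by (intro Ck_on_add Ck_on_ident Ck_on_const open_UNIV)
  have prodK: "Ck_on k UNIV (\<lambda>z::real \<times> real. potential (fst z * snd z))" for k
    by (rule Ck_on_compose[OF open_UNIV _ Ck_on_potential Ck_on_mult[OF open_UNIV
            Ck_on_bounded_linear[OF bounded_linear_fst open_UNIV]
            Ck_on_bounded_linear[OF bounded_linear_snd open_UNIV]]]) simp
  have f': "Ck_on k UNIV (\<lambda>x. flat 2 (x + \<delta>))" for k
    by (rule Ck_on_compose[OF open_UNIV _ Ck_on_flat shift]) simp
  have df: "((\<lambda>x. flat 0 (x + \<delta>)) has_real_derivative flat 2 (x + \<delta>)) (at x)" for x
    using flat_has_derivative[of 0 "x + \<delta>"] by (simp add: DERIV_shift numeral_2_eq_2)
  \<comment> \<open>The bound 4 of the potential lies below 9/2; this fixes the rate 3.\<close>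
  have bK: "\<bar>potential (fst z * snd z)\<bar> \<le> 3\<^sup>2 / 2" for z :: "real \<times> real"
    using potential_bound[of "fst z * snd z"] by simp
  have bf: "\<bar>flat 0 (x + \<delta>)\<bar> \<le> 1" for x using flat_nonneg flat_0_le_1 by simp
  obtain P Px Py :: "real \<times> real \<Rightarrow> real" where
    smooth: "\<And>k. Ck_on k UNIV P" "\<And>k. Ck_on k UNIV Px" "\<And>k. Ck_on k UNIV Py"
    and dP: "\<And>x y. ((\<lambda>x. P (x, y)) has_real_derivative Px (x, y)) (at x)"
    "\<And>x y. ((\<lambda>y. P (x, y)) has_real_derivative Py (x, y)) (at y)"
    and dPxy: "\<And>x y. ((\<lambda>y. Px (x, y)) has_real_derivative potential (fst (x, y) * snd (x, y)) * P (x, y)) (at y)"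
    and dPyx: "\<And>x y. ((\<lambda>x. Py (x, y)) has_real_derivative potential (fst (x, y) * snd (x, y)) * P (x, y)) (at x)"
    and b: "\<And>X F x y. is_interval X \<Longrightarrow> - \<delta> \<in> X \<Longrightarrow> x \<in> X \<Longrightarrow> (\<And>s. s \<in> X \<Longrightarrow> \<bar>flat 0 (s + \<delta>)\<bar> \<le> F) \<Longrightarrow>
       \<bar>P (x, y)\<bar> \<le> 2 * F * exp (3 * (\<bar>x - - \<delta>\<bar> + \<bar>y - 0\<bar>)) \<and>
       \<bar>Px (x, y) - flat 2 (x + \<delta>)\<bar> \<le> 3 * F * exp (3 * (\<bar>x - - \<delta>\<bar> + \<bar>y - 0\<bar>)) \<and>
       \<bar>Py (x, y)\<bar> \<le> 3 * F * exp (3 * (\<bar>x - - \<delta>\<bar> + \<bar>y - 0\<bar>))"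
  proof (rule goursat[OF prodK bK _ f' df bf, where a = "- \<delta>" and b = 0], goal_cases)
    case (2 P Px Py)
    show ?case by (rule 2(1)[OF 2(2-)])
  qed simp
  define Pxx where "Pxx z = frechet_derivative Px (at z) (1, 0)" for z
  define Pyy where "Pyy z = frechet_derivative Py (at z) (0, 1)" for z
  have cKP: "continuous_on UNIV (\<lambda>z. potential (fst z * snd z) * P z)"
    using Ck_on_imp_continuous_on[OF Ck_on_mult[OF open_UNIV prodK smooth(1)]] by simp
  have cPyy: "continuous_on UNIV Pyy"
    using smooth(3)[of 1] by (simp add: Pyy_def[abs_def] Basis_prod_def)
  show thesis
  proof (rule that[of P Px Py Pxx Pyy])
    show "(Px has_derivative (\<lambda>h. Pxx z * fst h + potential (fst z * snd z) * P z * snd h)) (at z)" for z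
      by (rule has_derivative_real_partials[OF _ dPxy cKP], unfold Pxx_def)
        (rule frechet_derivative_partials(1)[OF Ck_on_SucD[OF smooth(2)]], simp)
    show "(Py has_derivative (\<lambda>h. potential (fst z * snd z) * P z * fst h + Pyy z * snd h)) (at z)" for z
      by (rule has_derivative_real_partials[OF dPyx _ cPyy], unfold Pyy_def)
        (rule frechet_derivative_partials(2)[OF Ck_on_SucD[OF smooth(3)]], simp)
    show "wave_packet m P Px Py \<delta>"
    proof
      show "(P has_derivative (\<lambda>h. Px z * fst h + Py z * snd h)) (at z)" for z
        by (rule has_derivative_real_partials[OF dP Ck_on_imp_continuous_on[OF smooth(3)]])
      \<comment> \<open>The data vanish on the half-line up to \<open>- \<delta>\<close>, so the
        localised bound holds there with constant 0.\<close>
      show "P (x, y) = 0 \<and> Px (x, y) = 0 \<and> Py (x, y) = 0" if "x \<le> - \<delta>" for x y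
        using b[of "{..- \<delta>}" x 0 y] that by (simp add: is_interval_ic)
      fix x y :: real assume x: "- \<delta> \<le> x" "x \<le> 0"
      have F: "\<bar>flat 0 (s + \<delta>)\<bar> \<le> flat 0 \<delta>" if "s \<in> {- \<delta>..0}" for s
        using flat_0_mono[of "s + \<delta>" \<delta>] flat_nonneg[of 0 "s + \<delta>"] that by simp
      have w: "exp (3 * (\<bar>x - - \<delta>\<bar> + \<bar>y - 0\<bar>)) \<le> exp (3 * (\<delta> + \<bar>y\<bar>))" using x by simp
      have up: "c * flat 0 \<delta> * exp (3 * (\<bar>x - - \<delta>\<bar> + \<bar>y - 0\<bar>)) \<le> c * flat 0 \<delta> * exp (3 * (\<delta> + \<bar>y\<bar>))"
        if "c \<ge> 0" for c
        by (rule mult_left_mono[OF w]) (use that flat_nonneg in simp)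
      from b[of "{- \<delta>..0}" x "flat 0 \<delta>" y] x F d
      show "\<bar>P (x, y)\<bar> \<le> 2 * flat 0 \<delta> * exp (3 * (\<delta> + \<bar>y\<bar>)) \<and>
       \<bar>Px (x, y) - flat 2 (x + \<delta>)\<bar> \<le> 3 * flat 0 \<delta> * exp (3 * (\<delta> + \<bar>y\<bar>)) \<and>
       \<bar>Py (x, y)\<bar> \<le> 3 * flat 0 \<delta> * exp (3 * (\<delta> + \<bar>y\<bar>))"
        using up[of 2] up[of 3] by (fastforce simp: is_interval_cc)
    qed (use m d smooth[THEN Ck_on_imp_continuous_on] in auto)
  qed (use smooth in auto)
qed

section \<open>Size, energy and flux of a thin packet\<close>

lemma kU_bounds:
  assumes "m > 0" "r \<ge> 2 * m"
  shows "kU m (t, r) \<le> 0"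
    and "kU m (t, r) \<le> - ((r - 2 * m) / (2 * m) * exp (- t / (4 * m)))"
proof -
  have U: "kU m (t, r) = - ((r - 2 * m) / (2 * m) * exp ((r - t) / (4 * m)))"
    using assms by (simp add: kU_def field_simps)
  show "kU m (t, r) \<le> 0"
    unfolding U using assms by (simp add: mult_nonneg_nonneg)
  show "kU m (t, r) \<le> - ((r - 2 * m) / (2 * m) * exp (- t / (4 * m)))"
    unfolding U using assms by (intro le_imp_neg_le mult_left_mono) (auto simp: diff_divide_distrib)
qed

lemma kUr_bounds:
  assumes "m > 0" "2 * m \<le> r" "r \<le> R"
  shows "- kUr m (t, 2 * m) \<le> - kUr m (t, r)" "- kUr m (t, r) \<le> - kUr m (t, R)"
proof -
  have "- kUr m (t, a) \<le> - kUr m (t, b)" if "0 \<le> a" "a \<le> b" for a b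
  proof -
    have "(1 + a / (2 * m)) / (4 * m) * exp ((a - t) / (4 * m)) \<le> (1 + b / (2 * m)) / (4 * m) * exp ((b - t) / (4 * m))"
      using assms that by (intro mult_mono divide_right_mono) (auto simp: divide_right_mono)
    then show ?thesis by (simp add: kUr_def)
  qed
  then show "- kUr m (t, 2 * m) \<le> - kUr m (t, r)" "- kUr m (t, r) \<le> - kUr m (t, R)"
    using assms by simp_all
qed

text \<open>The redshift factor: between the times 0 and \<tau> this value drops by the factor
  \<open>exp (- \<tau> / 4m)\<close>.\<close>

lemma kUr_horizon: "m > 0 \<Longrightarrow> - kUr m (t, 2 * m) = exp ((2 * m - t) / (4 * m)) / (2 * m)"
  by (simp add: kUr_def)

text \<open>On the slice \<open>t\<^sup>* = t\<close> the region \<open>- \<delta> \<le> U \<le> 0\<close> lies in \<open>2 m \<le> r \<le> packet_end m t \<delta>\<close>.\<close>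

definition packet_end :: "real \<Rightarrow> real \<Rightarrow> real \<Rightarrow> real" where
  "packet_end m t \<delta> = 2 * m + 2 * m * \<delta> * exp (t / (4 * m))"

text \<open>The constant of \<open>uniform_bounds\<close>, taken at the end of the packet of width
  1, where V is largest; it does not depend on \<delta>.\<close>

definition amplitude_bound :: "real \<Rightarrow> real \<Rightarrow> real" where
  "amplitude_bound m t = 3 * exp (3 * (1 + kV m (t, packet_end m t 1)))"

text \<open>Bounds the terms besides the leading one, per unit of \<open>flat 0 \<delta>\<close>:
  the deviation of \<open>Px\<close> from the data, the term with \<open>Py\<close>, and the term of
  size \<open>P / r\<close>.\<close>

definition remainder_bound :: "real \<Rightarrow> real \<Rightarrow> real" where
  "remainder_bound m t = amplitude_bound m t *
     (- kUr m (t, packet_end m t 1) + kV m (t, packet_end m t 1) / (4 * m) + 1 / (2 * m))"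

text \<open>The error relative to I. Its terms are the loss in Young's inequality, the variation of
  the radial derivative of U across the packet, and the squared remainder times an upper bound for
  the length of the packet.\<close>

definition energy_error :: "real \<Rightarrow> real \<Rightarrow> real \<Rightarrow> real" where
  "energy_error m t \<delta> = 4 * pi * ((\<delta> * - kUr m (t, packet_end m t 1)
      + (kUr m (t, 2 * m) - kUr m (t, packet_end m t \<delta>)))
      + 4 * \<delta> * (remainder_bound m t)\<^sup>2 * (packet_end m t 1 - 2 * m))"

lemma continuous_on_kruskal_coords:
  assumes "m > 0"
  shows "continuous_on S (kU m)" "continuous_on S (kV m)" "continuous_on S (kUr m)"
  using kU_has_derivative[OF assms] kV_has_derivative[OF assms] kUr_has_derivative[OF assms]
  by (auto intro!: continuous_at_imp_continuous_on has_derivative_continuous)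

lemma energy_error_tendsto:
  assumes "m > 0"
  shows "(energy_error m t \<longlongrightarrow> 0) (at_right 0)"
proof -
  have "isCont (energy_error m t) 0"
    unfolding energy_error_def packet_end_def kUr_def using assms by (intro continuous_intros) auto
  moreover have "energy_error m t 0 = 0"
    by (simp add: energy_error_def packet_end_def)
  ultimately show ?thesis
    unfolding isCont_def by (auto intro: tendsto_within_subset)
qed

context wave_packet
begin

text \<open>Young's inequality with weight \<delta> puts a share \<delta> of the cross term on the
  main term. The squared remainder divided by \<delta> is still of order \<open>\<delta> I\<close>,
  because the square of \<open>flat 0 \<delta>\<close> is at most
  \<open>2 \<delta>^2 I\<close>.\<close>

lemma energy_density_estimate:
  assumes r: "2 * m \<le> r" "r \<le> packet_end m t \<delta>"
  defines "Y \<equiv> - kUr m (t, r)" and "f \<equiv> flat 2 (kU m (t, r) + \<delta>)"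
  shows "\<bar>r\<^sup>2 * energy_density (t, r) - (Y * f)\<^sup>2\<bar> \<le> \<delta> * (Y * f)\<^sup>2 + 4 * \<delta> * (remainder_bound m t)\<^sup>2 * flat_energy \<delta>"
proof -
  define F where "F = flat 0 \<delta>"
  have F: "F \<ge> 0" by (simp add: F_def flat_nonneg)
  have R1: "packet_end m t \<delta> \<le> packet_end m t 1"
    using delta m by (simp add: packet_end_def)
  have r0: "r > 0" using r m by simp
  define v V where "v = kV m (t, r)" and "V = kV m (t, packet_end m t 1)"
  define y where "y = (kU m (t, r), v)"
  have v: "0 \<le> v" "v \<le> V" using r R1 m by (auto simp: v_def V_def kV_def divide_right_mono)
  define A where "A = amplitude_bound m t"
  have A: "A \<ge> 0" by (simp add: A_def amplitude_bound_def)
  have b: "\<bar>P y\<bar> \<le> A * F" "\<bar>Px y - f\<bar> \<le> A * F" "\<bar>Py y\<bar> \<le> A * F"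
    using uniform_bounds[OF kU_bounds(1)[OF m r(1)] v[unfolded v_def], of t]
    by (simp_all add: y_def v_def A_def amplitude_bound_def F_def V_def f_def)
  define Ym where "Ym = - kUr m (t, packet_end m t 1)"
  have Y0: "Y \<ge> 0" using m r0 by (simp add: Y_def kUr_def)
  have Ym: "Y \<le> Ym"
    using kUr_bounds(2)[OF m r(1) order_trans[OF r(2) R1]] by (simp add: Y_def Ym_def)
  define B where "B = remainder_bound m t"
  have Beq: "B * F = Ym * (A * F) + (A * F * (V / (4 * m)) + A * F / (2 * m))"
    by (simp add: B_def remainder_bound_def A_def Ym_def V_def algebra_simps)
  have AF: "A * F \<ge> 0" using A F by simp
  have pr: "\<bar>P y / r\<bar> \<le> A * F / (2 * m)"
    using b(1) r m AF by (simp add: abs_divide) (intro frac_le, auto)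
  have hpr: "\<bar>2 * m / r * (P y / r)\<bar> \<le> A * F / (2 * m)"
  proof -
    have "\<bar>2 * m / r * (P y / r)\<bar> = 2 * m / r * \<bar>P y / r\<bar>" using r0 m by (simp add: abs_mult)
    also have "\<dots> \<le> 1 * (A * F / (2 * m))"
      using pr r m r0 by (intro mult_mono) auto
    finally show ?thesis by simp
  qed
  have pv: "\<bar>Py y * (v / (4 * m))\<bar> \<le> A * F * (V / (4 * m))"
    unfolding abs_mult using b(3) v m AF by (intro mult_mono) (auto simp: divide_right_mono)
  define e where "e = Y * (Px y - f)"
  have e: "\<bar>e\<bar> \<le> Ym * (A * F)"
    unfolding e_def abs_mult using b(2) Y0 Ym by (intro mult_mono) auto
  \<comment> \<open>The sign inside both squares is reversed, so that the main term is
    \<open>Y * f\<close> with \<open>Y \<ge> 0\<close>.\<close>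
  define e1 e2 where "e1 = e + (Py y * (v / (4 * m)) + 2 * m / r * (P y / r))"
    and "e2 = e - (Py y * (v / (4 * m)) - P y / r)"
  have eb: "\<bar>e1\<bar> \<le> B * F" "\<bar>e2\<bar> \<le> B * F"
    using e pv hpr pr unfolding e1_def e2_def Beq by linarith+
  have re: "r\<^sup>2 * energy_density (t, r) = 1 / 2 * ((Y * f + e1)\<^sup>2 + (Y * f + e2)\<^sup>2)"
    unfolding energy_density_kruskal[OF r0] v_def[symmetric] y_def[symmetric] e1_def e2_def e_def Y_def
    by (simp add: power2_eq_square algebra_simps)
  \<comment> \<open>The constant 4 is 2 from the cross term plus 2 from the square itself, where
    \<open>\<delta> \<le> 1\<close> is used for the latter.\<close>
  have young: "\<bar>(Y * f + x)\<^sup>2 - (Y * f)\<^sup>2\<bar> \<le> \<delta> * (Y * f)\<^sup>2 + 4 * \<delta> * B\<^sup>2 * flat_energy \<delta>"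
    if x: "\<bar>x\<bar> \<le> B * F" for x
  proof -
    define I where "I = flat_energy \<delta>"
    have F2: "F\<^sup>2 \<le> 2 * \<delta>\<^sup>2 * I" "I > 0"
      using flat_energy_bound[OF delta(1)] by (auto simp: F_def I_def)
    have "x\<^sup>2 \<le> (B * F)\<^sup>2" using power_mono[OF x, of 2] by simp
    also have "\<dots> \<le> B\<^sup>2 * (2 * \<delta>\<^sup>2 * I)"
      unfolding power_mult_distrib by (intro mult_left_mono F2) simp
    finally have x2: "x\<^sup>2 \<le> 2 * \<delta>\<^sup>2 * (B\<^sup>2 * I)" by (simp add: mult_ac)
    have "2 * \<bar>Y * f * x\<bar> \<le> \<delta> * (Y * f)\<^sup>2 + x\<^sup>2 / \<delta>"
    proof -
      have "0 \<le> (\<delta> * \<bar>Y * f\<bar> - \<bar>x\<bar>)\<^sup>2" by simp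
      then have "\<delta> * (2 * (\<bar>Y * f\<bar> * \<bar>x\<bar>)) \<le> \<delta> * (\<delta> * (Y * f)\<^sup>2 + x\<^sup>2 / \<delta>)"
        using delta by (simp add: power2_diff power_mult_distrib power2_eq_square algebra_simps)
      then show ?thesis using delta by (simp add: abs_mult)
    qed
    moreover have "x\<^sup>2 / \<delta> \<le> 2 * \<delta> * (B\<^sup>2 * I)"
      using x2 delta by (simp add: divide_simps power2_eq_square mult_ac)
    moreover have "x\<^sup>2 \<le> 2 * \<delta> * (B\<^sup>2 * I)"
    proof -
      have "\<delta>\<^sup>2 * (B\<^sup>2 * I) \<le> \<delta> * (B\<^sup>2 * I)"
        using delta F2 by (intro mult_right_mono) (auto simp: power2_eq_square mult_left_le)
      then show ?thesis using x2 by linarith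
    qed
    moreover have "\<bar>(Y * f + x)\<^sup>2 - (Y * f)\<^sup>2\<bar> \<le> 2 * \<bar>Y * f * x\<bar> + x\<^sup>2"
    proof -
      have "(Y * f + x)\<^sup>2 - (Y * f)\<^sup>2 = 2 * (Y * f * x) + x\<^sup>2"
        by (simp add: power2_eq_square algebra_simps)
      then show ?thesis using zero_le_power2[of x] by linarith
    qed
    ultimately show ?thesis unfolding I_def by linarith
  qed
  have avg: "\<bar>1 / 2 * (a + b) - c\<bar> \<le> k" if "\<bar>a - c\<bar> \<le> k" "\<bar>b - c\<bar> \<le> k" for a b c k :: real
    using that by (auto simp: abs_le_iff field_simps)
  show ?thesis
    unfolding re B_def[symmetric] by (rule avg[OF young[OF eb(1)] young[OF eb(2)]])
qed

text \<open>The time dependence of the main term sits entirely in the horizon value of the radial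
  derivative of U; the integral it multiplies is \<open>flat_energy \<delta>\<close> for every
  \<open>t\<close>.\<close>

lemma energy_estimate:
  "\<bar>energy m t field - 4 * pi * (exp ((2 * m - t) / (4 * m)) / (2 * m)) * flat_energy \<delta>\<bar>
    \<le> energy_error m t \<delta> * flat_energy \<delta>"
proof -
  define I R where "I = flat_energy \<delta>" and "R = packet_end m t \<delta>"
  have I: "I > 0" using flat_energy_bound(2)[OF delta(1)] by (simp add: I_def)
  have R: "2 * m \<le> R" "R \<le> packet_end m t 1"
    using delta m by (auto simp: R_def packet_end_def)
  define Y where "Y r = - kUr m (t, r)" for r
  \<comment> \<open>Only one of the two factors \<open>Y\<close> is kept: \<open>Y dr = - dU\<close>
    makes \<open>g\<close> an exact derivative in \<open>r\<close>, with integral I. The other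
    factor is compared with its horizon value \<Lambda>.\<close>
  define g where "g r = Y r * (flat 2 (kU m (t, r) + \<delta>))\<^sup>2" for r
  define \<Lambda> where "\<Lambda> = Y (2 * m)"
  define B where "B = (remainder_bound m t)\<^sup>2"
  have Y: "\<Lambda> \<le> Y r" "Y r \<le> Y R" if "r \<in> {2 * m..R}" for r
    using kUr_bounds[OF m, of r R t] that by (auto simp: Y_def \<Lambda>_def)
  have l0: "\<Lambda> \<ge> 0" using m by (simp add: \<Lambda>_def Y_def kUr_def)
  have out: "kU m (t, r) \<le> - \<delta>" if "r \<ge> R" for r
  proof -
    have "\<delta> = 2 * m * \<delta> * exp (t / (4 * m)) / (2 * m) * exp (- t / (4 * m))"
      using m by (simp add: exp_add[symmetric] mult.assoc)
    also have "\<dots> \<le> (r - 2 * m) / (2 * m) * exp (- t / (4 * m))"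
      using that m by (intro mult_right_mono divide_right_mono) (auto simp: R_def packet_end_def)
    also have "\<dots> \<le> - kU m (t, r)"
      using kU_bounds(2)[OF m, of r t] that R by simp
    finally show ?thesis by simp
  qed
  have slice: "continuous_on S (\<lambda>r. h (t, r))" if "continuous_on UNIV h" for S and h :: "real \<times> real \<Rightarrow> real"
    by (rule continuous_on_compose2[OF that _ subset_UNIV]) (intro continuous_intros)
  note cU = slice[OF continuous_on_kruskal_coords(1)[OF m]] and cV = slice[OF continuous_on_kruskal_coords(2)[OF m]]
    and cUr = slice[OF continuous_on_kruskal_coords(3)[OF m]]
  have comp: "continuous_on S (\<lambda>r. h (kU m (t, r), kV m (t, r)))" if "continuous_on UNIV h"
    for S and h :: "real \<times> real \<Rightarrow> real"
    by (rule continuous_on_compose2[OF that _ subset_UNIV]) (intro continuous_intros cU cV)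
  have cont_e: "continuous_on {2 * m..R} (\<lambda>r. energy_density (t, r))"
  proof (rule continuous_on_eq)
    show "continuous_on {2 * m..R} (\<lambda>r. 1 / 2 *
      ((kUr m (t, r) * Px (kU m (t, r), kV m (t, r)) - (Py (kU m (t, r), kV m (t, r)) * (kV m (t, r) / (4 * m))
          + 2 * m / r * (P (kU m (t, r), kV m (t, r)) / r)))\<^sup>2
     + (kUr m (t, r) * Px (kU m (t, r), kV m (t, r)) + (Py (kU m (t, r), kV m (t, r)) * (kV m (t, r) / (4 * m))
          - P (kU m (t, r), kV m (t, r)) / r))\<^sup>2) / r\<^sup>2)"
      using m by (intro continuous_intros cUr cV comp cont) auto
  next
    fix r assume "r \<in> {2 * m..R}"
    then have r0: "r > 0" using m by auto
    show "1 / 2 *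
      ((kUr m (t, r) * Px (kU m (t, r), kV m (t, r)) - (Py (kU m (t, r), kV m (t, r)) * (kV m (t, r) / (4 * m))
          + 2 * m / r * (P (kU m (t, r), kV m (t, r)) / r)))\<^sup>2
     + (kUr m (t, r) * Px (kU m (t, r), kV m (t, r)) + (Py (kU m (t, r), kV m (t, r)) * (kV m (t, r) / (4 * m))
          - P (kU m (t, r), kV m (t, r)) / r))\<^sup>2) / r\<^sup>2 = energy_density (t, r)"
      unfolding energy_density_kruskal[OF r0, symmetric] using r0 by simp
  qed
  have zero: "energy_density (t, r) = 0" if "r > R" for r
  proof -
    have "r > 0" using that R m by simp
    from energy_density_kruskal[OF this, of t] vanish[OF out[of r], of "kV m (t, r)"] that this
    show ?thesis by simp
  qed
  have E: "energy m t field = 4 * pi * integral {2 * m..R} (\<lambda>r. r\<^sup>2 * energy_density (t, r))"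
    unfolding energy_field[OF m] using m R by (intro radial_integral cont_e zero) auto
  have gI: "(g has_integral I) {2 * m..R}"
  proof -
    have "((\<lambda>r. - flat_energy (kU m (t, r) + \<delta>)) has_vector_derivative g r) (at r within {2 * m..R})" for r
    proof -
      have "((\<lambda>r. kU m (t, r)) has_real_derivative kUr m (t, r)) (at r)"
        using frechet_derivative_partials(2)[OF kU_has_derivative[OF m, of "(t, r)"]] by simp
      then have "((\<lambda>r. kU m (t, r) + \<delta>) has_real_derivative kUr m (t, r)) (at r)"
        by (auto intro!: derivative_eq_intros)
      from DERIV_chain2[OF flat_energy_has_derivative this]
      have "((\<lambda>r. - flat_energy (kU m (t, r) + \<delta>)) has_real_derivative g r) (at r)"
        by (auto intro!: derivative_eq_intros simp: g_def Y_def)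
      then show ?thesis
        by (simp add: has_real_derivative_iff_has_vector_derivative has_vector_derivative_at_within)
    qed
    then have "(g has_integral - flat_energy (kU m (t, R) + \<delta>) - - flat_energy (kU m (t, 2 * m) + \<delta>)) {2 * m..R}"
      by (intro fundamental_theorem_of_calculus R)
    moreover have "flat_energy (kU m (t, R) + \<delta>) = 0"
      using out[of R] by (simp add: flat_energy_def)
    moreover have "kU m (t, 2 * m) = 0" using m by (simp add: kU_def)
    ultimately show ?thesis by (simp add: I_def)
  qed
  define k where "k = \<delta> * Y (packet_end m t 1) + (Y R - \<Lambda>)"
  have point: "\<bar>r\<^sup>2 * energy_density (t, r) - \<Lambda> * g r\<bar> \<le> k * g r + 4 * \<delta> * B * I"
    if r: "r \<in> {2 * m..R}" for r
  proof -
    have f: "(Y r * flat 2 (kU m (t, r) + \<delta>))\<^sup>2 = Y r * g r"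
      by (simp add: g_def power_mult_distrib power2_eq_square mult_ac)
    have g0: "g r \<ge> 0" using Y[OF r] l0 by (simp add: g_def)
    have Y1: "Y r \<le> Y (packet_end m t 1)"
      using kUr_bounds(2)[OF m, of r "packet_end m t 1" t] r R by (auto simp: Y_def)
    have 1: "\<bar>r\<^sup>2 * energy_density (t, r) - Y r * g r\<bar> \<le> \<delta> * (Y r * g r) + 4 * \<delta> * B * I"
      using energy_density_estimate[of r t] r f by (simp add: R_def Y_def B_def I_def)
    have 2: "\<delta> * (Y r * g r) \<le> \<delta> * Y (packet_end m t 1) * g r"
      using mult_right_mono[OF Y1 g0] delta by (simp add: mult_left_mono mult.assoc)
    have 3: "\<bar>Y r * g r - \<Lambda> * g r\<bar> \<le> (Y R - \<Lambda>) * g r"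
      using Y[OF r] g0 by (simp add: left_diff_distrib[symmetric] abs_mult mult_right_mono)
    from 1 2 3 show ?thesis unfolding k_def distrib_right by linarith
  qed
  have ie: "(\<lambda>r. r\<^sup>2 * energy_density (t, r)) integrable_on {2 * m..R}"
    by (intro integrable_continuous_interval continuous_intros cont_e)
  have lg: "((\<lambda>r. \<Lambda> * g r) has_integral \<Lambda> * I) {2 * m..R}"
    by (rule has_integral_mult_right[OF gI])
  have bnd: "((\<lambda>r. k * g r + 4 * \<delta> * B * I) has_integral k * I + 4 * \<delta> * B * I * (R - 2 * m)) {2 * m..R}"
    using has_integral_add[OF has_integral_mult_right[OF gI, of k] has_integral_const_real[of "4 * \<delta> * B * I" "2 * m" R]] R
    by (simp add: mult.commute)
  have "\<bar>integral {2 * m..R} (\<lambda>r. r\<^sup>2 * energy_density (t, r)) - \<Lambda> * I\<bar>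
      = norm (integral {2 * m..R} (\<lambda>r. r\<^sup>2 * energy_density (t, r) - \<Lambda> * g r))"
    unfolding integral_diff[OF ie has_integral_integrable[OF lg]] integral_unique[OF lg] by simp
  also have "\<dots> \<le> integral {2 * m..R} (\<lambda>r. k * g r + 4 * \<delta> * B * I)"
    by (rule integral_norm_bound_integral[OF integrable_diff[OF ie has_integral_integrable[OF lg]]
          has_integral_integrable[OF bnd]]) (use point in auto)
  also have "\<dots> = k * I + 4 * \<delta> * B * I * (R - 2 * m)" by (rule integral_unique[OF bnd])
  also have "\<dots> \<le> k * I + 4 * \<delta> * B * I * (packet_end m t 1 - 2 * m)"
    using R delta I by (intro add_left_mono mult_left_mono) (auto simp: B_def)
  finally have fin: "\<bar>integral {2 * m..R} (\<lambda>r. r\<^sup>2 * energy_density (t, r)) - \<Lambda> * I\<bar>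
      \<le> k * I + 4 * \<delta> * B * I * (packet_end m t 1 - 2 * m)" .
  have lam: "exp ((2 * m - t) / (4 * m)) / (2 * m) = \<Lambda>"
    using kUr_horizon[OF m] by (simp add: \<Lambda>_def Y_def)
  have err: "energy_error m t \<delta> * I = 4 * pi * (k * I + 4 * \<delta> * B * I * (packet_end m t 1 - 2 * m))"
    by (simp add: energy_error_def k_def Y_def \<Lambda>_def R_def B_def algebra_simps)
  have "\<bar>4 * pi * integral {2 * m..R} (\<lambda>r. r\<^sup>2 * energy_density (t, r)) - 4 * pi * \<Lambda> * I\<bar>
      = 4 * pi * \<bar>integral {2 * m..R} (\<lambda>r. r\<^sup>2 * energy_density (t, r)) - \<Lambda> * I\<bar>"
    by (simp add: abs_mult mult.assoc flip: right_diff_distrib)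
  then show ?thesis
    unfolding E lam I_def[symmetric] err using mult_left_mono[OF fin, of "4 * pi"] by simp
qed

text \<open>On the horizon \<open>U = 0\<close>, which removes the large derivative
  \<open>Px\<close>. What is left is \<open>Py\<close>, of size \<open>flat 0 \<delta>\<close>, and
  the area factor cancels the factor \<open>1 / r^2\<close> of the squared field.\<close>

lemma horizon_flux_estimate:
  "horizon_flux m \<tau> field \<le> 2 * \<delta>\<^sup>2 * (amplitude_bound m \<tau> * kV m (\<tau>, 2 * m) / (4 * m))\<^sup>2
     * measure lborel ({0..\<tau>} \<times> {0..pi} \<times> {0..2 * pi}) * flat_energy \<delta>"
proof -
  define F where "F = flat 0 \<delta>"
  define C where "C = amplitude_bound m \<tau> * kV m (\<tau>, 2 * m) / (4 * m)"
  define A :: "(real \<times> real \<times> real) set" where "A = {0..\<tau>} \<times> {0..pi} \<times> {0..2 * pi}"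
  define \<Phi>t where "\<Phi>t t = (Px (kU m (t, 2 * m), kV m (t, 2 * m)) * (- kU m (t, 2 * m) / (4 * m))
      + Py (kU m (t, 2 * m), kV m (t, 2 * m)) * (kV m (t, 2 * m) / (4 * m))) / (2 * m)" for t
  have pt: "(\<Phi>t t)\<^sup>2 * ((2 * m)\<^sup>2 * sin \<theta>) \<le> (C * F)\<^sup>2" if "t \<in> {0..\<tau>}" for t \<theta>
  proof -
    define v where "v = kV m (t, 2 * m)"
    have U: "kU m (t, 2 * m) = 0" using m by (simp add: kU_def)
    have v: "0 \<le> v" "v \<le> kV m (\<tau>, 2 * m)" "kV m (\<tau>, 2 * m) \<le> kV m (\<tau>, packet_end m \<tau> 1)"
      using that m by (auto simp: v_def kV_def divide_right_mono packet_end_def)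
    have b: "\<bar>Py (0, v)\<bar> \<le> amplitude_bound m \<tau> * F"
      using uniform_bounds(3)[of 0 v] v unfolding amplitude_bound_def F_def by simp
    have AF: "amplitude_bound m \<tau> * F \<ge> 0"
      using b by linarith
    have "\<bar>2 * m * \<Phi>t t\<bar> = \<bar>Py (0, v)\<bar> * (v / (4 * m))"
      using m v by (simp add: \<Phi>t_def U v_def[symmetric] abs_mult)
    also have "\<dots> \<le> amplitude_bound m \<tau> * F * (kV m (\<tau>, 2 * m) / (4 * m))"
      using b v m AF by (intro mult_mono divide_right_mono) auto
    finally have "\<bar>2 * m * \<Phi>t t\<bar> \<le> C * F" by (simp add: C_def mult_ac)
    from power_mono[OF this, of 2] have "(2 * m * \<Phi>t t)\<^sup>2 \<le> (C * F)\<^sup>2" by simp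
    moreover have "(2 * m * \<Phi>t t)\<^sup>2 * sin \<theta> \<le> (2 * m * \<Phi>t t)\<^sup>2 * 1" by (intro mult_left_mono) auto
    ultimately show ?thesis by (simp add: power_mult_distrib mult_ac)
  qed
  define G where "G = (\<lambda>(t, \<theta>, \<phi>::real). (\<Phi>t t)\<^sup>2 * ((2 * m)\<^sup>2 * sin \<theta>))"
  have A: "A \<in> sets lborel" "emeasure lborel A < \<infinity>"
  proof -
    have "compact A" unfolding A_def by (intro compact_Times compact_Icc)
    then show "A \<in> sets lborel" "emeasure lborel A < \<infinity>"
      using emeasure_bounded_finite[OF compact_imp_bounded] by (simp_all add: borel_compact)
  qed
  have flux: "horizon_flux m \<tau> field = (LINT x : A | lborel. G x)"
    unfolding horizon_flux_field[OF m] G_def A_def \<Phi>t_def by simp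
  have "(LINT x : A | lborel. G x) \<le> (C * F)\<^sup>2 * measure lborel A"
  proof (cases "set_integrable lborel A G")
    case True
    have "(LINT x : A | lborel. G x) \<le> (LINT x : A | lborel. (C * F)\<^sup>2)"
      by (rule set_integral_mono[OF True])
        (use A pt in \<open>auto simp: G_def A_def set_integrable_def\<close>)
    also have "\<dots> = (C * F)\<^sup>2 * measure lborel A"
      using A by (simp add: set_lebesgue_integral_def)
    finally show ?thesis .
  next
    \<comment> \<open>The integral of a non-integrable function is 0 by convention and the bound is
      nonnegative, so integrability need not be established.\<close>
    case False
    then have "(LINT x : A | lborel. G x) = 0"
      unfolding set_integrable_def set_lebesgue_integral_def by (rule not_integrable_integral_eq)
    then show ?thesis by simp
  qed
  also have "\<dots> \<le> (C\<^sup>2 * (2 * \<delta>\<^sup>2 * flat_energy \<delta>)) * measure lborel A"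
    unfolding power_mult_distrib F_def
    by (intro mult_right_mono mult_left_mono flat_energy_bound(1)[OF delta(1)]) auto
  finally show ?thesis unfolding flux by (simp add: A_def C_def mult_ac)
qed

end

section \<open>Choice of the packet width and normalisation\<close>

theorem proposition3p3:
  fixes m :: real
  assumes "m > 0"
  shows "\<forall>\<mu>>0. \<forall>\<tau>>0. \<exists>v :: real ^ 4 \<Rightarrow> complex.
    smooth_on (closed_dep_Sigma0 m) v \<and>
    (\<forall>p \<in> closed_dep_Sigma0 m. wave_op (schw m) v p = 0) \<and>
    energy m \<tau> v = 1 \<and>
    horizon_flux m \<tau> v < \<mu> \<and>
    energy m 0 v \<ge> exp (surface_gravity m * \<tau>) - \<mu>"
proof (intro allI impI)
  fix \<mu> \<tau> :: real assume mu: "\<mu> > 0" and tau: "\<tau> > 0"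
  \<comment> \<open>The limit, as the width tends to 0, of the energy at time \<open>t\<close>
    divided by I.\<close>
  define l where "l t = 4 * pi * (exp ((2 * m - t) / (4 * m)) / (2 * m))" for t
  \<comment> \<open>Here \<kappa> is the whole amplification factor, not the surface
    gravity.\<close>
  define \<kappa> where "\<kappa> = exp (surface_gravity m * \<tau>)"
  define D where "D \<delta> = 2 * \<delta>\<^sup>2 * (amplitude_bound m \<tau> * kV m (\<tau>, 2 * m) / (4 * m))\<^sup>2
     * measure lborel ({0..\<tau>} \<times> {0..pi} \<times> {0..2 * pi})" for \<delta>
  have l: "l t > 0" for t using assms by (simp add: l_def)
  have l0: "l 0 = \<kappa> * l \<tau>"
    using assms by (simp add: l_def \<kappa>_def surface_gravity_def exp_add[symmetric] add_divide_distrib[symmetric])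
  note lim = energy_error_tendsto[OF assms]
  have D0: "(D \<longlongrightarrow> 0) (at_right 0)"
  proof -
    have "isCont D 0" unfolding D_def by (intro continuous_intros)
    moreover have "D 0 = 0" by (simp add: D_def)
    ultimately show ?thesis unfolding isCont_def by (auto intro: tendsto_within_subset)
  qed
  \<comment> \<open>Three conditions on the width follow, each with a positive limit: positive final
    energy, flux below \<mu> times the final energy, and the lower bound for the initial
    energy.\<close>
  have "((\<lambda>\<delta>. l \<tau> - energy_error m \<tau> \<delta>) \<longlongrightarrow> l \<tau> - 0) (at_right 0)"
    by (intro tendsto_intros lim)
  then have 1: "\<forall>\<^sub>F \<delta> in at_right 0. 0 < l \<tau> - energy_error m \<tau> \<delta>"
    by (rule order_tendstoD) (use l[of \<tau>] in simp)
  have "((\<lambda>\<delta>. \<mu> * (l \<tau> - energy_error m \<tau> \<delta>) - D \<delta>) \<longlongrightarrow> \<mu> * (l \<tau> - 0) - 0) (at_right 0)"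
    by (intro tendsto_intros lim D0)
  then have 2: "\<forall>\<^sub>F \<delta> in at_right 0. 0 < \<mu> * (l \<tau> - energy_error m \<tau> \<delta>) - D \<delta>"
    by (rule order_tendstoD) (use l[of \<tau>] mu in simp)
  \<comment> \<open>The limit is \<open>\<mu> * l \<tau>\<close>. The absolute value covers both
    signs of \<open>\<kappa> - \<mu>\<close>, for which opposite bounds of the final energy are
    relevant.\<close>
  have "((\<lambda>\<delta>. (l 0 - energy_error m 0 \<delta>) - ((\<kappa> - \<mu>) * l \<tau> + \<bar>\<kappa> - \<mu>\<bar> * energy_error m \<tau> \<delta>)) \<longlongrightarrow>
      (l 0 - 0) - ((\<kappa> - \<mu>) * l \<tau> + \<bar>\<kappa> - \<mu>\<bar> * 0)) (at_right 0)"
    by (intro tendsto_intros lim)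
  then have 3: "\<forall>\<^sub>F \<delta> in at_right 0. 0 < (l 0 - energy_error m 0 \<delta>) - ((\<kappa> - \<mu>) * l \<tau> + \<bar>\<kappa> - \<mu>\<bar> * energy_error m \<tau> \<delta>)"
    by (rule order_tendstoD) (use l[of \<tau>] mu in \<open>simp add: l0 algebra_simps\<close>)
  have 4: "\<forall>\<^sub>F \<delta> in at_right (0::real). 0 < \<delta> \<and> \<delta> \<le> 1"
    unfolding eventually_at_right_field by (intro exI[of _ 1]) auto
  obtain \<delta> where d: "0 < \<delta>" "\<delta> \<le> 1" and h1: "0 < l \<tau> - energy_error m \<tau> \<delta>"
    and h2: "0 < \<mu> * (l \<tau> - energy_error m \<tau> \<delta>) - D \<delta>"
    and h3: "0 < (l 0 - energy_error m 0 \<delta>) - ((\<kappa> - \<mu>) * l \<tau> + \<bar>\<kappa> - \<mu>\<bar> * energy_error m \<tau> \<delta>)"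
    using eventually_happens[OF eventually_conj[OF eventually_conj[OF 1 2] eventually_conj[OF 3 4]]] by auto
  obtain P Px Py Pxx Pyy where wp: "wave_packet m P Px Py \<delta>"
    and smooth: "\<And>k. Ck_on k UNIV P"
    and Px': "\<And>z. (Px has_derivative (\<lambda>h. Pxx z * fst h + potential (fst z * snd z) * P z * snd h)) (at z)"
    and Py': "\<And>z. (Py has_derivative (\<lambda>h. potential (fst z * snd z) * P z * fst h + Pyy z * snd h)) (at z)"
    using wave_packet_exists[OF assms d] by blast
  interpret W: wave_packet m P Px Py \<delta> by (rule wp)
  define I where "I = flat_energy \<delta>"
  have I: "I > 0" using flat_energy_bound(2)[OF d(1)] by (simp add: I_def)
  have E: "\<bar>energy m t W.field - l t * I\<bar> \<le> energy_error m t \<delta> * I" for t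
    using W.energy_estimate[of t] by (simp add: l_def I_def)
  have fl: "horizon_flux m \<tau> W.field \<le> D \<delta> * I"
    using W.horizon_flux_estimate by (simp add: D_def I_def)
  define e where "e = energy m \<tau> W.field"
  have elow: "(l \<tau> - energy_error m \<tau> \<delta>) * I \<le> e"
    using E[of \<tau>] by (simp add: e_def left_diff_distrib abs_le_iff)
  have epos: "e > 0" using elow h1 I mult_pos_pos[OF h1 I] by linarith
  define c where "c = 1 / sqrt e"
  have c2: "c\<^sup>2 = 1 / e" using epos by (simp add: c_def power_divide)
  interpret S: kruskal_field m "\<lambda>z. c * P z" "\<lambda>z. c * Px z" "\<lambda>z. c * Py z"
    by (rule W.scaled_field(1))
  show "\<exists>v. smooth_on (closed_dep_Sigma0 m) v \<and>
    (\<forall>p \<in> closed_dep_Sigma0 m. wave_op (schw m) v p = 0) \<and> energy m \<tau> v = 1 \<and>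
    horizon_flux m \<tau> v < \<mu> \<and> energy m 0 v \<ge> exp (surface_gravity m * \<tau>) - \<mu>"
  proof (intro exI[of _ S.field] conjI ballI)
    \<comment> \<open>The chart itself is the open neighbourhood. Inside the black hole the field is
      smooth but need not solve the wave equation.\<close>
    have "Ck_on k ingoing_chart S.field" for k
      by (intro S.Ck_on_field Ck_on_mult[OF open_UNIV] Ck_on_const[OF open_UNIV] smooth)
    then show "smooth_on (closed_dep_Sigma0 m) S.field"
      unfolding smooth_on_def using closed_dep_Sigma0_subset(1)[OF assms] open_ingoing_chart by blast
    show "wave_op (schw m) S.field p = 0" if "p \<in> closed_dep_Sigma0 m" for p
    proof (rule S.wave_op_kruskal)
      show "radius p \<ge> 2 * m" by (rule closed_dep_Sigma0_subset(2)[OF assms that])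
      show "((\<lambda>z. c * Px z) has_derivative (\<lambda>h. c * Pxx z * fst h + potential (fst z * snd z) * (c * P z) * snd h)) (at z)" for z
        using has_derivative_mult_right[OF Px'[of z], of c] by (simp add: algebra_simps)
      show "((\<lambda>z. c * Py z) has_derivative (\<lambda>h. potential (fst z * snd z) * (c * P z) * fst h + c * Pyy z * snd h)) (at z)" for z
        using has_derivative_mult_right[OF Py'[of z], of c] by (simp add: algebra_simps)
    qed
    show "energy m \<tau> S.field = 1"
      unfolding W.scaled_field(2) c2 using epos by (simp add: e_def)
    have "horizon_flux m \<tau> W.field < \<mu> * e"
    proof -
      have "D \<delta> * I < \<mu> * (l \<tau> - energy_error m \<tau> \<delta>) * I" using h2 I by simp
      also have "\<dots> \<le> \<mu> * e" using mult_left_mono[OF elow, of \<mu>] mu by (simp add: mult.assoc)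
      finally show ?thesis using fl by linarith
    qed
    then show "horizon_flux m \<tau> S.field < \<mu>"
      unfolding W.scaled_field(3) c2 using epos by (simp add: divide_less_eq)
    have "(\<kappa> - \<mu>) * e \<le> energy m 0 W.field"
    proof -
      have "(\<kappa> - \<mu>) * (e - l \<tau> * I) \<le> \<bar>\<kappa> - \<mu>\<bar> * (energy_error m \<tau> \<delta> * I)"
        using E[of \<tau>] abs_ge_self[of "(\<kappa> - \<mu>) * (e - l \<tau> * I)"]
          mult_left_mono[of "\<bar>e - l \<tau> * I\<bar>" "energy_error m \<tau> \<delta> * I" "\<bar>\<kappa> - \<mu>\<bar>"]
        by (simp add: e_def abs_mult)
      then have "(\<kappa> - \<mu>) * e \<le> ((\<kappa> - \<mu>) * l \<tau> + \<bar>\<kappa> - \<mu>\<bar> * energy_error m \<tau> \<delta>) * I"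
        by (simp add: algebra_simps)
      also have "\<dots> \<le> (l 0 - energy_error m 0 \<delta>) * I"
        using h3 I by (intro mult_right_mono) auto
      also have "\<dots> \<le> energy m 0 W.field"
        using E[of 0] by (simp add: left_diff_distrib abs_le_iff)
      finally show ?thesis .
    qed
    then show "energy m 0 S.field \<ge> exp (surface_gravity m * \<tau>) - \<mu>"
      unfolding W.scaled_field(2) c2 \<kappa>_def using epos by (simp add: le_divide_eq)
  qed
qed

end
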